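(* Let $S$ be a totally ordered idempotent semifield, let $\kappa$ be a field, and let $\mathrm{val}:\kappa\{t^S\}\to S$ be the standard valuation. Let $E,F$ be finite sets, let $\Lambda\subseteq\kappa\{t^S\}^E$ be a rank $d$ linear subspace, let $L=\mathrm{trop}(\Lambda)\subseteq S^E$, and let $A\in S^{F\times E}$ be a matrix. If $|\kappa|>\binom{|E|+|F|}{d}$, then $\mathrm{tropim}_A(L)$ is realizable over $\kappa\{t^S\}$; indeed, for $\Delta\in\mathrm{val}^{-1}(A)$ with generic leading coefficients (i.e. with leading coefficients lying in a suitable non-empty Zariski open subset of $\kappa^{F\times E}$) we have $$\mathrm{tropim}_A(L)=\mathrm{trop}(\Delta\Lambda).$$
   Context: A totally ordered idempotent semifield $S$ is a commutative semiring (with $0$ and $1$) in which every nonzero element is invertible, $1+1=1$, and the order $a\le b\iff a+b=b$ is total. For a finite set $E$, $S^E$ is the free $S$-module with basis $\{e_i\}_{i\in E}$, with dual basis $\{x_i\}$ of $(S^E)^\vee=\mathrm{Hom}(S^E,S)$. A tropical Plücker vector of rank $d$ on $E$ is a nonzero $w\in S^{\binom Ed}$ with $\sum_{i\in J-K}w_{J-i}w_{K+i}=\sum_{i\in J-K,\,i\ne j}w_{J-i}w_{K+i}$ for all $J\in\binom{E}{d+1}$, $K\in\binom{E}{d-1}$, $j\in J-K$. Its tropical linear space, of rank $d$, is $L_w=\{v\in S^E: \sum_{i\in J}w_{J-i}v_i=\sum_{i\in J,\,i\neq j}w_{J-i}v_i \text{ for all } J\in\binom{E}{d+1},\, j\in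 J\}$. Exterior algebra: $\bigwedge^dS^E$ is free on $e_I$, $I\in\binom Ed$, with $e_I\wedge e_J=e_{I\cup J}$ if $I\cap J=\emptyset$ and $0$ otherwise (no signs). Rank $d$ tropical Plücker vectors are viewed in $\bigwedge^d S^E$. The Hodge star $\star:\bigwedge^dS^E\to\bigwedge^{|E|-d}(S^E)^\vee$ is the linear map $e_I\mapsto x_{E-I}$ (similarly in the other direction), and $u\cdot u'=\star(\star u\wedge\star u')$. Tropical graph and image: let $A=(a_{ji})\in S^{F\times E}$, $F=\{f_1,\dots,f_m\}$, with $y_1,\dots,y_m$ the dual basis of $S^F$, and $\rho_j=\sum_{i\in E}a_{ji}x_i$. The tropical graph of $A$ on $L_w$ is the tropical linear space in $S^{E\sqcup F}$ with Plücker vector $g(w,A)=(w\wedge f_1\wedge\cdots\wedge f_m)\cdot\star(\rho_1+y_1)\cdots\star(\rho_m+y_m)\in\bigwedge^dS^{E\sqcup F}$, where $\star$ and $\cdot$ are taken on $S^{E\sqcup F}$. The tropical image $\mathrm{tropim}_A(L_w)$ is $\pi_F(L_{g(w,A)})$, where $\pi_F:S^{E\sqcup F}\to S^F$ is the coordinate projection; it is a tropical linear space depending only on $L_w$ and $A$ (as $L_w$ determines $w$ up to a scalar in $S^\times$). Realizability: $\kappa\{t^S\}$ is the field of generalized power series $\sum_{s\in T}\alpha_st^s$ with $T\subseteq S^\times$ well-ordered and $\alpha_s\in\kappa$ (so $t^st^{s'}=t^{ss'}$). The standard valuation sends $0$ to $0$ and a nonzero series to the inverse in $S$ of its degree, the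 smallest $s$ with $\alpha_s\ne0$; the leading coefficient of the series is $\alpha_s$ for this $s$ (the zero series has leading coefficient $0$). $\mathrm{val}^{-1}(A)$ is the set of matrices over $\kappa\{t^S\}$ whose entrywise valuation is $A$. For a linear subspace $\Lambda\subseteq\kappa\{t^S\}^E$, $\mathrm{trop}(\Lambda)\subseteq S^E$ is the set of coordinatewise valuations of elements of $\Lambda$; it is the tropical linear space whose Plücker coordinates are the valuations of the Plücker coordinates of $\Lambda$. A tropical linear space is realizable over $\kappa\{t^S\}$ if it equals $\mathrm{trop}(\Lambda')$ for some linear subspace $\Lambda'$. $\Delta\Lambda\subseteq\kappa\{t^S\}^F$ is the image of $\Lambda$ under $\Delta$. *)

theory Defs
  imports Complex_Main "HOL-Library.Function_Algebras" "HOL-Library.Poly_Mapping"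
begin

section \<open>Totally ordered idempotent semifields\<close>

text \<open>
  As for the library's fields, \<open>inverse 0 = 0\<close> is a convention that makes the inversion total;
  it carries no mathematical content.
\<close>

class idem_semifield = comm_semiring_1 + inverse + linorder +
  assumes idem_left_inverse: "a \<noteq> 0 \<Longrightarrow> inverse a * a = 1"
    and idem_inverse_zero: "inverse 0 = 0"
    and idem_divide_inverse: "a / b = a * inverse b"
    and idem_one_plus_one: "1 + 1 = 1"
    and idem_le_iff: "a \<le> b \<longleftrightarrow> a + b = b"
begin

lemma idem_right_inverse: "a \<noteq> 0 \<Longrightarrow> a * inverse a = 1"
  using idem_left_inverse by (simp add: mult.commute)

lemma idem_mult_left_cancel: "c \<noteq> 0 \<Longrightarrow> c * a = c * b \<longleftrightarrow> a = b"
proof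
  assume c: "c \<noteq> 0" and "c * a = c * b"
  then have "inverse c * c * a = inverse c * c * b"
    by (simp add: mult.assoc)
  then show "a = b" using c by (simp add: idem_left_inverse)
qed simp

lemma idem_mult_eq_0_iff: "a * b = 0 \<longleftrightarrow> a = 0 \<or> b = 0"
  using idem_mult_left_cancel[of a b 0] by auto

lemma idem_mult_mono: "a \<le> b \<Longrightarrow> c * a \<le> c * b"
  unfolding idem_le_iff by (simp flip: distrib_left)

lemma idem_mult_less: "c \<noteq> 0 \<Longrightarrow> c * a < c * b \<longleftrightarrow> a < b"
  using idem_mult_mono[of a b c] idem_mult_mono[of b a c] idem_mult_left_cancel[of c a b]
  by (metis not_le order.order_iff_strict)

lemma idem_mult_le: "c \<noteq> 0 \<Longrightarrow> c * a \<le> c * b \<longleftrightarrow> a \<le> b"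
  using idem_mult_less[of c b a] by (simp flip: not_less)

lemma idem_mult_mono2: "a \<le> b \<Longrightarrow> c \<le> d \<Longrightarrow> a * c \<le> b * d"
  using idem_mult_mono[of c d a] idem_mult_mono[of a b d]
  by (simp add: mult.commute)

end


section \<open>Generalized power series\<close>

lemma wfp_on_less_iff:
  "wfp_on A ((<) :: 'a::linorder \<Rightarrow> 'a \<Rightarrow> bool) \<longleftrightarrow> (\<forall>B\<subseteq>A. B \<noteq> {} \<longrightarrow> (\<exists>m\<in>B. \<forall>b\<in>B. m \<le> b))"
  unfolding wfp_on_iff_ex_minimal by (meson not_le)

lemma wfp_on_less_un:
  assumes "wfp_on A ((<) :: 'a::linorder \<Rightarrow> 'a \<Rightarrow> bool)" "wfp_on B (<)"
  shows "wfp_on (A \<union> B) ((<) :: 'a \<Rightarrow> 'a \<Rightarrow> bool)"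
  unfolding wfp_on_less_iff
proof (intro allI impI)
  fix C :: "'a set" assume C: "C \<subseteq> A \<union> B" "C \<noteq> {}"
  show "\<exists>m\<in>C. \<forall>b\<in>C. m \<le> b"
  proof (cases "C \<inter> A = {} \<or> C \<inter> B = {}")
    case True
    then have "C \<subseteq> A \<or> C \<subseteq> B" using C by auto
    then show ?thesis using C assms unfolding wfp_on_less_iff by blast
  next
    case False
    then obtain m n where m: "m \<in> C \<inter> A" "\<forall>b\<in>C\<inter>A. m \<le> b" and n: "n \<in> C \<inter> B" "\<forall>b\<in>C\<inter>B. n \<le> b"
      using assms unfolding wfp_on_less_iff by (metis inf_le2)
    have "min m n \<in> C" using m n by (auto simp: min_def)
    moreover have "\<forall>b\<in>C. min m n \<le> b" using m n C by (auto simp: min_le_iff_disj)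
    ultimately show ?thesis by blast
  qed
qed

lemma finite_if_well_ordered_both:
  fixes A :: "'a::linorder set"
  assumes min: "\<And>B. B \<subseteq> A \<Longrightarrow> B \<noteq> {} \<Longrightarrow> \<exists>m\<in>B. \<forall>b\<in>B. m \<le> b"
    and max: "\<And>B. B \<subseteq> A \<Longrightarrow> B \<noteq> {} \<Longrightarrow> \<exists>m\<in>B. \<forall>b\<in>B. b \<le> m"
  shows "finite A"
proof (rule ccontr)
  assume inf: "infinite A"
  define B where "B = {a\<in>A. infinite {x\<in>A. x \<le> a}}"
  obtain mx where mx: "mx \<in> A" "\<forall>b\<in>A. b \<le> mx" using max[of A] inf by auto
  have "{x\<in>A. x \<le> mx} = A" using mx by auto
  then have "mx \<in> B" using mx inf by (simp add: B_def)
  then obtain m where m: "m \<in> B" "\<forall>b\<in>B. m \<le> b" using min[of B] by (auto simp: B_def)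
  define D where "D = {x\<in>A. x < m}"
  have "{x\<in>A. x \<le> m} = insert m D" using m by (auto simp: D_def B_def)
  then have infD: "infinite D" using m by (auto simp: B_def)
  then have "D \<noteq> {}" by (rule infinite_imp_nonempty)
  moreover have "D \<subseteq> A" by (auto simp: D_def)
  ultimately obtain q where q: "q \<in> D" "\<forall>b\<in>D. b \<le> q" using max[of D] by blast
  have "D \<subseteq> {x\<in>A. x \<le> q}" using q by (auto simp: D_def)
  then have "q \<in> B" using q infD finite_subset by (auto simp: B_def D_def)
  then show False using m q by (auto simp: D_def)
qed

lemma finite_factorizations:
  fixes A B :: "'s::idem_semifield set"
  assumes A: "wfp_on A (<)" "0 \<notin> A" and B: "wfp_on B (<)" "0 \<notin> B"
  shows "finite {(a, b). a \<in> A \<and> b \<in> B \<and> a * b = s}"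
proof -
  define P where "P = {(a, b). a \<in> A \<and> b \<in> B \<and> a * b = s}"
  have inj: "inj_on fst P"
    using A(2) by (auto simp: inj_on_def P_def) (metis idem_mult_left_cancel)
  have "finite (fst ` P)"
  proof (rule finite_if_well_ordered_both)
    fix C assume C: "C \<subseteq> fst ` P" "C \<noteq> {}"
    have "C \<subseteq> A" using C by (auto simp: P_def)
    then show "\<exists>m\<in>C. \<forall>b\<in>C. m \<le> b" using A C unfolding wfp_on_less_iff by blast
    let ?D = "{b. \<exists>a\<in>C. (a, b) \<in> P}"
    have "?D \<subseteq> B" "?D \<noteq> {}" using C by (auto simp: P_def) force
    then obtain n where n: "n \<in> ?D" "\<forall>b\<in>?D. n \<le> b" using B unfolding wfp_on_less_iff by meson
    then obtain a where a: "a \<in> C" "(a, n) \<in> P" by auto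
    have "a' \<le> a" if "a' \<in> C" for a'
    proof (rule ccontr)
      assume na: "\<not> a' \<le> a"
      have "a' \<in> fst ` P" using that C by auto
      then obtain b' where b': "(a', b') \<in> P" by auto
      then have "n \<le> b'" using n that by auto
      then have "a * n \<le> a * b'" by (rule idem_mult_mono)
      moreover have "b' * a < b' * a'" using na b' B by (subst idem_mult_less) (auto simp: P_def)
      ultimately have "a * n < a' * b'" by (simp add: mult.commute)
      then show False using a b' by (auto simp: P_def)
    qed
    then show "\<exists>m\<in>C. \<forall>b\<in>C. b \<le> m" using a by blast
  qed
  then show ?thesis using finite_imageD[OF _ inj] by (simp add: P_def)
qed

lemma wfp_on_products:
  fixes A B :: "'s::idem_semifield set"
  assumes A: "wfp_on A (<)" "0 \<notin> A" and B: "wfp_on B (<)" "0 \<notin> B"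
  shows "wfp_on {a * b | a b. a \<in> A \<and> b \<in> B} (<)"
proof -
  have key: "(a, \<beta>) \<in> Q \<Longrightarrow> Q \<subseteq> A \<times> B \<Longrightarrow> \<forall>q\<in>Q. a \<le> fst q
      \<Longrightarrow> \<exists>m\<in>Q. \<forall>q\<in>Q. fst m * snd m \<le> fst q * snd q" if "\<beta> \<in> B" for \<beta> a Q
    using B(1) that
  proof (induction \<beta> arbitrary: a Q rule: wfp_on_induct)
    case in_set
    show ?case by (rule that)
  next
    case (less \<beta>)
    define Q' where "Q' = {q\<in>Q. fst q * snd q < a * \<beta>}"
    show ?case
    proof (cases "Q' = {}")
      case True
      then show ?thesis using less.prems(1) by (intro bexI[of _ "(a, \<beta>)"]) (auto simp: Q'_def not_less)
    next
      case False
      have "fst ` Q' \<subseteq> A" using less.prems by (auto simp: Q'_def)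
      then obtain a' where a': "a' \<in> fst ` Q'" "\<forall>x\<in>fst ` Q'. a' \<le> x"
        using A(1) False unfolding wfp_on_less_iff by (metis image_is_empty)
      then obtain \<beta>' where q': "(a', \<beta>') \<in> Q'" by auto
      then have in_Q: "(a', \<beta>') \<in> Q" "a' * \<beta>' < a * \<beta>" by (auto simp: Q'_def)
      then have le: "a \<le> a'" "a \<in> A" "\<beta>' \<in> B" using less.prems by auto
      have "\<beta>' < \<beta>"
      proof (rule ccontr)
        assume "\<not> \<beta>' < \<beta>"
        then have "a * \<beta> \<le> a' * \<beta>'" using le by (intro idem_mult_mono2) auto
        then show False using in_Q by simp
      qed
      moreover have "Q' \<subseteq> A \<times> B" "\<forall>q\<in>Q'. a' \<le> fst q" using less.prems a' by (auto simp: Q'_def)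
      ultimately obtain m where m: "m \<in> Q'" "\<forall>q\<in>Q'. fst m * snd m \<le> fst q * snd q"
        using less.IH[OF le(3) _ q'] le(3) by blast
      have "fst m * snd m \<le> fst q * snd q" if "q \<in> Q" for q
        using m that by (cases "q \<in> Q'") (auto simp: Q'_def)
      moreover have "m \<in> Q" using m by (simp add: Q'_def)
      ultimately show ?thesis by blast
    qed
  qed
  show ?thesis
    unfolding wfp_on_less_iff
  proof (intro allI impI)
    fix C assume C: "C \<subseteq> {a * b | a b. a \<in> A \<and> b \<in> B}" "C \<noteq> {}"
    define Q where "Q = {(a, b). a \<in> A \<and> b \<in> B \<and> a * b \<in> C}"
    have "fst ` Q \<subseteq> A" "fst ` Q \<noteq> {}" using C by (auto simp: Q_def)
    then obtain a where a: "a \<in> fst ` Q" "\<forall>x\<in>fst ` Q. a \<le> x"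
      using A(1) unfolding wfp_on_less_iff by meson
    then obtain b where b: "(a, b) \<in> Q" by auto
    have "Q \<subseteq> A \<times> B" by (auto simp: Q_def)
    moreover have "\<forall>q\<in>Q. a \<le> fst q" using a by simp
    ultimately obtain m where m: "m \<in> Q" "\<forall>q\<in>Q. fst m * snd m \<le> fst q * snd q"
      using key[OF _ b] b by blast
    have "fst m * snd m \<le> c" if c: "c \<in> C" for c
    proof -
      have "\<exists>x y. c = x * y \<and> x \<in> A \<and> y \<in> B" using C(1) c by blast
      then obtain x y where "c = x * y" "(x, y) \<in> Q" using c by (auto simp: Q_def)
      then show ?thesis using m by auto
    qed
    then show "\<exists>m\<in>C. \<forall>c\<in>C. m \<le> c" using m by (intro bexI[of _ "fst m * snd m"]) (auto simp: Q_def)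
  qed
qed

text \<open>
  \<open>('s, 'k) hahn\<close> is \<open>\<kappa>{t\<^sup>S}\<close>: a series is given by its coefficient function on \<open>'s\<close>,
  which vanishes at \<open>0\<close> because exponents are taken in \<open>S - {0}\<close>.
\<close>

typedef (overloaded) ('s, 'k) hahn =
  "{f :: 's::idem_semifield \<Rightarrow> 'k::zero. f 0 = 0 \<and> wfp_on {s. f s \<noteq> 0} (<)}"
  morphisms hcoeff Abs_hahn
  by (rule exI[of _ "\<lambda>_. 0"]) (simp add: wfp_on_less_iff)

definition hsupp :: "('s::idem_semifield, 'k::zero) hahn \<Rightarrow> 's set" where
  "hsupp f = {s. hcoeff f s \<noteq> 0}"

lemma in_hsupp_iff [simp]: "s \<in> hsupp f \<longleftrightarrow> hcoeff f s \<noteq> 0"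
  by (simp add: hsupp_def)

lemma hcoeff_0_arg [simp]: "hcoeff f 0 = 0"
  using hcoeff[of f] by simp

lemma wfp_on_hsupp: "wfp_on (hsupp f) (<)"
  using hcoeff[of f] by (simp add: hsupp_def)

lemma zero_notin_hsupp: "0 \<notin> hsupp f"
  by simp

lemma hcoeff_Abs: "f 0 = 0 \<Longrightarrow> wfp_on A (<) \<Longrightarrow> (\<And>s. f s \<noteq> 0 \<Longrightarrow> s \<in> A) \<Longrightarrow> hcoeff (Abs_hahn f) = f"
  by (rule Abs_hahn_inverse) (auto intro: wfp_on_subset)

lemma hahn_eqI: "(\<And>s. hcoeff f s = hcoeff g s) \<Longrightarrow> f = g"
  by (simp add: hcoeff_inject[symmetric] fun_eq_iff)

instantiation hahn :: (idem_semifield, zero) zero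
begin
definition "0 = Abs_hahn (\<lambda>_. 0)"
instance ..
end

lemma hcoeff_zero [simp]: "hcoeff 0 s = 0"
  unfolding zero_hahn_def by (subst hcoeff_Abs[where A = "{}"]) (auto simp: wfp_on_less_iff)

lemma hahn_eq_0_iff: "f = 0 \<longleftrightarrow> hsupp f = {}"
  by (auto simp: hsupp_def intro: hahn_eqI)

instantiation hahn :: (idem_semifield, ab_group_add) ab_group_add
begin

definition "f + g = Abs_hahn (\<lambda>s. hcoeff f s + hcoeff g s)"
definition "f - g = Abs_hahn (\<lambda>s. hcoeff f s - hcoeff g s)"
definition "- f = Abs_hahn (\<lambda>s. - hcoeff f s)"

lemma hcoeff_add [simp]: "hcoeff (f + g) s = hcoeff f s + hcoeff g s"
  unfolding plus_hahn_def
  by (subst hcoeff_Abs[where A = "hsupp f \<union> hsupp g"])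
    (auto intro!: wfp_on_less_un wfp_on_hsupp)

lemma hcoeff_diff [simp]: "hcoeff (f - g) s = hcoeff f s - hcoeff g s"
  unfolding minus_hahn_def
  by (subst hcoeff_Abs[where A = "hsupp f \<union> hsupp g"])
    (auto intro!: wfp_on_less_un wfp_on_hsupp)

lemma hcoeff_uminus [simp]: "hcoeff (- f) s = - hcoeff f s"
  unfolding uminus_hahn_def
  by (subst hcoeff_Abs[where A = "hsupp f"]) (auto intro!: wfp_on_hsupp)

instance
  by standard (auto intro!: hahn_eqI simp: add.assoc add.commute)

end

definition hconv :: "('s::idem_semifield, 'k::comm_ring_1) hahn \<Rightarrow> ('s, 'k) hahn \<Rightarrow> 's \<Rightarrow> 'k" where
  "hconv f g s = (\<Sum>(a, b) | a \<in> hsupp f \<and> b \<in> hsupp g \<and> a * b = s. hcoeff f a * hcoeff g b)"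

lemma hconv_superset:
  assumes "hsupp f \<subseteq> A" "wfp_on A (<)" "0 \<notin> A" and "hsupp g \<subseteq> B" "wfp_on B (<)" "0 \<notin> B"
  shows "hconv f g s = (\<Sum>(a, b) | a \<in> A \<and> b \<in> B \<and> a * b = s. hcoeff f a * hcoeff g b)"
  unfolding hconv_def
  using assms by (intro sum.mono_neutral_left finite_factorizations) auto

lemma hconv_eq_0:
  "(\<And>a b. a \<in> hsupp f \<Longrightarrow> b \<in> hsupp g \<Longrightarrow> a * b \<noteq> s) \<Longrightarrow> hconv f g s = 0"
  unfolding hconv_def by (intro sum.neutral) auto

lemma hsupp_products:
  "hconv f g s \<noteq> 0 \<Longrightarrow> s \<in> {a * b | a b. a \<in> hsupp f \<and> b \<in> hsupp g}"
  using hconv_eq_0[of f g s] by blast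

instantiation hahn :: (idem_semifield, comm_ring_1) comm_ring_1
begin

definition "1 = Abs_hahn (\<lambda>s. if s = 1 then 1 else 0)"
definition "f * g = Abs_hahn (hconv f g)"

lemma hcoeff_one: "hcoeff 1 s = (if s = 1 then 1 else 0)"
  unfolding one_hahn_def
  by (subst hcoeff_Abs[where A = "{1}"]) (auto simp: wfp_on_less_iff split: if_splits)

lemma hcoeff_mult: "hcoeff (f * g) = hconv f g"
  unfolding times_hahn_def
proof (rule hcoeff_Abs)
  show "hconv f g 0 = 0"
    by (rule hconv_eq_0) (auto simp: idem_mult_eq_0_iff)
  show "wfp_on {a * b | a b. a \<in> hsupp f \<and> b \<in> hsupp g} (<)"
    by (intro wfp_on_products wfp_on_hsupp zero_notin_hsupp)
qed (rule hsupp_products)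

lemma hahn_mult_commute: "f * g = g * f" for f g :: "('a, 'b) hahn"
proof (rule hahn_eqI)
  fix s
  show "hcoeff (f * g) s = hcoeff (g * f) s"
    unfolding hcoeff_mult hconv_def
    by (rule sum.reindex_bij_witness[where i = prod.swap and j = prod.swap]) (auto simp: mult.commute)
qed

lemma hahn_mult_assoc: "(f * g) * h = f * (g * h)" for f g h :: "('a, 'b) hahn"
proof (rule hahn_eqI)
  fix s
  let ?F = "hsupp f" and ?G = "hsupp g" and ?H = "hsupp h"
  let ?FG = "{a * b | a b. a \<in> ?F \<and> b \<in> ?G}" and ?GH = "{a * b | a b. a \<in> ?G \<and> b \<in> ?H}"
  have wf: "wfp_on ?FG (<)" "wfp_on ?GH (<)"
    by (intro wfp_on_products wfp_on_hsupp zero_notin_hsupp)+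
  have nz: "0 \<notin> ?FG" "0 \<notin> ?GH"
    by (auto simp: idem_mult_eq_0_iff)
  have sub: "hsupp (f * g) \<subseteq> ?FG" "hsupp (g * h) \<subseteq> ?GH"
    using hsupp_products[of f g] hsupp_products[of g h] by (auto simp: hcoeff_mult)
  let ?P = "{(x, c). x \<in> ?FG \<and> c \<in> ?H \<and> x * c = s}"
  let ?P' = "{(a, y). a \<in> ?F \<and> y \<in> ?GH \<and> a * y = s}"
  let ?Q = "\<lambda>q. {(a, b). a \<in> ?F \<and> b \<in> ?G \<and> a * b = fst q}"
  let ?Q' = "\<lambda>q. {(b, c). b \<in> ?G \<and> c \<in> ?H \<and> b * c = snd q}"
  have fin: "finite ?P" "finite ?P'" "finite (?Q q)" "finite (?Q' q)" for q
    by (intro finite_factorizations wfp_on_hsupp zero_notin_hsupp wf nz)+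
  have "hcoeff (f * g * h) s = (\<Sum>(x, c)\<in>?P. hconv f g x * hcoeff h c)"
    unfolding hcoeff_mult[of "f * g"]
    by (subst hconv_superset[where A = ?FG and B = ?H])
      (use sub wf nz in \<open>auto intro: wfp_on_hsupp simp: hcoeff_mult\<close>)
  also have "\<dots> = (\<Sum>q\<in>?P. \<Sum>r\<in>?Q q. hcoeff f (fst r) * hcoeff g (snd r) * hcoeff h (snd q))"
    by (intro sum.cong) (auto simp: hconv_def sum_distrib_right case_prod_unfold)
  also have "\<dots> = (\<Sum>(q, r)\<in>Sigma ?P ?Q. hcoeff f (fst r) * hcoeff g (snd r) * hcoeff h (snd q))"
    using fin by (subst sum.Sigma) auto
  also have "\<dots> = (\<Sum>(q, r)\<in>Sigma ?P' ?Q'. hcoeff f (fst q) * (hcoeff g (fst r) * hcoeff h (snd r)))"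
    by (rule sum.reindex_bij_witness[where
          j = "\<lambda>((x, c), (a, b)). ((a, b * c), (b, c))" and
          i = "\<lambda>((a, y), (b, c)). ((a * b, c), (a, b))"])
      (auto simp: mult.assoc, metis mult.assoc)
  also have "\<dots> = (\<Sum>q\<in>?P'. \<Sum>r\<in>?Q' q. hcoeff f (fst q) * (hcoeff g (fst r) * hcoeff h (snd r)))"
    using fin by (subst sum.Sigma) auto
  also have "\<dots> = (\<Sum>(a, y)\<in>?P'. hcoeff f a * hconv g h y)"
    by (intro sum.cong) (auto simp: hconv_def sum_distrib_left case_prod_unfold)
  also have "\<dots> = hcoeff (f * (g * h)) s"
    unfolding hcoeff_mult[of f]
    by (subst hconv_superset[where A = ?F and B = ?GH])
      (use sub wf nz in \<open>auto intro: wfp_on_hsupp simp: hcoeff_mult\<close>)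
  finally show "hcoeff (f * g * h) s = hcoeff (f * (g * h)) s" .
qed

lemma hahn_mult_1: "1 * f = f" for f :: "('a, 'b) hahn"
proof (rule hahn_eqI)
  fix s
  have "hcoeff (1 * f) s = (\<Sum>(a, b) | a \<in> {1} \<and> b \<in> hsupp f \<and> a * b = s. hcoeff 1 a * hcoeff f b)"
    unfolding hcoeff_mult
  proof (rule hconv_superset)
    show "wfp_on {1} ((<) :: 'a \<Rightarrow> 'a \<Rightarrow> bool)" by (auto simp: wfp_on_less_iff)
  qed (auto simp: hcoeff_one intro: wfp_on_hsupp split: if_splits)
  also have "\<dots> = (\<Sum>(a, b) \<in> (if s \<in> hsupp f then {(1, s)} else {}). hcoeff 1 a * hcoeff f b)"
    by (intro sum.cong) auto
  finally show "hcoeff (1 * f) s = hcoeff f s"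
    by (auto simp: hcoeff_one split: if_splits)
qed

lemma hahn_distrib: "(f + g) * h = f * h + g * h" for f g h :: "('a, 'b) hahn"
proof (rule hahn_eqI)
  fix s
  let ?A = "hsupp f \<union> hsupp g"
  have A: "wfp_on ?A (<)" "0 \<notin> ?A"
    by (auto intro!: wfp_on_less_un wfp_on_hsupp)
  have *: "hconv x h s = (\<Sum>(a, b) | a \<in> ?A \<and> b \<in> hsupp h \<and> a * b = s. hcoeff x a * hcoeff h b)"
    if "hsupp x \<subseteq> ?A" for x
    by (rule hconv_superset) (use A that in \<open>auto intro: wfp_on_hsupp\<close>)
  have "hsupp (f + g) \<subseteq> ?A" by auto
  then show "hcoeff ((f + g) * h) s = hcoeff (f * h + g * h) s"
    by (simp add: hcoeff_mult * case_prod_unfold distrib_right sum.distrib)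
qed

instance
proof
  show "(0 :: ('a, 'b) hahn) \<noteq> 1"
    using hcoeff_one[of 1] by (metis hcoeff_zero zero_neq_one)
qed (fact hahn_mult_assoc hahn_mult_commute hahn_mult_1 hahn_distrib)+

end

definition hdeg :: "('s::idem_semifield, 'k::zero) hahn \<Rightarrow> 's" where
  "hdeg f = (LEAST s. hcoeff f s \<noteq> 0)"

definition hlc :: "('s::idem_semifield, 'k::zero) hahn \<Rightarrow> 'k" where
  "hlc f = (if f = 0 then 0 else hcoeff f (hdeg f))"

definition hval :: "('s::idem_semifield, 'k::zero) hahn \<Rightarrow> 's" where
  "hval f = (if f = 0 then 0 else inverse (hdeg f))"

lemma hdeg:
  assumes "f \<noteq> 0"
  shows "hcoeff f (hdeg f) \<noteq> 0" and "hcoeff f s \<noteq> 0 \<Longrightarrow> hdeg f \<le> s"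
proof -
  obtain m where "m \<in> hsupp f" "\<forall>b\<in>hsupp f. m \<le> b"
    using wfp_on_hsupp[of f] assms unfolding hahn_eq_0_iff wfp_on_less_iff by blast
  then have m: "hcoeff f m \<noteq> 0" "\<And>s. hcoeff f s \<noteq> 0 \<Longrightarrow> m \<le> s" by auto
  then have "hdeg f = m" unfolding hdeg_def by (intro Least_equality)
  then show "hcoeff f (hdeg f) \<noteq> 0" and "hcoeff f s \<noteq> 0 \<Longrightarrow> hdeg f \<le> s" using m by auto
qed

text \<open>
  The inverse of a nonzero series \<open>f\<close>: an approximation is a series \<open>g\<close> for which
  \<open>1 - f * g\<close> vanishes up to and including every exponent \<open>deg f * s\<close> with \<open>s\<close> in the support
  of \<open>g\<close>. Approximations are ordered by truncation, and a maximal one is an inverse.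
\<close>

definition hmonom :: "'k::zero \<Rightarrow> 's::idem_semifield \<Rightarrow> ('s, 'k) hahn" where
  "hmonom c s = Abs_hahn (\<lambda>x. if x = s \<and> s \<noteq> 0 then c else 0)"

lemma hcoeff_monom: "hcoeff (hmonom c s) x = (if x = s \<and> s \<noteq> 0 then c else 0)"
  unfolding hmonom_def
  by (subst hcoeff_Abs[where A = "{s}"]) (auto simp: wfp_on_less_iff split: if_splits)

definition hext :: "('s::idem_semifield, 'k::zero) hahn \<Rightarrow> ('s, 'k) hahn \<Rightarrow> bool" where
  "hext g h \<longleftrightarrow> (\<forall>s\<in>hsupp g. \<forall>x\<le>s. hcoeff h x = hcoeff g x)"

lemma hext_antisym: "hext g h \<Longrightarrow> hext h g \<Longrightarrow> g = h"
  by (rule hahn_eqI) (metis hext_def in_hsupp_iff order_refl)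

lemma hext_trans:
  assumes "hext g h" "hext h k"
  shows "hext g k"
  unfolding hext_def
proof (intro ballI allI impI)
  fix s x assume s: "s \<in> hsupp g" "x \<le> s"
  then have h: "s \<in> hsupp h" using assms(1) by (auto simp: hext_def)
  then have "hcoeff k x = hcoeff h x" using assms(2) s(2) unfolding hext_def by blast
  also have "\<dots> = hcoeff g x" using assms(1) s unfolding hext_def by blast
  finally show "hcoeff k x = hcoeff g x" .
qed

lemma hahn_chain_sup:
  assumes chain: "\<And>g h. g \<in> C \<Longrightarrow> h \<in> C \<Longrightarrow> hext g h \<or> hext h g"
  shows "\<exists>u. (\<forall>g\<in>C. hext g u) \<and> (\<forall>s\<in>hsupp u. \<exists>g\<in>C. s \<in> hsupp g)"
proof -
  define U where "U = (\<Union>g\<in>C. hsupp g)"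
  define f where "f s = (if s \<in> U then hcoeff (SOME g. g \<in> C \<and> s \<in> hsupp g) s else 0)" for s
  have f_eq: "f x = hcoeff g x" if g: "g \<in> C" "s \<in> hsupp g" "x \<le> s" for g s x
  proof (cases "x \<in> U")
    case True
    let ?h = "SOME g. g \<in> C \<and> x \<in> hsupp g"
    have "\<exists>g. g \<in> C \<and> x \<in> hsupp g" using True by (auto simp: U_def)
    then have h: "?h \<in> C \<and> x \<in> hsupp ?h" by (rule someI_ex)
    have "hcoeff k x = hcoeff g x" if k: "k \<in> C" "x \<in> hsupp k" for k
      using chain[OF g(1) k(1)] g(2,3) k(2) order_refl[of x] unfolding hext_def by metis
    then have "hcoeff ?h x = hcoeff g x" using h by blast
    then show ?thesis using True by (simp add: f_def)
  next
    case False
    then have "x \<notin> hsupp g" using g by (auto simp: U_def)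
    then show ?thesis using False by (simp add: f_def)
  qed
  have wf: "wfp_on U (<)"
    unfolding wfp_on_less_iff
  proof (intro allI impI)
    fix B assume B: "B \<subseteq> U" "B \<noteq> {}"
    then obtain g b where g: "g \<in> C" "b \<in> hsupp g" "b \<in> B" unfolding U_def by blast
    then have "hsupp g \<inter> B \<subseteq> hsupp g" "hsupp g \<inter> B \<noteq> {}" by auto
    then obtain m where m: "m \<in> hsupp g \<inter> B" "\<forall>x\<in>hsupp g \<inter> B. m \<le> x"
      using wfp_on_hsupp[of g] unfolding wfp_on_less_iff by meson
    have "m \<le> x" if xB: "x \<in> B" for x
    proof (rule ccontr)
      assume x: "\<not> m \<le> x"
      obtain h where h: "h \<in> C" "x \<in> hsupp h" using xB B(1) unfolding U_def by blast
      have "f x = hcoeff g x" "f x = hcoeff h x" using f_eq[of g m x] f_eq[of h x x] g m h x by auto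
      then have "x \<in> hsupp g" using h by simp
      then show False using m x xB by auto
    qed
    then show "\<exists>m\<in>B. \<forall>b\<in>B. m \<le> b" using m by auto
  qed
  have f_supp: "s \<in> U" if "f s \<noteq> 0" for s using that by (auto simp: f_def split: if_splits)
  have "0 \<notin> U" by (auto simp: U_def)
  then have "f 0 = 0" by (simp add: f_def)
  then have u: "hcoeff (Abs_hahn f) = f" using wf f_supp by (rule hcoeff_Abs)
  show ?thesis
  proof (intro exI[of _ "Abs_hahn f"] conjI ballI)
    show "hext g (Abs_hahn f)" if "g \<in> C" for g
      using f_eq that by (auto simp: hext_def u)
    show "\<exists>g\<in>C. s \<in> hsupp g" if "s \<in> hsupp (Abs_hahn f)" for s
      using that f_supp[of s] by (auto simp: u U_def)
  qed
qed

lemma hconv_cong_upto: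
  assumes "f \<noteq> 0" "\<And>x. x \<le> s \<Longrightarrow> hcoeff g x = hcoeff h x" "t \<le> hdeg f * s"
  shows "hconv f g t = hconv f h t"
  unfolding hconv_def
proof (rule sum.cong)
  have le: "b \<le> s" if "hcoeff f a \<noteq> 0" "a * b = t" for a b
  proof (rule ccontr)
    assume "\<not> b \<le> s"
    then have "hdeg f * s < hdeg f * b"
      using hdeg(1)[OF assms(1)] by (subst idem_mult_less) auto
    also have "\<dots> \<le> a * b" using hdeg(2)[OF assms(1) that(1)] by (intro idem_mult_mono2) auto
    finally show False using that(2) assms(3) by simp
  qed
  show "{(a, b). a \<in> hsupp f \<and> b \<in> hsupp g \<and> a * b = t} = {(a, b). a \<in> hsupp f \<and> b \<in> hsupp h \<and> a * b = t}"
    using le assms(2) by auto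
  show "(case p of (a, b) \<Rightarrow> hcoeff f a * hcoeff g b) = (case p of (a, b) \<Rightarrow> hcoeff f a * hcoeff h b)"
    if "p \<in> {(a, b). a \<in> hsupp f \<and> b \<in> hsupp h \<and> a * b = t}" for p
    using that le assms(2) by auto
qed

lemma hahn_inverse_exists:
  fixes f :: "('s::idem_semifield, 'k::field) hahn"
  assumes f: "f \<noteq> 0"
  shows "\<exists>g. f * g = 1"
proof -
  let ?d = "hdeg f"
  have d0: "?d \<noteq> 0" using hdeg(1)[OF f] by auto
  define G where "G = {g. \<forall>s\<in>hsupp g. \<forall>t\<le>?d * s. hcoeff (1 - f * g) t = 0}"
  have "\<exists>m\<in>G. \<forall>a\<in>G. hext m a \<longrightarrow> a = m"
  proof (rule predicate_Zorn)
    show "partial_order_on G (relation_of hext G)"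
      by (rule partial_order_on_relation_ofI) (auto intro: hext_trans hext_antisym, simp add: hext_def)
    fix C assume C: "C \<in> Chains (relation_of hext G)"
    then have CG: "C \<subseteq> G" by (auto simp: Chains_def relation_of_def)
    have "hext g h \<or> hext h g" if "g \<in> C" "h \<in> C" for g h
      using C that by (auto simp: Chains_def relation_of_def)
    then obtain u where u: "\<And>g. g \<in> C \<Longrightarrow> hext g u" "\<And>s. s \<in> hsupp u \<Longrightarrow> \<exists>g\<in>C. s \<in> hsupp g"
      using hahn_chain_sup[of C] by blast
    have "u \<in> G"
      unfolding G_def
    proof (intro CollectI ballI allI impI)
      fix s t assume s: "s \<in> hsupp u" and t: "t \<le> ?d * s"
      obtain g where g: "g \<in> C" "s \<in> hsupp g" using u(2)[OF s] by auto
      have "hcoeff u x = hcoeff g x" if "x \<le> s" for x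
        using u(1)[OF g(1)] g(2) that unfolding hext_def by blast
      then have "hconv f u t = hconv f g t" by (rule hconv_cong_upto[OF f _ t])
      moreover have "hcoeff (1 - f * g) t = 0" using CG g t by (auto simp: G_def)
      ultimately show "hcoeff (1 - f * u) t = 0" by (simp add: hcoeff_mult)
    qed
    then show "\<exists>u\<in>G. \<forall>a\<in>C. hext a u" using u(1) by blast
  qed
  then obtain g where g: "g \<in> G" and max: "\<And>a. a \<in> G \<Longrightarrow> hext g a \<Longrightarrow> a = g" by blast
  have "1 - f * g = 0"
  proof (rule ccontr)
    let ?r = "1 - f * g"
    assume r: "?r \<noteq> 0"
    define s0 where "s0 = inverse ?d * hdeg ?r"
    have ds0: "?d * s0 = hdeg ?r"
      unfolding s0_def by (simp add: idem_right_inverse[OF d0] flip: mult.assoc)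
    have s0: "s0 \<noteq> 0" using hdeg(1)[OF r] ds0 by (metis hcoeff_0_arg mult_zero_right)
    have above: "s < s0" if "s \<in> hsupp g" for s
    proof (rule ccontr)
      assume "\<not> s < s0"
      then have "hdeg ?r \<le> ?d * s" unfolding ds0[symmetric] by (intro idem_mult_mono) auto
      then show False using g that hdeg(1)[OF r] by (auto simp: G_def)
    qed
    let ?m = "hmonom (hcoeff ?r (hdeg ?r) / hcoeff f ?d) s0"
    have coeff_m: "hconv f ?m t = (if t = hdeg ?r then hcoeff ?r (hdeg ?r) else 0)"
      if t: "t \<le> hdeg ?r" for t
    proof -
      have iff: "a * s0 = t \<longleftrightarrow> a = ?d \<and> t = hdeg ?r" if "hcoeff f a \<noteq> 0" for a
      proof
        assume at: "a * s0 = t"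
        have "?d \<le> a" using hdeg(2)[OF f that] .
        moreover have "s0 * a \<le> s0 * ?d" using t at ds0 by (simp add: mult.commute)
        then have "a \<le> ?d" using s0 by (simp add: idem_mult_le)
        ultimately show "a = ?d \<and> t = hdeg ?r" using at ds0 by auto
      qed (use ds0 in auto)
      have "hconv f ?m t = (\<Sum>(a, b) | a \<in> hsupp f \<and> b \<in> {s0} \<and> a * b = t. hcoeff f a * hcoeff ?m b)"
      proof (rule hconv_superset)
        show "wfp_on {s0} (<)" by (auto simp: wfp_on_less_iff)
      qed (use s0 in \<open>auto simp: hcoeff_monom intro: wfp_on_hsupp split: if_splits\<close>)
      also have "\<dots> = (\<Sum>(a, b) \<in> (if t = hdeg ?r then {(?d, s0)} else {}). hcoeff f a * hcoeff ?m b)"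
        by (intro sum.cong) (use iff hdeg(1)[OF f] in auto)
      also have "\<dots> = (if t = hdeg ?r then hcoeff ?r (hdeg ?r) else 0)"
        using hdeg(1)[OF f] s0 by (simp add: hcoeff_monom)
      finally show ?thesis .
    qed
    have "g + ?m \<in> G"
      unfolding G_def
    proof (intro CollectI ballI allI impI)
      fix s t assume s: "s \<in> hsupp (g + ?m)" and t: "t \<le> ?d * s"
      have "s \<le> s0" using s above[of s] by (cases "s = s0") (auto simp: hcoeff_monom)
      then have "?d * s \<le> hdeg ?r" unfolding ds0[symmetric] by (rule idem_mult_mono)
      then have t': "t \<le> hdeg ?r" using t by simp
      have "hcoeff (1 - f * (g + ?m)) t = hcoeff ?r t - hconv f ?m t"
        by (simp add: distrib_left hcoeff_mult)
      also have "\<dots> = 0"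
      proof (cases "t = hdeg ?r")
        case True
        show ?thesis unfolding coeff_m[OF t'] if_P[OF True] using arg_cong[OF True, of "hcoeff ?r"] by (simp only: diff_self)
      next
        case False
        then have "hcoeff ?r t = 0" using hdeg(2)[OF r, of t] t' order_antisym by blast
        then show ?thesis unfolding coeff_m[OF t'] if_not_P[OF False] by (simp only: diff_self)
      qed
      finally show "hcoeff (1 - f * (g + ?m)) t = 0" .
    qed
    moreover have "hext g (g + ?m)"
      using above by (fastforce simp: hext_def hcoeff_monom)
    ultimately have "g + ?m = g" by (rule max)
    then have "hcoeff ?m s0 = 0" by (metis add_cancel_right_right hcoeff_zero)
    then show False using hdeg(1)[OF f] hdeg(1)[OF r] s0 by (simp add: hcoeff_monom)
  qed
  then show ?thesis by (intro exI[of _ g]) simp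
qed

instantiation hahn :: (idem_semifield, field) field
begin

definition inverse_hahn :: "('a, 'b) hahn \<Rightarrow> ('a, 'b) hahn" where
  "inverse_hahn f = (if f = 0 then 0 else SOME g. f * g = 1)"

definition divide_hahn :: "('a, 'b) hahn \<Rightarrow> ('a, 'b) hahn \<Rightarrow> ('a, 'b) hahn" where
  "divide_hahn f g = f * inverse g"

instance
proof
  fix f :: "('a, 'b) hahn"
  assume "f \<noteq> 0"
  then have "f * inverse f = 1"
    using someI_ex[OF hahn_inverse_exists] by (simp add: inverse_hahn_def)
  then show "inverse f * f = 1" by (simp add: mult.commute)
qed (simp_all add: inverse_hahn_def divide_hahn_def)

end


section \<open>Coordinate spaces and linear subspaces\<close>

text \<open>
  For a finite set \<open>X\<close>, the space \<open>R\<^sup>X\<close> is the set of functions that vanish outside \<open>X\<close>;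
  the empty \<open>X\<close> is allowed.
\<close>

definition coord_space :: "'i set \<Rightarrow> ('i \<Rightarrow> 'a::zero) set" where
  "coord_space X = {v. \<forall>i. i \<notin> X \<longrightarrow> v i = 0}"

definition cscale :: "'k::times \<Rightarrow> ('i \<Rightarrow> 'k) \<Rightarrow> 'i \<Rightarrow> 'k" where
  "cscale c v = (\<lambda>i. c * v i)"

global_interpretation coord: vector_space "cscale :: 'k::field \<Rightarrow> ('i \<Rightarrow> 'k) \<Rightarrow> 'i \<Rightarrow> 'k"
  by standard (simp_all add: cscale_def fun_eq_iff algebra_simps)

definition linear_subspace :: "'i set \<Rightarrow> ('i \<Rightarrow> 'k::field) set \<Rightarrow> bool" where
  "linear_subspace X \<Lambda> \<longleftrightarrow> \<Lambda> \<subseteq> coord_space X \<and> coord.subspace \<Lambda>"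

text \<open>A matrix in \<open>R\<^bsup>F\<times>E\<^esup>\<close> is a function on pairs (row, column).\<close>

definition matrix_image :: "'e set \<Rightarrow> ('f \<times> 'e \<Rightarrow> 'k::field) \<Rightarrow> ('e \<Rightarrow> 'k) set \<Rightarrow> ('f \<Rightarrow> 'k) set" where
  "matrix_image E \<Delta> \<Lambda> = (\<lambda>v j. \<Sum>i\<in>E. \<Delta> (j, i) * v i) ` \<Lambda>"


section \<open>Tropical linear spaces\<close>

text \<open>
  Vectors in \<open>S\<close> indexed by the \<open>d\<close>-subsets of \<open>E\<close> are functions on sets that vanish on all other sets.
\<close>

definition trop_plucker :: "'e set \<Rightarrow> nat \<Rightarrow> ('e set \<Rightarrow> 's::idem_semifield) \<Rightarrow> bool" where
  "trop_plucker E d w \<longleftrightarrow>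
     (\<exists>I. w I \<noteq> 0) \<and> (\<forall>I. w I \<noteq> 0 \<longrightarrow> I \<subseteq> E \<and> card I = d) \<and>
     (\<forall>J K. J \<subseteq> E \<and> card J = d + 1 \<and> K \<subseteq> E \<and> card K + 1 = d \<longrightarrow>
        (\<forall>j\<in>J - K. (\<Sum>i\<in>J - K. w (J - {i}) * w (insert i K)) =
                    (\<Sum>i\<in>J - K - {j}. w (J - {i}) * w (insert i K))))"

definition plucker_space :: "'e set \<Rightarrow> nat \<Rightarrow> ('e set \<Rightarrow> 's::idem_semifield) \<Rightarrow> ('e \<Rightarrow> 's) set" where
  "plucker_space E d w = {v \<in> coord_space E. \<forall>J\<subseteq>E. card J = d + 1 \<longrightarrow>
     (\<forall>j\<in>J. (\<Sum>i\<in>J. w (J - {i}) * v i) = (\<Sum>i\<in>J - {j}. w (J - {i}) * v i))}"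

definition trop_linear_space :: "'e set \<Rightarrow> ('e \<Rightarrow> 's::idem_semifield) set \<Rightarrow> bool" where
  "trop_linear_space E L \<longleftrightarrow> (\<exists>d w. trop_plucker E d w \<and> L = plucker_space E d w)"

definition trop :: "('e \<Rightarrow> ('s::idem_semifield, 'k::field) hahn) set \<Rightarrow> ('e \<Rightarrow> 's) set" where
  "trop \<Lambda> = (\<lambda>v i. hval (v i)) ` \<Lambda>"

definition realizable :: "'k::field itself \<Rightarrow> 'e set \<Rightarrow> ('e \<Rightarrow> 's::idem_semifield) set \<Rightarrow> bool" where
  "realizable _ E L \<longleftrightarrow> trop_linear_space E L \<and>
     (\<exists>\<Lambda> :: ('e \<Rightarrow> ('s, 'k) hahn) set. linear_subspace E \<Lambda> \<and> L = trop \<Lambda>)"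


section \<open>The sign-free exterior algebra\<close>

text \<open>
  An element of the exterior algebra of \<open>S\<^sup>V\<close>, and likewise of its dual, is the function
  assigning to each \<open>I \<subseteq> V\<close> its coefficient at \<open>e\<^sub>I\<close>, respectively \<open>x\<^sub>I\<close>. The wedge product is
  written coefficientwise; \<open>wedge_basis\<close> and \<open>star_basis\<close> recover the values on basis elements.
\<close>

definition ext_basis :: "'v set \<Rightarrow> 'v set \<Rightarrow> 's::idem_semifield" where
  "ext_basis I = (\<lambda>J. if J = I then 1 else 0)"

definition wedge :: "('v set \<Rightarrow> 's::idem_semifield) \<Rightarrow> ('v set \<Rightarrow> 's) \<Rightarrow> 'v set \<Rightarrow> 's" where
  "wedge u u' = (\<lambda>I. \<Sum>J\<in>Pow I. u J * u' (I - J))"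

definition star :: "'v set \<Rightarrow> ('v set \<Rightarrow> 's::idem_semifield) \<Rightarrow> 'v set \<Rightarrow> 's" where
  "star V u = (\<lambda>I. if I \<subseteq> V then u (V - I) else 0)"

definition ext_dot :: "'v set \<Rightarrow> ('v set \<Rightarrow> 's::idem_semifield) \<Rightarrow> ('v set \<Rightarrow> 's) \<Rightarrow> 'v set \<Rightarrow> 's" where
  "ext_dot V u u' = star V (wedge (star V u) (star V u'))"

lemma wedge_infinite: "infinite I \<Longrightarrow> wedge u u' I = 0"
  by (simp add: wedge_def)

lemma wedge_basis:
  assumes "finite I" "finite J"
  shows "wedge (ext_basis I) (ext_basis J) = (if I \<inter> J = {} then ext_basis (I \<union> J) else 0)"
proof
  fix K :: "'a set"
  show "wedge (ext_basis I) (ext_basis J) K = (if I \<inter> J = {} then ext_basis (I \<union> J) else 0) K"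
  proof (cases "finite K")
    case True
    have "wedge (ext_basis I) (ext_basis J) K = (\<Sum>L\<in>Pow K. if L = I then (if K - L = J then 1 else 0) else 0)"
      unfolding wedge_def ext_basis_def by (intro sum.cong) auto
    also have "\<dots> = (if I \<subseteq> K \<and> K - I = J then 1 else 0)"
      using True by (simp add: sum.delta)
    also have "I \<subseteq> K \<and> K - I = J \<longleftrightarrow> I \<inter> J = {} \<and> K = I \<union> J" by blast
    finally show ?thesis
      by (cases "I \<inter> J = {}"; cases "K = I \<union> J") (simp_all add: ext_basis_def[of "I \<union> J"])
  next
    case False
    then show ?thesis using assms by (auto simp: wedge_infinite ext_basis_def)
  qed
qed

lemma star_basis: "I \<subseteq> V \<Longrightarrow> star V (ext_basis I) = ext_basis (V - I)"
  by (auto simp: star_def ext_basis_def fun_eq_iff)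

lemma wedge_commute: "wedge u u' = wedge u' u"
proof
  fix I
  show "wedge u u' I = wedge u' u I"
    unfolding wedge_def
    by (rule sum.reindex_bij_witness[where i = "\<lambda>J. I - J" and j = "\<lambda>J. I - J"])
      (auto simp: double_diff mult.commute)
qed

lemma wedge_assoc: "wedge (wedge u v) w = wedge u (wedge v w)"
proof
  fix I
  show "wedge (wedge u v) w I = wedge u (wedge v w) I"
  proof (cases "finite I")
    case True
    have fin: "finite J" if "J \<subseteq> I" for J using True that by (rule finite_subset[rotated])
    have "wedge (wedge u v) w I = (\<Sum>J\<in>Pow I. \<Sum>K\<in>Pow J. u K * v (J - K) * w (I - J))"
      by (simp add: wedge_def sum_distrib_right)
    also have "\<dots> = (\<Sum>(J, K)\<in>Sigma (Pow I) Pow. u K * v (J - K) * w (I - J))"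
      using True fin by (subst sum.Sigma) auto
    also have "\<dots> = (\<Sum>(K, M)\<in>Sigma (Pow I) (\<lambda>K. Pow (I - K)). u K * (v M * w (I - K - M)))"
      by (rule sum.reindex_bij_witness[where
            j = "\<lambda>(J, K). (K, J - K)" and i = "\<lambda>(K, M). (K \<union> M, K)"])
        (auto simp: mult.assoc intro!: arg_cong2[where f = "(*)"] arg_cong[where f = v] arg_cong[where f = w])
    also have "\<dots> = (\<Sum>K\<in>Pow I. \<Sum>M\<in>Pow (I - K). u K * (v M * w (I - K - M)))"
      using True by (subst sum.Sigma) auto
    also have "\<dots> = wedge u (wedge v w) I"
      by (simp add: wedge_def sum_distrib_left)
    finally show ?thesis .
  qed (simp add: wedge_infinite)
qed

lemma star_star_wedge: "star V (star V (wedge (star V u) (star V u'))) = wedge (star V u) (star V u')"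
proof
  fix I
  have "wedge (star V u) (star V u') I = 0" if "\<not> I \<subseteq> V"
    unfolding wedge_def
  proof (intro sum.neutral ballI)
    fix J
    have "\<not> J \<subseteq> V \<or> \<not> I - J \<subseteq> V" using that by blast
    then show "star V u J * star V u' (I - J) = 0" by (auto simp: star_def)
  qed
  then show "star V (star V (wedge (star V u) (star V u'))) I = wedge (star V u) (star V u') I"
    by (auto simp: star_def double_diff)
qed

text \<open>The products over \<open>f\<^sub>1, \<dots>, f\<^sub>m\<close> below do not depend on the order, so they may be written as set folds.\<close>

lemma comp_fun_commute_wedge: "comp_fun_commute (\<lambda>j u. wedge u (f j))"
  by standard (simp add: fun_eq_iff wedge_assoc wedge_commute[of "f _" "f _"])

lemma comp_fun_commute_ext_dot: "comp_fun_commute (\<lambda>j u. ext_dot V u (f j))"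
  by standard (simp add: fun_eq_iff ext_dot_def star_star_wedge wedge_assoc
      wedge_commute[of "star V (f _)" "star V (f _)"])


section \<open>Tropical graphs and images\<close>

text \<open>The image of \<open>w\<close> under the inclusion of \<open>S\<^sup>E\<close> into the space on the disjoint union \<open>E <+> F\<close>.\<close>

definition ext_Inl :: "('e set \<Rightarrow> 's::idem_semifield) \<Rightarrow> ('e + 'f) set \<Rightarrow> 's" where
  "ext_Inl w = (\<lambda>I. if I \<subseteq> range Inl then w (Inl -` I) else 0)"

text \<open>The linear form \<open>\<rho>\<^sub>j + y\<^sub>j\<close>, as an element of degree one.\<close>

definition graph_form :: "'e set \<Rightarrow> ('f \<times> 'e \<Rightarrow> 's::idem_semifield) \<Rightarrow> 'f \<Rightarrow> ('e + 'f) set \<Rightarrow> 's" where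
  "graph_form E A j = (\<lambda>I. (\<Sum>i\<in>E. A (j, i) * ext_basis {Inl i} I) + ext_basis {Inr j} I)"

definition trop_graph :: "'e set \<Rightarrow> 'f set \<Rightarrow> ('f \<times> 'e \<Rightarrow> 's::idem_semifield) \<Rightarrow> ('e set \<Rightarrow> 's) \<Rightarrow> ('e + 'f) set \<Rightarrow> 's" where
  "trop_graph E F A w =
     Finite_Set.fold (\<lambda>j u. ext_dot (E <+> F) u (star (E <+> F) (graph_form E A j)))
       (Finite_Set.fold (\<lambda>j u. wedge u (ext_basis {Inr j})) (ext_Inl w) F) F"

text \<open>
  The tropical image is a function of the tropical linear space \<open>L\<close>, not of a chosen Pluecker vector:
  it is the common value over all Pluecker vectors (and ranks) that define \<open>L\<close>.
\<close>

definition tropim :: "'e set \<Rightarrow> 'f set \<Rightarrow> ('f \<times> 'e \<Rightarrow> 's::idem_semifield) \<Rightarrow> ('e \<Rightarrow> 's) set \<Rightarrow> ('f \<Rightarrow> 's) set" where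
  "tropim E F A L = (THE M. \<exists>d w. trop_plucker E d w \<and> L = plucker_space E d w \<and>
     M = (\<lambda>v j. v (Inr j)) ` plucker_space (E <+> F) d (trop_graph E F A w))"


section \<open>Zariski open sets and valuation fibres\<close>

text \<open>
  A polynomial over \<open>'k\<close> in the variables \<open>'v\<close> is a finitely supported map from monomials,
  i.e. finitely supported exponent vectors, to \<open>'k\<close>.
\<close>

definition poly_eval :: "(('v \<Rightarrow>\<^sub>0 nat) \<Rightarrow>\<^sub>0 'k::comm_semiring_1) \<Rightarrow> ('v \<Rightarrow> 'k) \<Rightarrow> 'k" where
  "poly_eval p c = (\<Sum>m\<in>Poly_Mapping.keys p. Poly_Mapping.lookup p m *
     (\<Prod>i\<in>Poly_Mapping.keys m. c i ^ Poly_Mapping.lookup m i))"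

definition zariski_open :: "'v set \<Rightarrow> ('v \<Rightarrow> 'k::field) set \<Rightarrow> bool" where
  "zariski_open X U \<longleftrightarrow>
     (\<exists>P. U = coord_space X - {c \<in> coord_space X. \<forall>p\<in>P. poly_eval p c = 0})"

definition val_fibre ::
  "'f set \<Rightarrow> 'e set \<Rightarrow> ('f \<times> 'e \<Rightarrow> 's::idem_semifield) \<Rightarrow> ('f \<times> 'e \<Rightarrow> ('s, 'k::field) hahn) set" where
  "val_fibre F E A = {\<Delta> \<in> coord_space (F \<times> E). \<forall>x\<in>F \<times> E. hval (\<Delta> x) = A x}"

definition lead_coeffs :: "('v \<Rightarrow> ('s::idem_semifield, 'k::field) hahn) \<Rightarrow> 'v \<Rightarrow> 'k" where
  "lead_coeffs \<Delta> = (\<lambda>x. hlc (\<Delta> x))"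

end

theory Submission
  imports Defs "Jordan_Normal_Form.Determinant"
begin

text \<open>
  The graph of \<open>\<Delta>\<close> on \<open>\<Lambda>\<close> is a \<open>d\<close>-dimensional space whose projection to the coordinates in \<open>F\<close> is
  \<open>\<Delta>\<Lambda>\<close>, and projecting commutes with taking valuations. So the theorem reduces to the claim that
  for generic leading coefficients the tropicalization of the graph is the tropical graph.

  Two facts give this. First, a linear space whose dimension is positive tropicalizes to the tropical
  linear space of the valuations of its Pluecker coordinates, provided the residue field has more than
  \<open>n - d + 1\<close> elements, where \<open>n\<close> is the number of coordinates (\<open>trop_row_space\<close>). One inclusion is
  Cramer's rule, which is a vanishing sum. For the other, a generic combination of the cocircuits of a
  suitably maximal basis lifts a given tropical vector. Second, by multilinearity a Pluecker
  coordinate of the graph at \<open>I \<union> J\<close>, with \<open>I \<subseteq> E\<close> and \<open>J \<subseteq> F\<close>, is the sum over maps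
  \<open>\<sigma> : J \<rightarrow> E\<close> of the products of the entries \<open>\<Delta> (j, \<sigma> j)\<close> with, up to sign, the coordinate of \<open>\<Lambda>\<close>
  at \<open>I \<union> \<sigma>(J)\<close> (\<open>vec_det_graph_cols\<close>). Contracting \<open>w\<close> with the forms \<open>\<rho>\<^sub>j + y\<^sub>j\<close> yields the same sum,
  read tropically (\<open>trop_graph_eq_sum\<close>). Hence the valuation of the former is the latter unless the
  leading coefficients of the largest terms cancel.

  Different \<open>\<sigma>\<close> involve different square-free monomials in the leading coefficients of \<open>\<Delta>\<close>. So
  cancellation is the vanishing of a nonzero square-free polynomial, one for each \<open>d\<close>-subset of
  \<open>E + F\<close> that meets \<open>F\<close>. There are fewer than \<open>(|E| + |F|) choose d\<close> of these, and a field with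
  more elements than that has a point with nonzero coordinates at which none of them vanishes
  (\<open>generic_point\<close>).

  Finally, the tropical image is defined from \<open>L\<close> alone. That this is meaningful is
  \<open>plucker_space_determines_vector\<close>: a tropical linear space determines its bases, and the ratios of
  the Pluecker coordinates of two bases that differ by an exchange.
\<close>


section \<open>Sums in a totally ordered idempotent semifield\<close>

lemma idem_add_eq_max: "a + b = max a (b :: 's::idem_semifield)"
  by (metis add.commute idem_le_iff max.absorb1 max.absorb2 linear)

lemma idem_zero_le [simp]: "0 \<le> (a :: 's::idem_semifield)"
  by (simp add: idem_le_iff)

lemma idem_le_zero [simp]: "a \<le> 0 \<longleftrightarrow> a = (0 :: 's::idem_semifield)"
  by (metis antisym idem_zero_le order_refl)

lemma idem_inverse_eq_0 [simp]: "inverse a = 0 \<longleftrightarrow> a = (0 :: 's::idem_semifield)"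
  by (metis idem_inverse_zero idem_right_inverse mult_zero_right zero_neq_one)

lemma idem_inverse_le:
  assumes "a \<noteq> 0" "b \<noteq> (0 :: 's::idem_semifield)"
  shows "inverse a \<le> inverse b \<longleftrightarrow> b \<le> a"
proof -
  have "inverse a \<le> inverse b \<longleftrightarrow> a * b * inverse a \<le> a * b * inverse b"
    using assms by (subst idem_mult_le) (auto simp: idem_mult_eq_0_iff)
  also have "a * b * inverse a = b" using assms by (simp add: mult.assoc mult.left_commute[of a] idem_right_inverse)
  also have "a * b * inverse b = a" using assms by (simp add: mult.assoc idem_right_inverse)
  finally show ?thesis .
qed

lemma idem_inverse_inverse [simp]: "inverse (inverse a) = (a :: 's::idem_semifield)"
proof (cases "a = 0")
  case False
  then show ?thesis by (metis idem_inverse_eq_0 idem_left_inverse idem_mult_left_cancel idem_right_inverse)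
qed (simp add: idem_inverse_zero)

lemma idem_inverse_mult: "inverse (a * b) = inverse a * inverse (b :: 's::idem_semifield)"
proof (cases "a = 0 \<or> b = 0")
  case False
  then have ab: "a * b \<noteq> 0" by (simp add: idem_mult_eq_0_iff)
  have "(a * b) * (inverse a * inverse b) = (a * inverse a) * (b * inverse b)" by (simp add: ac_simps)
  also have "\<dots> = (a * b) * inverse (a * b)" using False ab by (simp add: idem_right_inverse)
  finally show ?thesis using ab idem_mult_left_cancel by metis
qed (auto simp: idem_inverse_zero)

lemma idem_sum_le_iff:
  fixes f :: "'i \<Rightarrow> 's::idem_semifield"
  assumes "finite A"
  shows "sum f A \<le> m \<longleftrightarrow> (\<forall>a\<in>A. f a \<le> m)"
  using assms by (induction A) (auto simp: idem_add_eq_max)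

lemma idem_le_sum:
  fixes f :: "'i \<Rightarrow> 's::idem_semifield"
  assumes "finite A" "a \<in> A"
  shows "f a \<le> sum f A"
  using assms idem_sum_le_iff[of A f "sum f A"] by auto

lemma idem_sum_attained:
  fixes f :: "'i \<Rightarrow> 's::idem_semifield"
  assumes "sum f A \<noteq> 0"
  shows "\<exists>a\<in>A. f a = sum f A"
proof -
  have "finite A" using assms by (rule contrapos_np) simp
  then show ?thesis using assms
  proof (induction A)
    case (insert a A)
    show ?case
    proof (cases "f a \<le> sum f A")
      case True
      then have "sum f (insert a A) = sum f A" using insert by (simp add: idem_le_iff)
      then show ?thesis using insert by auto
    next
      case False
      then have "sum f (insert a A) = f a" using insert by (simp add: idem_add_eq_max max_def)
      then show ?thesis by auto
    qed
  qed simp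
qed

lemma idem_prod_eq_0_iff:
  fixes f :: "'i \<Rightarrow> 's::idem_semifield"
  assumes "finite A"
  shows "prod f A = 0 \<longleftrightarrow> (\<exists>a\<in>A. f a = 0)"
  using assms by (induction A) (auto simp: idem_mult_eq_0_iff)

text \<open>
  The tropical vanishing condition says that no single summand exceeds the sum of the others.
\<close>

lemma sum_eq_sum_remove_iff:
  fixes t :: "'i \<Rightarrow> 's::idem_semifield"
  assumes "finite J" "j \<in> J"
  shows "sum t J = sum t (J - {j}) \<longleftrightarrow> t j \<le> sum t (J - {j})"
  by (subst sum.remove[OF assms]) (simp add: idem_le_iff)


section \<open>Valuations and leading coefficients\<close>

lemma hval_eq_0_iff [simp]: "hval f = 0 \<longleftrightarrow> f = (0 :: ('s::idem_semifield, 'k::ab_group_add) hahn)"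
  using hdeg(1)[of f] by (auto simp: hval_def)

lemma hval_zero [simp]: "hval (0 :: ('s::idem_semifield, 'k::ab_group_add) hahn) = 0"
  by simp

text \<open>
  Valuations are exponents inverted, so the part of \<open>f\<close> at valuation level \<open>m\<close> is its coefficient at
  \<open>inverse m\<close>. At level \<open>0\<close> this is \<open>0\<close>.
\<close>

lemma hval_le_iff:
  fixes f :: "('s::idem_semifield, 'k::ab_group_add) hahn"
  shows "hval f \<le> m \<longleftrightarrow> (\<forall>s. hcoeff f s \<noteq> 0 \<longrightarrow> m \<noteq> 0 \<and> inverse m \<le> s)"
proof (cases "f = 0 \<or> m = 0")
  case True
  show ?thesis
  proof (cases "f = 0")
    case False
    then show ?thesis using True hdeg(1)[of f] by auto
  qed simp
next
  case False
  then have d: "hcoeff f (hdeg f) \<noteq> 0" "hdeg f \<noteq> 0" using hdeg(1)[of f] by auto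
  have "hval f \<le> m \<longleftrightarrow> inverse m \<le> hdeg f"
    using False d idem_inverse_le[of m "inverse (hdeg f)"] by (simp add: hval_def)
  also have "\<dots> \<longleftrightarrow> (\<forall>s. hcoeff f s \<noteq> 0 \<longrightarrow> inverse m \<le> s)"
    using d False hdeg(2)[of f] order_trans by blast
  finally show ?thesis using False by simp
qed

lemma hcoeff_level:
  fixes f :: "('s::idem_semifield, 'k::ab_group_add) hahn"
  assumes "hval f \<le> m"
  shows "hcoeff f (inverse m) = (if hval f = m then hlc f else 0)"
proof (cases "f = 0")
  case False
  show ?thesis
  proof (cases "hval f = m")
    case True
    then have "inverse m = hdeg f" using False by (auto simp: hval_def)
    then show ?thesis using True False by (simp add: hlc_def)
  next
    case neq: False
    have "hcoeff f (inverse m) = 0"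
    proof (rule ccontr)
      assume c: "hcoeff f (inverse m) \<noteq> 0"
      then have "m \<noteq> 0" by (auto simp: idem_inverse_zero)
      have "hdeg f \<le> inverse m" using hdeg(2)[OF False c] .
      then have "m \<le> hval f"
        using False \<open>m \<noteq> 0\<close> idem_inverse_le[of "inverse (hdeg f)" m] hdeg(1)[OF False]
        by (cases "hdeg f = 0") (auto simp: hval_def)
      then show False using assms neq by simp
    qed
    then show ?thesis using neq by simp
  qed
qed (simp add: hlc_def)

lemma hlc_eq_0_iff [simp]: "hlc f = 0 \<longleftrightarrow> f = (0 :: ('s::idem_semifield, 'k::ab_group_add) hahn)"
  using hdeg(1)[of f] by (auto simp: hlc_def)

lemma hval_add_le:
  fixes f g :: "('s::idem_semifield, 'k::ab_group_add) hahn"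
  shows "hval f \<le> m \<Longrightarrow> hval g \<le> m \<Longrightarrow> hval (f + g) \<le> m"
  unfolding hval_le_iff by (metis add.left_neutral hcoeff_add)

lemma hval_sum_le:
  fixes f :: "'i \<Rightarrow> ('s::idem_semifield, 'k::ab_group_add) hahn"
  assumes "\<And>a. a \<in> A \<Longrightarrow> hval (f a) \<le> m"
  shows "hval (sum f A) \<le> m"
  using assms by (induction A rule: infinite_finite_induct) (auto intro: hval_add_le)

lemma hcoeff_sum:
  fixes f :: "'i \<Rightarrow> ('s::idem_semifield, 'k::ab_group_add) hahn"
  shows "hcoeff (sum f A) s = (\<Sum>a\<in>A. hcoeff (f a) s)"
  by (induction A rule: infinite_finite_induct) auto

lemma hval_uminus [simp]: "hval (- f) = hval (f :: ('s::idem_semifield, 'k::ab_group_add) hahn)"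
proof -
  have "hval (- f) \<le> hval f" for f :: "('s, 'k) hahn"
    using hval_le_iff[of f "hval f"] by (auto simp: hval_le_iff)
  from this[of f] this[of "- f"] show ?thesis by simp
qed

text \<open>
  Only the leading coefficients of the largest summands reach level \<open>m\<close>, and unless they cancel the
  sum has valuation \<open>m\<close>.
\<close>

lemma hval_sum_eq:
  fixes f :: "'i \<Rightarrow> ('s::idem_semifield, 'k::ab_group_add) hahn"
  assumes "finite A" and le: "\<And>a. a \<in> A \<Longrightarrow> hval (f a) \<le> m"
    and nz: "m \<noteq> 0 \<Longrightarrow> (\<Sum>a | a \<in> A \<and> hval (f a) = m. hlc (f a)) \<noteq> 0"
  shows "hval (sum f A) = m"
proof (cases "m = 0")
  case True
  then have "f a = 0" if "a \<in> A" for a using le[OF that] by simp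
  then show ?thesis using True by simp
next
  case False
  have "hcoeff (sum f A) (inverse m) = (\<Sum>a\<in>A. if hval (f a) = m then hlc (f a) else 0)"
    unfolding hcoeff_sum using le by (intro sum.cong) (auto simp: hcoeff_level)
  also have "\<dots> = (\<Sum>a | a \<in> A \<and> hval (f a) = m. hlc (f a))"
    using assms(1) by (simp add: sum.inter_filter)
  finally have "hcoeff (sum f A) (inverse m) \<noteq> 0" using nz[OF False] by simp
  moreover have "hval (sum f A) \<le> m" by (rule hval_sum_le) (rule le)
  ultimately show ?thesis using hcoeff_level[of "sum f A" m] by (auto split: if_splits)
qed

lemma
  fixes f g :: "('s::idem_semifield, 'k::field) hahn"
  shows hval_mult: "hval (f * g) = hval f * hval g"
    and hlc_mult: "hlc (f * g) = hlc f * hlc g"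
proof -
  have "hval (f * g) = hval f * hval g \<and> hlc (f * g) = hlc f * hlc g"
  proof (cases "f = 0 \<or> g = 0")
    case True
    then show ?thesis by (auto simp: hlc_def)
  next
    case False
    let ?m = "hdeg f" and ?n = "hdeg g"
    have deg: "hcoeff f ?m \<noteq> 0" "hcoeff g ?n \<noteq> 0" "?m \<noteq> 0" "?n \<noteq> 0"
      using False hdeg(1)[of f] hdeg(1)[of g] by auto
    have le: "?m * ?n \<le> a * b" "a * b = ?m * ?n \<longleftrightarrow> a = ?m \<and> b = ?n"
      if "hcoeff f a \<noteq> 0" "hcoeff g b \<noteq> 0" for a b
    proof -
      have ab: "?m \<le> a" "?n \<le> b" using that hdeg(2)[of f a] hdeg(2)[of g b] False by auto
      then show "?m * ?n \<le> a * b" by (rule idem_mult_mono2)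
      show "a * b = ?m * ?n \<longleftrightarrow> a = ?m \<and> b = ?n"
      proof
        assume eq: "a * b = ?m * ?n"
        have "?m * ?n \<le> ?m * b" "?m * b \<le> a * b" using ab by (auto intro: idem_mult_mono2)
        then have "?m * b = ?m * ?n" using eq by simp
        then have "b = ?n" using deg idem_mult_left_cancel by metis
        moreover from this have "a = ?m" using eq deg idem_mult_left_cancel by (metis mult.commute)
        ultimately show "a = ?m \<and> b = ?n" by simp
      qed simp
    qed
    have "{(a, b). a \<in> hsupp f \<and> b \<in> hsupp g \<and> a * b = ?m * ?n} = {(?m, ?n)}"
      using le deg by auto
    then have c: "hcoeff (f * g) (?m * ?n) = hlc f * hlc g"
      using False by (simp add: hcoeff_mult hconv_def hlc_def)
    have nz: "hcoeff (f * g) (?m * ?n) \<noteq> 0" unfolding c using False by simp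
    have "hdeg (f * g) = ?m * ?n"
      unfolding hdeg_def[of "f * g"]
    proof (rule Least_equality)
      fix s assume "hcoeff (f * g) s \<noteq> 0"
      then have "\<exists>a b. s = a * b \<and> a \<in> hsupp f \<and> b \<in> hsupp g"
        using hsupp_products[of f g s] by (auto simp: hcoeff_mult)
      then show "?m * ?n \<le> s" using le(1) by auto
    qed (rule nz)
    moreover from nz have "f * g \<noteq> 0" by auto
    ultimately show ?thesis using c False by (simp add: hval_def hlc_def idem_inverse_mult)
  qed
  then show "hval (f * g) = hval f * hval g" "hlc (f * g) = hlc f * hlc g" by auto
qed

lemma
  fixes c :: "'k::ab_group_add" and s :: "'s::idem_semifield"
  assumes "c \<noteq> 0" "s \<noteq> 0"
  shows hval_hmonom: "hval (hmonom c s) = inverse s" and hlc_hmonom: "hlc (hmonom c s) = c"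
proof -
  have nz: "hmonom c s \<noteq> 0" using assms hcoeff_monom[of c s s] by auto
  have d: "hdeg (hmonom c s) = s"
    using hdeg(1)[OF nz] by (simp add: hcoeff_monom split: if_splits)
  show "hval (hmonom c s) = inverse s" "hlc (hmonom c s) = c"
    using nz d assms by (auto simp: hval_def hlc_def hcoeff_monom)
qed

lemma hval_one [simp]: "hval (1 :: ('s::idem_semifield, 'k::field) hahn) = 1"
proof -
  have "hval (1 :: ('s, 'k) hahn) * hval (1 :: ('s, 'k) hahn) = hval (1 :: ('s, 'k) hahn) * 1"
    by (simp flip: hval_mult)
  then show ?thesis using idem_mult_left_cancel hval_eq_0_iff by (metis zero_neq_one)
qed

lemma hlc_one [simp]: "hlc (1 :: ('s::idem_semifield, 'k::field) hahn) = 1"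
proof -
  have "hlc (1 :: ('s, 'k) hahn) * hlc (1 :: ('s, 'k) hahn) = hlc (1 :: ('s, 'k) hahn)"
    by (simp flip: hlc_mult)
  then show ?thesis by simp
qed

lemma hval_prod:
  fixes f :: "'i \<Rightarrow> ('s::idem_semifield, 'k::field) hahn"
  shows "hval (prod f A) = (\<Prod>a\<in>A. hval (f a))"
  by (induction A rule: infinite_finite_induct) (auto simp: hval_mult)

lemma hlc_prod:
  fixes f :: "'i \<Rightarrow> ('s::idem_semifield, 'k::field) hahn"
  shows "hlc (prod f A) = (\<Prod>a\<in>A. hlc (f a))"
  by (induction A rule: infinite_finite_induct) (auto simp: hlc_mult)

lemma hval_inverse: "hval (inverse f) = inverse (hval (f :: ('s::idem_semifield, 'k::field) hahn))"
proof (cases "f = 0")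
  case False
  then have "hval f * hval (inverse f) = hval f * inverse (hval f)"
    by (simp add: idem_right_inverse flip: hval_mult)
  then show ?thesis using False idem_mult_left_cancel hval_eq_0_iff by metis
qed (simp add: idem_inverse_zero)


section \<open>Points avoiding finitely many square-free polynomials\<close>

text \<open>
  A square-free polynomial is affine in each variable. Writing each as \<open>g + x h\<close> for the newly
  added variable \<open>x\<close>, choose the other variables so that \<open>h\<close> (or \<open>g\<close>, if \<open>h\<close> is zero as a polynomial)
  does not vanish; then each polynomial excludes at most one value of \<open>x\<close>, and \<open>x \<noteq> 0\<close> excludes
  one more.
\<close>

lemma generic_point:
  fixes a :: "'t \<Rightarrow> 'v set \<Rightarrow> 'k::field"
  assumes "finite X" "finite T" and large: "infinite (UNIV :: 'k set) \<or> card T + 1 < card (UNIV :: 'k set)"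
    and "\<And>t. t \<in> T \<Longrightarrow> \<exists>M\<subseteq>X. a t M \<noteq> 0"
  shows "\<exists>c. (\<forall>x\<in>X. c x \<noteq> 0) \<and> (\<forall>t\<in>T. (\<Sum>M\<in>Pow X. a t M * (\<Prod>x\<in>M. c x)) \<noteq> 0)"
  using assms(1,4)
proof (induction X arbitrary: a)
  case empty
  then show ?case by auto
next
  case (insert x X)
  (* The polynomial at t is G t + z * H t, with z the value of x. *)
  define h where "h t M = a t (insert x M)" for t M
  define p where "p t = (if \<exists>M\<subseteq>X. h t M \<noteq> 0 then h t else a t)" for t
  have "\<exists>M\<subseteq>X. p t M \<noteq> 0" if t: "t \<in> T" for t
  proof (cases "\<exists>M\<subseteq>X. h t M \<noteq> 0")
    case False
    obtain M where M: "M \<subseteq> insert x X" "a t M \<noteq> 0" using insert.prems[OF t] by blast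
    have "x \<notin> M"
    proof
      assume "x \<in> M"
      then have "h t (M - {x}) \<noteq> 0" "M - {x} \<subseteq> X" using M by (auto simp: h_def insert_absorb)
      then show False using False by blast
    qed
    then show ?thesis using M False by (auto simp: p_def)
  qed (auto simp: p_def)
  from insert.IH[of p, OF this] obtain c where c: "\<And>y. y \<in> X \<Longrightarrow> c y \<noteq> 0"
    "\<And>t. t \<in> T \<Longrightarrow> (\<Sum>M\<in>Pow X. p t M * (\<Prod>y\<in>M. c y)) \<noteq> 0" by blast
  define H where "H t = (\<Sum>M\<in>Pow X. h t M * (\<Prod>y\<in>M. c y))" for t
  define G where "G t = (\<Sum>M\<in>Pow X. a t M * (\<Prod>y\<in>M. c y))" for t
  (* H t = 0 can only happen if h t is the zero polynomial, and then c was chosen for G t. *)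
  have nz: "G t \<noteq> 0" if "t \<in> T" "H t = 0" for t
    using c(2)[OF that(1)] that(2) by (auto simp: p_def G_def H_def split: if_splits)
  have "insert 0 ((\<lambda>t. - G t / H t) ` T) \<noteq> UNIV"
  proof
    assume eq: "insert 0 ((\<lambda>t. - G t / H t) ` T) = UNIV"
    have "finite (UNIV :: 'k set)" unfolding eq[symmetric] using assms(2) by simp
    moreover have "card (UNIV :: 'k set) \<le> card T + 1"
      unfolding eq[symmetric] using card_image_le[OF assms(2), of "\<lambda>t. - G t / H t"] assms(2)
      by (simp add: card_insert_if)
    ultimately show False using large by simp
  qed
  then obtain z where z: "z \<noteq> 0" "\<And>t. t \<in> T \<Longrightarrow> z \<noteq> - G t / H t" by blast
  have "(\<Sum>M\<in>Pow (insert x X). a t M * (\<Prod>y\<in>M. (c(x := z)) y)) = G t + z * H t" for t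
  proof -
    have upd: "(\<Prod>y\<in>M. (c(x := z)) y) = (\<Prod>y\<in>M. c y)" if "M \<subseteq> X" for M
      using that insert.hyps by (intro prod.cong) auto
    have upd': "(\<Prod>y\<in>insert x M. (c(x := z)) y) = z * (\<Prod>y\<in>M. c y)" if "M \<subseteq> X" for M
    proof -
      have "finite M" "x \<notin> M" using that insert.hyps finite_subset by auto
      then show ?thesis using upd[OF that] by simp
    qed
    have "(\<Sum>M\<in>Pow (insert x X). a t M * (\<Prod>y\<in>M. (c(x := z)) y))
        = (\<Sum>M\<in>Pow X. a t M * (\<Prod>y\<in>M. (c(x := z)) y))
          + (\<Sum>M\<in>insert x ` Pow X. a t M * (\<Prod>y\<in>M. (c(x := z)) y))"
      unfolding Pow_insert using insert.hyps by (intro sum.union_disjoint) auto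
    also have "(\<Sum>M\<in>insert x ` Pow X. a t M * (\<Prod>y\<in>M. (c(x := z)) y))
        = (\<Sum>M\<in>Pow X. a t (insert x M) * (\<Prod>y\<in>insert x M. (c(x := z)) y))"
      using insert.hyps by (intro sum.reindex_cong[OF _ refl refl]) (auto simp: inj_on_def)
    also have "\<dots> = z * H t"
      unfolding H_def h_def sum_distrib_left
      by (intro sum.cong refl) (simp only: upd' PowD, simp add: ac_simps)
    also have "(\<Sum>M\<in>Pow X. a t M * (\<Prod>y\<in>M. (c(x := z)) y)) = G t"
      unfolding G_def by (intro sum.cong refl) (simp only: upd PowD)
    finally show ?thesis .
  qed
  moreover have "G t + z * H t \<noteq> 0" if "t \<in> T" for t
  proof (cases "H t = 0")
    case False
    then show ?thesis using z(2)[OF that] by (auto simp: field_simps add_eq_0_iff)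
  qed (use nz[OF that] in simp)
  ultimately show ?case using c(1) z(1) by (intro exI[of _ "c(x := z)"]) auto
qed

text \<open>
  The same for polynomials given as sums over arbitrary index sets of monomials. Since \<open>g t\<close> is
  injective, no coefficients are added up when the terms are collected by monomial.
\<close>

lemma generic_point_monomials:
  fixes \<beta> :: "'t \<Rightarrow> 'r \<Rightarrow> 'k::field" and g :: "'t \<Rightarrow> 'r \<Rightarrow> 'v set"
  assumes fin: "finite X" "finite T" "\<And>t. t \<in> T \<Longrightarrow> finite (R t)"
    and large: "infinite (UNIV :: 'k set) \<or> card T + 1 < card (UNIV :: 'k set)"
    and g: "\<And>t. t \<in> T \<Longrightarrow> inj_on (g t) (R t)" "\<And>t \<rho>. t \<in> T \<Longrightarrow> \<rho> \<in> R t \<Longrightarrow> g t \<rho> \<subseteq> X"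
    and nz: "\<And>t. t \<in> T \<Longrightarrow> \<exists>\<rho>\<in>R t. \<beta> t \<rho> \<noteq> 0"
  shows "\<exists>c. (\<forall>x\<in>X. c x \<noteq> 0) \<and> (\<forall>t\<in>T. (\<Sum>\<rho>\<in>R t. \<beta> t \<rho> * (\<Prod>x\<in>g t \<rho>. c x)) \<noteq> 0)"
proof -
  define a where "a t M = (\<Sum>\<rho>\<in>R t. if g t \<rho> = M then \<beta> t \<rho> else 0)" for t M
  have "\<exists>M\<subseteq>X. a t M \<noteq> 0" if t: "t \<in> T" for t
  proof -
    obtain \<rho> where \<rho>: "\<rho> \<in> R t" "\<beta> t \<rho> \<noteq> 0" using nz[OF t] by auto
    have "a t (g t \<rho>) = (\<Sum>\<rho>'\<in>R t. if \<rho>' = \<rho> then \<beta> t \<rho> else 0)"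
      unfolding a_def using g(1)[OF t] \<rho>(1) by (intro sum.cong refl) (auto dest: inj_onD)
    then have "a t (g t \<rho>) \<noteq> 0" using \<rho> fin(3)[OF t] by simp
    then show ?thesis using g(2)[OF t \<rho>(1)] by blast
  qed
  then have "\<exists>c. (\<forall>x\<in>X. c x \<noteq> 0) \<and> (\<forall>t\<in>T. (\<Sum>M\<in>Pow X. a t M * (\<Prod>x\<in>M. c x)) \<noteq> 0)"
    by (rule generic_point[where a = a, OF fin(1,2) large])
  then obtain c where c: "\<forall>x\<in>X. c x \<noteq> 0"
    "\<forall>t\<in>T. (\<Sum>M\<in>Pow X. a t M * (\<Prod>x\<in>M. c x)) \<noteq> 0" by (elim exE conjE)
  have "(\<Sum>M\<in>Pow X. a t M * (\<Prod>x\<in>M. c x)) = (\<Sum>\<rho>\<in>R t. \<beta> t \<rho> * (\<Prod>x\<in>g t \<rho>. c x))" if t: "t \<in> T" for t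
  proof -
    have "(\<Sum>M\<in>Pow X. a t M * (\<Prod>x\<in>M. c x)) =
        (\<Sum>\<rho>\<in>R t. \<Sum>M\<in>Pow X. if M = g t \<rho> then \<beta> t \<rho> * (\<Prod>x\<in>g t \<rho>. c x) else 0)"
      unfolding a_def sum_distrib_right by (subst sum.swap) (intro sum.cong refl, auto)
    also have "\<dots> = (\<Sum>\<rho>\<in>R t. \<beta> t \<rho> * (\<Prod>x\<in>g t \<rho>. c x))"
      using g(2)[OF t] fin(1) by (intro sum.cong refl) (auto simp: sum.delta)
    finally show ?thesis .
  qed
  then show ?thesis using c by auto
qed

lemma one_less_card_field: "finite (UNIV :: 'k::field set) \<Longrightarrow> 1 < card (UNIV :: 'k set)"
  using card_mono[of "UNIV :: 'k set" "{0, 1}"] by simp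


section \<open>A tropical linear space determines its rank and Pluecker vector\<close>

lemma trop_plucker_support:
  assumes "trop_plucker E d w" "w I \<noteq> 0"
  shows "I \<subseteq> E" "card I = d"
  using assms by (auto simp: trop_plucker_def)

lemma trop_plucker_card_neq: "trop_plucker E d w \<Longrightarrow> card I \<noteq> d \<Longrightarrow> w I = 0"
  by (auto simp: trop_plucker_def)

lemma plucker_space_le:
  assumes "v \<in> plucker_space E d w" "J \<subseteq> E" "card J = d + 1" "j \<in> J"
  shows "w (J - {j}) * v j \<le> (\<Sum>i\<in>J - {j}. w (J - {i}) * v i)"
proof -
  have "finite J" using assms(3) by (metis Suc_eq_plus1 card.infinite nat.distinct(1))
  then show ?thesis
    using assms sum_eq_sum_remove_iff[of J j "\<lambda>i. w (J - {i}) * v i"] by (auto simp: plucker_space_def)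
qed

lemma plucker_spaceI:
  assumes "v \<in> coord_space E"
    and "\<And>J j. J \<subseteq> E \<Longrightarrow> card J = d + 1 \<Longrightarrow> j \<in> J \<Longrightarrow>
      w (J - {j}) * v j \<le> (\<Sum>i\<in>J - {j}. w (J - {i}) * v i)"
  shows "v \<in> plucker_space E d w"
  unfolding plucker_space_def
proof (intro CollectI conjI allI impI ballI)
  fix J j assume J: "J \<subseteq> E" "card J = d + 1" "j \<in> J"
  have "finite J" using J(2) by (metis Suc_eq_plus1 card.infinite nat.distinct(1))
  then show "(\<Sum>i\<in>J. w (J - {i}) * v i) = (\<Sum>i\<in>J - {j}. w (J - {i}) * v i)"
    using assms(2)[OF J] J(3) by (subst sum_eq_sum_remove_iff)
qed (rule assms(1))

text \<open>
  The tropical Pluecker relations say precisely that the rows of the Pluecker vector obtained by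
  fixing \<open>d - 1\<close> of the indices lie in the linear space.
\<close>

lemma cocircuit_in_plucker_space:
  assumes w: "trop_plucker E d w" and K: "K \<subseteq> E" "card K + 1 = d"
  shows "(\<lambda>k. w (insert k K)) \<in> plucker_space E d w"
proof (rule plucker_spaceI)
  show "(\<lambda>k. w (insert k K)) \<in> coord_space E"
    using trop_plucker_support(1)[OF w] by (auto simp: coord_space_def)
  fix J j assume J: "J \<subseteq> E" "card J = d + 1" "j \<in> J"
  have fin: "finite J" using J(2) by (metis Suc_eq_plus1 card.infinite nat.distinct(1))
  have wK: "w (insert i K) = 0" if "i \<in> K" for i
    using that K trop_plucker_card_neq[OF w, of K] by (simp add: insert_absorb)
  show "w (J - {j}) * w (insert j K) \<le> (\<Sum>i\<in>J - {j}. w (J - {i}) * w (insert i K))"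
  proof (cases "j \<in> K")
    case False
    then have j: "j \<in> J - K" using J by simp
    then have "(\<Sum>i\<in>J - K. w (J - {i}) * w (insert i K)) = (\<Sum>i\<in>J - K - {j}. w (J - {i}) * w (insert i K))"
      using w J K unfolding trop_plucker_def by blast
    then have "w (J - {j}) * w (insert j K) \<le> (\<Sum>i\<in>J - K - {j}. w (J - {i}) * w (insert i K))"
      using sum_eq_sum_remove_iff[OF _ j, of "\<lambda>i. w (J - {i}) * w (insert i K)"] fin by auto
    also have "\<dots> = (\<Sum>i\<in>J - {j}. w (J - {i}) * w (insert i K))"
      using fin wK by (intro sum.mono_neutral_left) auto
    finally show ?thesis .
  qed (simp add: wK)
qed

text \<open>
  Basis exchange is the Pluecker relation for \<open>I' \<union> {i}\<close> and \<open>I - {i}\<close>: its term at \<open>i\<close> is nonzero, so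
  another one is.
\<close>

lemma trop_plucker_exchange:
  assumes w: "trop_plucker E d w" and I: "w I \<noteq> 0" "finite I" and I': "w I' \<noteq> 0" "finite I'" and i: "i \<in> I - I'"
  shows "\<exists>k\<in>I' - I. w (insert k (I - {i})) \<noteq> 0"
proof -
  let ?K = "I - {i}" and ?J = "insert i I'"
  note sI = trop_plucker_support[OF w I(1)] and sI' = trop_plucker_support[OF w I'(1)]
  have K: "?K \<subseteq> E" "card ?K + 1 = d"
    using sI i I(2) card_Suc_Diff1[of I i] by auto
  have J: "?J \<subseteq> E" "card ?J = d + 1" using sI sI' i I'(2) by auto
  have "w (?J - {i}) * w (insert i ?K) \<noteq> 0"
    using i I I' by (simp add: insert_absorb idem_mult_eq_0_iff)
  then have "(\<Sum>k\<in>?J - {i}. w (?J - {k}) * w (insert k ?K)) \<noteq> 0"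
    using plucker_space_le[OF cocircuit_in_plucker_space[OF w K] J, of i] by force
  then obtain k where k: "k \<in> ?J - {i}" "w (?J - {k}) * w (insert k ?K) \<noteq> 0"
    by (meson sum.neutral)
  have "k \<notin> I"
  proof
    assume "k \<in> I"
    then have "insert k ?K = ?K" using k by auto
    then show False using k(2) trop_plucker_card_neq[OF w, of ?K] K by (auto simp: idem_mult_eq_0_iff)
  qed
  then show ?thesis using k by (auto simp: idem_mult_eq_0_iff)
qed

text \<open>
  Bases can be read off the space: a set contains a basis exactly if no nonzero vector of the space
  vanishes on it.
\<close>

lemma spanning_iff_contains_basis:
  assumes fin: "finite E" and w: "trop_plucker E d w" and I: "I \<subseteq> E"
  shows "(\<forall>v\<in>plucker_space E d w. (\<forall>i\<in>I. v i = 0) \<longrightarrow> (\<forall>k. v k = 0)) \<longleftrightarrow> (\<exists>I'\<subseteq>I. w I' \<noteq> 0)"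
    (is "?span \<longleftrightarrow> _")
proof
  assume span: ?span
  have fin': "finite A" if "w A \<noteq> 0" for A
    using trop_plucker_support(1)[OF w that] fin by (rule finite_subset)
  obtain B where "w B \<noteq> 0" using w by (auto simp: trop_plucker_def)
  moreover have "\<forall>A. w A \<noteq> 0 \<longrightarrow> card (A \<inter> I) < card E + 1"
    using fin I by (auto intro!: card_mono simp: less_Suc_eq_le)
  ultimately obtain B where B: "w B \<noteq> 0" and max: "\<And>A. w A \<noteq> 0 \<Longrightarrow> card (A \<inter> I) \<le> card (B \<inter> I)"
    using ex_has_greatest_nat[of "\<lambda>A. w A \<noteq> 0" B "\<lambda>A. card (A \<inter> I)" "card E + 1"] by auto
  (* If i is in B but not in I, then no exchange of i increases the overlap, so the cocircuit
     of B at i vanishes on I. *)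
  have "B \<subseteq> I"
  proof (rule ccontr)
    assume "\<not> B \<subseteq> I"
    then obtain i where i: "i \<in> B" "i \<notin> I" by auto
    let ?K = "B - {i}"
    have K: "?K \<subseteq> E" "card ?K + 1 = d"
      using trop_plucker_support[OF w B] i fin'[OF B] card_Suc_Diff1[of B i] by auto
    have "w (insert i ?K) \<noteq> 0" using B i by (simp add: insert_absorb)
    then have "\<not> (\<forall>k\<in>I. w (insert k ?K) = 0)"
      using bspec[OF span cocircuit_in_plucker_space[OF w K]] by metis
    then obtain k where k: "k \<in> I" "w (insert k ?K) \<noteq> 0" by blast
    have "k \<notin> B"
    proof
      assume "k \<in> B"
      then have "insert k ?K = ?K" using k i by auto
      then show False using k(2) K trop_plucker_card_neq[OF w, of ?K] by auto
    qed
    have "insert k ?K \<inter> I = insert k (B \<inter> I)" using i k by auto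
    then have "card (insert k ?K \<inter> I) = card (B \<inter> I) + 1"
      using \<open>k \<notin> B\<close> fin'[OF B] by simp
    then show False using max[OF k(2)] by simp
  qed
  then show "\<exists>I'\<subseteq>I. w I' \<noteq> 0" using B by blast
next
  assume "\<exists>I'\<subseteq>I. w I' \<noteq> 0"
  then obtain B where B: "B \<subseteq> I" "w B \<noteq> 0" by blast
  show ?span
  proof (intro ballI impI allI)
    fix v k assume v: "v \<in> plucker_space E d w" "\<forall>i\<in>I. v i = 0"
    show "v k = 0"
    proof (cases "k \<in> E - B")
      case True
      let ?J = "insert k B"
      have "finite B" using trop_plucker_support(1)[OF w B(2)] fin by (rule finite_subset)
      then have J: "?J \<subseteq> E" "card ?J = d + 1" using trop_plucker_support[OF w B(2)] True by auto
      have "(\<Sum>i\<in>?J - {k}. w (?J - {i}) * v i) = 0"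
        using v B by (intro sum.neutral) auto
      then have "w (?J - {k}) * v k \<le> 0" using plucker_space_le[OF v(1) J, of k] by simp
      then show ?thesis using B True by (simp add: idem_mult_eq_0_iff)
    next
      case False
      then show ?thesis using v B by (auto simp: plucker_space_def coord_space_def)
    qed
  qed
qed

text \<open>
  For a vector that vanishes on \<open>I - {i}\<close> the condition for \<open>I \<union> {k}\<close> involves only two terms. Hence
  such a vector determines the ratio of the two Pluecker coordinates.
\<close>

lemma plucker_ratio:
  assumes w: "trop_plucker E d w" and fin: "finite E" and I: "w I \<noteq> 0" "i \<in> I" and k: "k \<in> E - I"
    and v: "v \<in> plucker_space E d w" "\<And>j. j \<in> I - {i} \<Longrightarrow> v j = 0"
  shows "w I * v k = w (insert k (I - {i})) * v i"
proof -
  let ?J = "insert k I"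
  note sI = trop_plucker_support[OF w I(1)]
  have fI: "finite I" using sI(1) fin by (rule finite_subset)
  have J: "?J \<subseteq> E" "card ?J = d + 1" using sI k fI by auto
  have [simp]: "?J - {k} = I" "?J - {i} = insert k (I - {i})" using k I by auto
  have "(\<Sum>m\<in>?J - {k}. w (?J - {m}) * v m) = (\<Sum>m\<in>{i}. w (?J - {m}) * v m)"
    using I k fI v by (intro sum.mono_neutral_right) auto
  then have le: "w I * v k \<le> w (insert k (I - {i})) * v i"
    using plucker_space_le[OF v(1) J, of k] by simp
  have "(\<Sum>m\<in>?J - {i}. w (?J - {m}) * v m) = (\<Sum>m\<in>{k}. w (?J - {m}) * v m)"
    using I k fI v by (intro sum.mono_neutral_right) auto
  then have "w (insert k (I - {i})) * v i \<le> w I * v k"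
    using plucker_space_le[OF v(1) J, of i] I by simp
  with le show ?thesis by simp
qed

lemma plucker_space_determines_bases:
  assumes fin: "finite E" and w: "trop_plucker E d w" and w': "trop_plucker E d' w'"
    and eq: "plucker_space E d w = plucker_space E d' w'" and I: "w I \<noteq> 0"
  shows "w' I \<noteq> 0"
proof -
  have IE: "I \<subseteq> E" using trop_plucker_support[OF w I] by simp
  (* I contains a basis I' of w', and I' a basis of w, which has the same size as I. *)
  obtain I' where I': "I' \<subseteq> I" "w' I' \<noteq> 0"
    using spanning_iff_contains_basis[OF fin w IE] spanning_iff_contains_basis[OF fin w' IE] eq I by auto
  have I'E: "I' \<subseteq> E" using I' IE by simp
  obtain I'' where I'': "I'' \<subseteq> I'" "w I'' \<noteq> 0"
    using spanning_iff_contains_basis[OF fin w I'E] spanning_iff_contains_basis[OF fin w' I'E] eq I' by auto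
  have "I'' = I"
    using trop_plucker_support(2)[OF w] I I' I'' IE fin by (intro card_subset_eq) (auto dest: finite_subset)
  then have "I' = I" using I'(1) I''(1) by blast
  then show ?thesis using I'(2) by simp
qed

text \<open>
  Two bases are joined by a chain of exchanges, and each exchange changes both Pluecker vectors by
  the same ratio.
\<close>

lemma plucker_space_determines_vector:
  assumes fin: "finite E" and w: "trop_plucker E d w" and w': "trop_plucker E d' w'"
    and eq: "plucker_space E d w = plucker_space E d' w'"
  shows "d' = d" and "\<exists>c. c \<noteq> 0 \<and> (\<forall>I. w' I = c * w I)"
proof -
  have bases: "w I \<noteq> 0 \<longleftrightarrow> w' I \<noteq> 0" for I
    using plucker_space_determines_bases[OF fin w w' eq, of I] plucker_space_determines_bases[OF fin w' w eq[symmetric], of I]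
    by argo
  obtain I0 where I0: "w I0 \<noteq> 0" using w by (auto simp: trop_plucker_def)
  then have "w' I0 \<noteq> 0" using bases[of I0] by simp
  then show "d' = d" using trop_plucker_support(2)[OF w I0] trop_plucker_support(2)[OF w'] by simp
  have fin': "finite I" if "w I \<noteq> 0" for I
    using trop_plucker_support(1)[OF w that] fin by (rule finite_subset)
  have ratio: "w' I * w I0 = w' I0 * w I" if "w I \<noteq> 0" for I
    using that
  proof (induction "card (I - I0)" arbitrary: I rule: less_induct)
    case less
    show ?case
    proof (cases "I \<subseteq> I0")
      case True
      then have "I = I0"
        using trop_plucker_support(2)[OF w] less.prems I0 fin' by (intro card_subset_eq) auto
      then show ?thesis by simp
    next
      case False
      then obtain i where i: "i \<in> I - I0" by auto
      obtain k where k: "k \<in> I0 - I" "w (insert k (I - {i})) \<noteq> 0"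
        using trop_plucker_exchange[OF w less.prems fin'[OF less.prems] I0 fin'[OF I0] i] by blast
      let ?I = "insert k (I - {i})"
      have "?I - I0 = I - I0 - {i}" using k by auto
      then have "card (?I - I0) < card (I - I0)"
        using i fin'[OF less.prems] card_Diff1_less[of "I - I0" i] by simp
      then have IH: "w' ?I * w I0 = w' I0 * w ?I" using less.hyps k(2) by blast
      have K: "I - {i} \<subseteq> E" "card (I - {i}) + 1 = d"
        using trop_plucker_support[OF w less.prems] i fin'[OF less.prems] card_Suc_Diff1[of I i] by auto
      let ?v = "\<lambda>m. w (insert m (I - {i}))"
      have v: "?v \<in> plucker_space E d' w'" using cocircuit_in_plucker_space[OF w K] eq by simp
      have v0: "?v j = 0" if "j \<in> I - {i}" for j
        using that K trop_plucker_card_neq[OF w, of "I - {i}"] by (simp add: insert_absorb)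
      have "w' I \<noteq> 0" "i \<in> I" "k \<in> E - I"
        using less.prems bases[of I] i k trop_plucker_support(1)[OF w I0] by auto
      from plucker_ratio[OF w' fin this v v0] have exch: "w' I * w ?I = w' ?I * w I"
        using \<open>i \<in> I\<close> by (simp add: insert_absorb)
      have "w ?I * (w' I * w I0) = (w' I * w ?I) * w I0" by (simp add: ac_simps)
      also have "\<dots> = w I * (w' ?I * w I0)" unfolding exch by (simp add: ac_simps)
      also have "\<dots> = w ?I * (w' I0 * w I)" unfolding IH by (simp add: ac_simps)
      finally show ?thesis using idem_mult_left_cancel[OF k(2)] by simp
    qed
  qed
  let ?c = "w' I0 * inverse (w I0)"
  have "w' I = ?c * w I" for I
  proof (cases "w I = 0")
    case False
    have "?c * w I = inverse (w I0) * (w' I0 * w I)" by (simp add: ac_simps)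
    also have "\<dots> = inverse (w I0) * w I0 * w' I" unfolding ratio[OF False, symmetric] by (simp add: ac_simps)
    finally show ?thesis using I0 by (simp add: idem_left_inverse)
  qed (use bases[of I] in auto)
  moreover have "?c \<noteq> 0" using I0 bases[of I0] by (simp add: idem_mult_eq_0_iff)
  ultimately show "\<exists>c. c \<noteq> 0 \<and> (\<forall>I. w' I = c * w I)" by blast
qed

lemma plucker_space_scale:
  fixes w w' :: "'e set \<Rightarrow> 's::idem_semifield"
  assumes "c \<noteq> 0" and w': "\<And>I. I \<subseteq> E \<Longrightarrow> card I = d \<Longrightarrow> w' I = c * w I"
  shows "plucker_space E d w' = plucker_space E d w"
proof -
  have scaled: "(\<Sum>i\<in>A. w' (J - {i}) * v i) = c * (\<Sum>i\<in>A. w (J - {i}) * v i)"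
    if "J \<subseteq> E" "card J = d + 1" "A \<subseteq> J" for A J v
    unfolding sum_distrib_left
  proof (intro sum.cong refl)
    fix i assume "i \<in> A"
    then have "w' (J - {i}) = c * w (J - {i})" using that by (intro w') auto
    then show "w' (J - {i}) * v i = c * (w (J - {i}) * v i)" by (simp add: mult.assoc)
  qed
  have "(\<Sum>i\<in>J. w' (J - {i}) * v i) = (\<Sum>i\<in>J - {j}. w' (J - {i}) * v i) \<longleftrightarrow>
      (\<Sum>i\<in>J. w (J - {i}) * v i) = (\<Sum>i\<in>J - {j}. w (J - {i}) * v i)" if "J \<subseteq> E" "card J = d + 1" for J j v
    unfolding scaled[OF that subset_refl] scaled[OF that Diff_subset] by (rule idem_mult_left_cancel[OF assms(1)])
  then show ?thesis unfolding plucker_space_def by (intro Collect_cong) (simp cong: imp_cong conj_cong)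
qed


section \<open>The Pluecker vector of a tropical graph\<close>

lemma wedge_ext_basis_singleton:
  assumes "finite Z"
  shows "wedge u (ext_basis {x}) Z = (if x \<in> Z then u (Z - {x}) else 0)"
proof -
  have iff: "Z - J = {x} \<longleftrightarrow> x \<in> Z \<and> J = Z - {x}" if "J \<subseteq> Z" for J using that by auto
  have "wedge u (ext_basis {x}) Z = (\<Sum>J\<in>Pow Z. if J = Z - {x} then (if x \<in> Z then u (Z - {x}) else 0) else 0)"
    unfolding wedge_def ext_basis_def by (intro sum.cong refl) (auto simp: iff)
  also have "\<dots> = (if x \<in> Z then u (Z - {x}) else 0)" using assms by (simp add: sum.delta)
  finally show ?thesis .
qed

lemma fold_wedge_basis:
  fixes w :: "'e set \<Rightarrow> 's::idem_semifield" and G :: "'f set"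
  assumes "finite G" "finite Z"
  shows "Finite_Set.fold (\<lambda>j u. wedge u (ext_basis {Inr j})) (ext_Inl w) G Z = (if Inr -` Z = G then w (Inl -` Z) else 0)"
  using assms
proof (induction G arbitrary: Z)
  case empty
  have "z \<in> range Inl" if "z \<in> Z" "Inr -` Z = {}" for z using that by (cases z) auto
  then have "Z \<subseteq> range Inl \<longleftrightarrow> Inr -` Z = {}" by blast
  then show ?case by (auto simp: ext_Inl_def)
next
  case (insert j G)
  interpret comp_fun_commute "\<lambda>(j :: 'f) u. wedge u (ext_basis {Inr j}) :: ('e + 'f) set \<Rightarrow> 's"
    by (rule comp_fun_commute_wedge)
  let ?u = "Finite_Set.fold (\<lambda>j u. wedge u (ext_basis {Inr j})) (ext_Inl w)"
  have "?u (insert j G) = wedge (?u G) (ext_basis {Inr j})"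
    using insert.hyps by (rule fold_insert)
  then have "?u (insert j G) Z = wedge (?u G) (ext_basis {Inr j}) Z" by (rule fun_cong)
  also have "\<dots> = (if Inr j \<in> Z then ?u G (Z - {Inr j}) else 0)"
    by (rule wedge_ext_basis_singleton[OF insert.prems])
  also have "?u G (Z - {Inr j}) = (if Inr -` (Z - {Inr j}) = G then w (Inl -` (Z - {Inr j})) else 0)"
    using insert.prems by (intro insert.IH) simp
  also have "Inl -` (Z - {Inr j}) = Inl -` Z" by auto
  finally have "?u (insert j G) Z = (if Inr j \<in> Z \<and> Inr -` (Z - {Inr j}) = G then w (Inl -` Z) else 0)"
    by simp
  also have "Inr j \<in> Z \<and> Inr -` (Z - {Inr j}) = G \<longleftrightarrow> Inr -` Z = insert j G" using insert.hyps by auto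
  finally show ?case .
qed

text \<open>Multiplying with the hyperplane of a linear form is contraction with that form.\<close>

lemma ext_dot_star:
  assumes "finite V" "Z \<subseteq> V"
  shows "ext_dot V u (star V l) Z = (\<Sum>Y\<in>Pow (V - Z). u (Z \<union> Y) * l Y)"
proof -
  have "ext_dot V u (star V l) Z = wedge (star V u) (star V (star V l)) (V - Z)"
    unfolding ext_dot_def by (subst star_def) (simp add: assms(2))
  also have "\<dots> = (\<Sum>J\<in>Pow (V - Z). star V u J * star V (star V l) (V - Z - J))"
    by (simp only: wedge_def)
  also have "\<dots> = (\<Sum>Y\<in>Pow (V - Z). u (Z \<union> Y) * l Y)"
  proof (rule sum.reindex_bij_witness[where i = "\<lambda>Y. V - Z - Y" and j = "\<lambda>J. V - Z - J"])
    fix J assume J: "J \<in> Pow (V - Z)"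
    then have "Z \<union> (V - Z - J) = V - J" "V - (V - (V - Z - J)) = V - Z - J" "V - Z - J \<subseteq> V" "J \<subseteq> V"
      using assms by auto
    then show "u (Z \<union> (V - Z - J)) * l (V - Z - J) = star V u J * star V (star V l) (V - Z - J)"
      by (simp add: star_def)
  qed auto
  finally show ?thesis .
qed

lemma ext_dot_graph_form:
  assumes fin: "finite E" "finite F" and "j \<in> F" and Z: "Z \<subseteq> E <+> F"
  shows "ext_dot (E <+> F) u (star (E <+> F) (graph_form E A j)) Z =
    (if Inr j \<in> Z then 0 else u (insert (Inr j) Z)) +
    (\<Sum>i\<in>E. if Inl i \<in> Z then 0 else A (j, i) * u (insert (Inl i) Z))"
proof -
  let ?P = "Pow ((E <+> F) - Z)"
  have P: "finite ?P" using fin by simp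
  have single: "(\<Sum>Y\<in>?P. u (Z \<union> Y) * ext_basis {x} Y) = (if x \<in> Z then 0 else u (insert x Z))"
    if "x \<in> E <+> F" for x
  proof -
    have "(\<Sum>Y\<in>?P. u (Z \<union> Y) * ext_basis {x} Y) = (\<Sum>Y\<in>?P. if Y = {x} then u (insert x Z) else 0)"
      by (intro sum.cong refl) (auto simp: ext_basis_def)
    also have "\<dots> = (if x \<in> Z then 0 else u (insert x Z))" using P that by (subst sum.delta) auto
    finally show ?thesis .
  qed
  have "ext_dot (E <+> F) u (star (E <+> F) (graph_form E A j)) Z =
      (\<Sum>Y\<in>?P. u (Z \<union> Y) * graph_form E A j Y)"
    using fin by (intro ext_dot_star Z) simp
  also have "\<dots> = (\<Sum>Y\<in>?P. (\<Sum>i\<in>E. A (j, i) * (u (Z \<union> Y) * ext_basis {Inl i} Y)) + u (Z \<union> Y) * ext_basis {Inr j} Y)"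
    by (simp add: graph_form_def distrib_left sum_distrib_left ac_simps)
  also have "\<dots> = (\<Sum>i\<in>E. A (j, i) * (\<Sum>Y\<in>?P. u (Z \<union> Y) * ext_basis {Inl i} Y)) + (\<Sum>Y\<in>?P. u (Z \<union> Y) * ext_basis {Inr j} Y)"
    unfolding sum.distrib by (subst sum.swap) (simp add: sum_distrib_left)
  also have "(\<Sum>Y\<in>?P. u (Z \<union> Y) * ext_basis {Inr j} Y) = (if Inr j \<in> Z then 0 else u (insert (Inr j) Z))"
    using assms by (intro single) auto
  also have "(\<Sum>i\<in>E. A (j, i) * (\<Sum>Y\<in>?P. u (Z \<union> Y) * ext_basis {Inl i} Y)) =
      (\<Sum>i\<in>E. if Inl i \<in> Z then 0 else A (j, i) * u (insert (Inl i) Z))"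
  proof (intro sum.cong refl)
    fix i assume "i \<in> E"
    then have "Inl i \<in> E <+> F" by auto
    from single[OF this]
    show "A (j, i) * (\<Sum>Y\<in>?P. u (Z \<union> Y) * ext_basis {Inl i} Y) = (if Inl i \<in> Z then 0 else A (j, i) * u (insert (Inl i) Z))"
      by simp
  qed
  finally show ?thesis by (simp only: add.commute)
qed

text \<open>
  The coordinate of \<open>w\<close> that remains when each form \<open>\<rho>\<^sub>j\<close>, \<open>j \<in> J\<close>, contributes its
  \<open>\<sigma> j\<close>-th term.
\<close>

definition graph_weight :: "('e set \<Rightarrow> 's::zero) \<Rightarrow> 'e set \<Rightarrow> 'f set \<Rightarrow> ('f \<Rightarrow> 'e) \<Rightarrow> 's" where
  "graph_weight w I J \<sigma> = (if inj_on \<sigma> J \<and> \<sigma> ` J \<inter> I = {} then w (I \<union> \<sigma> ` J) else 0)"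

lemma graph_weight_fun_upd:
  assumes "j \<notin> J"
  shows "graph_weight w I (insert j J) (\<sigma>(j := i)) = (if i \<in> I then 0 else graph_weight w (insert i I) J \<sigma>)"
proof -
  have img: "(\<sigma>(j := i)) ` J = \<sigma> ` J" using assms by (auto simp: image_iff)
  have "inj_on (\<sigma>(j := i)) J \<longleftrightarrow> inj_on \<sigma> J" using assms by (intro inj_on_cong) auto
  then have inj: "inj_on (\<sigma>(j := i)) (insert j J) \<longleftrightarrow> inj_on \<sigma> J \<and> i \<notin> \<sigma> ` J"
    using assms img by (simp add: inj_on_insert del: fun_upd_image)
  have img': "(\<sigma>(j := i)) ` insert j J = insert i (\<sigma> ` J)" by (simp only: image_insert img fun_upd_same)
  show ?thesis
    unfolding graph_weight_def inj img' by auto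
qed

lemma sum_graph_weight_insert:
  fixes A :: "'f \<times> 'e \<Rightarrow> 's::comm_semiring_1"
  assumes "finite E" "finite J" "j \<notin> J"
  shows "(\<Sum>\<sigma>\<in>insert j J \<rightarrow>\<^sub>E E. (\<Prod>x\<in>insert j J. A (x, \<sigma> x)) * graph_weight w I (insert j J) \<sigma>) =
    (\<Sum>i\<in>E. if i \<in> I then 0 else
       A (j, i) * (\<Sum>\<sigma>\<in>J \<rightarrow>\<^sub>E E. (\<Prod>x\<in>J. A (x, \<sigma> x)) * graph_weight w (insert i I) J \<sigma>))"
proof -
  have "(\<Sum>\<sigma>\<in>insert j J \<rightarrow>\<^sub>E E. (\<Prod>x\<in>insert j J. A (x, \<sigma> x)) * graph_weight w I (insert j J) \<sigma>) =
      (\<Sum>(i, \<sigma>)\<in>E \<times> (J \<rightarrow>\<^sub>E E). (\<Prod>x\<in>insert j J. A (x, (\<sigma>(j := i)) x)) * graph_weight w I (insert j J) (\<sigma>(j := i)))"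
    unfolding PiE_insert_eq
    by (subst sum.reindex) (use assms inj_combinator[of j J "\<lambda>_. E"] in \<open>auto simp: case_prod_unfold\<close>)
  also have "\<dots> = (\<Sum>i\<in>E. \<Sum>\<sigma>\<in>J \<rightarrow>\<^sub>E E. if i \<in> I then 0 else
      A (j, i) * ((\<Prod>x\<in>J. A (x, \<sigma> x)) * graph_weight w (insert i I) J \<sigma>))"
    unfolding sum.cartesian_product
  proof (intro sum.cong refl, clarify)
    fix i \<sigma>
    have "(\<Prod>x\<in>J. A (x, (\<sigma>(j := i)) x)) = (\<Prod>x\<in>J. A (x, \<sigma> x))"
      using assms by (intro prod.cong) auto
    then have split: "(\<Prod>x\<in>insert j J. A (x, (\<sigma>(j := i)) x)) = A (j, i) * (\<Prod>x\<in>J. A (x, \<sigma> x))"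
      using assms by simp
    show "(\<Prod>x\<in>insert j J. A (x, (\<sigma>(j := i)) x)) * graph_weight w I (insert j J) (\<sigma>(j := i)) =
        (if i \<in> I then 0 else A (j, i) * ((\<Prod>x\<in>J. A (x, \<sigma> x)) * graph_weight w (insert i I) J \<sigma>))"
      unfolding graph_weight_fun_upd[OF assms(3)] split by (simp add: mult.assoc)
  qed
  also have "\<dots> = (\<Sum>i\<in>E. if i \<in> I then 0 else
       A (j, i) * (\<Sum>\<sigma>\<in>J \<rightarrow>\<^sub>E E. (\<Prod>x\<in>J. A (x, \<sigma> x)) * graph_weight w (insert i I) J \<sigma>))"
    by (intro sum.cong refl) (auto simp: sum_distrib_left)
  finally show ?thesis .
qed

text \<open>
  After contracting with the forms for \<open>j \<in> G\<close>, a coordinate indexed by \<open>I\<close> and \<open>J\<close> is nonzero only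
  if every missing \<open>f\<^sub>j\<close> has been removed by its own form; the forms for \<open>j \<in> G \<inter> J\<close> then had to use
  one of their terms in \<open>E\<close>.
\<close>

lemma fold_ext_dot_graph_form:
  assumes fin: "finite E" "finite F" and "G \<subseteq> F" "I \<subseteq> E" "J \<subseteq> F"
  shows "Finite_Set.fold (\<lambda>j u. ext_dot (E <+> F) u (star (E <+> F) (graph_form E A j)))
       (Finite_Set.fold (\<lambda>j u. wedge u (ext_basis {Inr j})) (ext_Inl w) F) G (I <+> J) =
    (if F - J \<subseteq> G then \<Sum>\<sigma>\<in>G \<inter> J \<rightarrow>\<^sub>E E. (\<Prod>j\<in>G \<inter> J. A (j, \<sigma> j)) * graph_weight w I (G \<inter> J) \<sigma> else 0)"
    (is "?u G (I <+> J) = _")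
proof -
  have "finite G" using assms(3,2) by (rule finite_subset)
  then show ?thesis using assms(3-)
  proof (induction G arbitrary: I J)
    case empty
    have "finite (I <+> J)"
      using finite_subset[OF empty.prems(2) fin(1)] finite_subset[OF empty.prems(3) fin(2)] by simp
    moreover have "Inr -` (I <+> J) = J" "Inl -` (I <+> J) = I" by auto
    moreover have "J = F \<longleftrightarrow> F \<subseteq> J" using empty.prems by auto
    ultimately show ?case using fin by (auto simp: fold_wedge_basis graph_weight_def)
  next
    case (insert j G)
    interpret comp_fun_commute "\<lambda>j u. ext_dot (E <+> F) u (star (E <+> F) (graph_form E A j))"
      by (rule comp_fun_commute_ext_dot)
    have jF: "j \<in> F" "G \<subseteq> F" using insert.prems by auto
    have ins: "insert (Inl i) (I <+> J) = insert i I <+> J" "insert (Inr j) (I <+> J) = I <+> insert j J" for i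
      by auto
    have mem: "Inl i \<in> I <+> J \<longleftrightarrow> i \<in> I" "Inr j \<in> I <+> J \<longleftrightarrow> j \<in> J" for i by auto
    have sub: "I <+> J \<subseteq> E <+> F" using insert.prems by auto
    have "?u (insert j G) = ext_dot (E <+> F) (?u G) (star (E <+> F) (graph_form E A j))"
      using insert.hyps by (rule fold_insert)
    then have "?u (insert j G) (I <+> J) =
        (if j \<in> J then 0 else ?u G (I <+> insert j J)) +
        (\<Sum>i\<in>E. if i \<in> I then 0 else A (j, i) * ?u G (insert i I <+> J))"
      by (simp only: ext_dot_graph_form[OF fin jF(1) sub] ins mem)
    also have "\<dots> = (if F - J \<subseteq> insert j G
        then \<Sum>\<sigma>\<in>insert j G \<inter> J \<rightarrow>\<^sub>E E. (\<Prod>j\<in>insert j G \<inter> J. A (j, \<sigma> j)) * graph_weight w I (insert j G \<inter> J) \<sigma> else 0)"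
    proof (cases "j \<in> J")
      case False
      have "\<not> F - J \<subseteq> G" using False jF insert.hyps by auto
      then have "?u G (insert i I <+> J) = 0" if "i \<in> E" for i
        using insert.IH[of "insert i I" J] insert.prems that jF by auto
      then have "(\<Sum>i\<in>E. if i \<in> I then 0 else A (j, i) * ?u G (insert i I <+> J)) = 0"
        by (intro sum.neutral) auto
      moreover have "F - insert j J \<subseteq> G \<longleftrightarrow> F - J \<subseteq> insert j G" "G \<inter> insert j J = insert j G \<inter> J"
        using insert.hyps False by auto
      ultimately show ?thesis
        using insert.IH[of I "insert j J"] insert.prems False jF by simp
    next
      case True
      have iff: "F - J \<subseteq> insert j G \<longleftrightarrow> F - J \<subseteq> G" using True by auto
      have eq: "insert j G \<inter> J = insert j (G \<inter> J)" using True by auto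
      have u: "?u G (insert i I <+> J) = (if F - J \<subseteq> G
          then \<Sum>\<sigma>\<in>G \<inter> J \<rightarrow>\<^sub>E E. (\<Prod>j\<in>G \<inter> J. A (j, \<sigma> j)) * graph_weight w (insert i I) (G \<inter> J) \<sigma> else 0)"
        if "i \<in> E" for i
        using insert.IH[of "insert i I" J] insert.prems that jF by auto
      have "(\<Sum>i\<in>E. if i \<in> I then 0 else A (j, i) * ?u G (insert i I <+> J)) =
          (if F - J \<subseteq> G then \<Sum>i\<in>E. if i \<in> I then 0 else A (j, i) *
             (\<Sum>\<sigma>\<in>G \<inter> J \<rightarrow>\<^sub>E E. (\<Prod>j\<in>G \<inter> J. A (j, \<sigma> j)) * graph_weight w (insert i I) (G \<inter> J) \<sigma>) else 0)"
        by (simp only: u cong: sum.cong) (cases "F - J \<subseteq> G"; simp cong: if_cong)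
      also have "\<dots> = (if F - J \<subseteq> G then \<Sum>\<sigma>\<in>insert j (G \<inter> J) \<rightarrow>\<^sub>E E.
          (\<Prod>j\<in>insert j (G \<inter> J). A (j, \<sigma> j)) * graph_weight w I (insert j (G \<inter> J)) \<sigma> else 0)"
        using sum_graph_weight_insert[of E "G \<inter> J" j A w I] fin insert.hyps by simp
      finally show ?thesis using True by (simp add: iff eq)
    qed
    finally show ?case .
  qed
qed

text \<open>The tropical form of the expansion \<open>vec_det_graph_cols\<close> of the minors of a graph.\<close>

lemma trop_graph_eq_sum:
  assumes "finite E" "finite F" "I \<subseteq> E" "J \<subseteq> F"
  shows "trop_graph E F A w (I <+> J) = (\<Sum>\<sigma>\<in>J \<rightarrow>\<^sub>E E. (\<Prod>j\<in>J. A (j, \<sigma> j)) * graph_weight w I J \<sigma>)"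
  using fold_ext_dot_graph_form[OF assms(1,2) subset_refl assms(3,4), of A w] assms(4)
  by (simp add: trop_graph_def Int_absorb1)

lemma trop_graph_scale:
  assumes "finite E" "finite F" "Z \<subseteq> E <+> F"
  shows "trop_graph E F A (\<lambda>I. c * w I) Z = c * trop_graph E F A w Z"
proof -
  have Z: "Z = Inl -` Z <+> Inr -` Z" using assms(3) by auto
  have sub: "Inl -` Z \<subseteq> E" "Inr -` Z \<subseteq> F" using assms(3) by auto
  show ?thesis
    by (subst (1 2) Z) (simp add: trop_graph_eq_sum[OF assms(1,2) sub] sum_distrib_left graph_weight_def
        if_distrib mult.left_commute cong: if_cong)
qed


section \<open>Determinants of families of vectors\<close>

definition vec_det :: "nat \<Rightarrow> (nat \<Rightarrow> nat \<Rightarrow> 'k::comm_ring_1) \<Rightarrow> 'k" where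
  "vec_det d C = det (mat d d (\<lambda>(s, r). C s r))"

lemma vec_det_cong: "(\<And>s r. s < d \<Longrightarrow> r < d \<Longrightarrow> C s r = C' s r) \<Longrightarrow> vec_det d C = vec_det d C'"
  unfolding vec_det_def by (intro arg_cong[where f = det] eq_matI) auto

lemma vec_det_expand:
  "vec_det d C = (\<Sum>p | p permutes {..<d}. of_int (sign p) * (\<Prod>s<d. C s (p s)))"
proof -
  have "vec_det d C = (\<Sum>p | p permutes {0..<d}. of_int (sign p) *
      (\<Prod>s = 0..<d. mat d d (\<lambda>(s, r). C s r) $$ (s, p s)))"
    unfolding vec_det_def by (rule det_def') simp
  also have "\<dots> = (\<Sum>p | p permutes {0..<d}. of_int (sign p) * (\<Prod>s = 0..<d. C s (p s)))"
  proof (intro sum.cong refl arg_cong2[where f = "(*)"] prod.cong)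
    fix p s assume p: "p \<in> {p. p permutes {0..<d}}" and s: "s \<in> {0..<d}"
    have "p s \<in> {0..<d}" using permutes_in_image[of p "{0..<d}" s] p s by blast
    then show "mat d d (\<lambda>(s, r). C s r) $$ (s, p s) = C s (p s)" using s by simp
  qed
  finally show ?thesis by (simp add: atLeast0LessThan)
qed

lemma vec_det_permute:
  assumes p: "p permutes {..<d}"
  shows "vec_det d (\<lambda>s. C (p s)) = of_int (sign p) * vec_det d C"
proof -
  have p': "p permutes {0..<d}" using p by (simp add: atLeast0LessThan)
  have "det (mat d d (\<lambda>(i, j). mat d d (\<lambda>(s, r). C s r) $$ (p i, j))) = of_int (sign p) * vec_det d C"
    unfolding vec_det_def by (rule det_permute_rows[OF _ p']) simp
  moreover have "mat d d (\<lambda>(i, j). mat d d (\<lambda>(s, r). C s r) $$ (p i, j)) = mat d d (\<lambda>(s, r). C (p s) r)"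
  proof (rule eq_matI)
    fix i j assume ij: "i < dim_row (mat d d (\<lambda>(s, r). C (p s) r))" "j < dim_col (mat d d (\<lambda>(s, r). C (p s) r))"
    then have "p i \<in> {0..<d}" using permutes_in_image[OF p', of i] by simp
    then show "mat d d (\<lambda>(i, j). mat d d (\<lambda>(s, r). C s r) $$ (p i, j)) $$ (i, j) = mat d d (\<lambda>(s, r). C (p s) r) $$ (i, j)"
      using ij by simp
  qed auto
  ultimately show ?thesis by (simp add: vec_det_def)
qed

lemma vec_det_eq_vectors:
  assumes "s < d" "t < d" "s \<noteq> t" "C s = C t"
  shows "vec_det d C = 0"
  unfolding vec_det_def
  by (rule det_identical_rows[of _ d s t]) (use assms in \<open>auto intro!: eq_vecI\<close>)

lemma vec_det_sum:
  assumes "\<And>s. s < d \<Longrightarrow> finite (Q s)" and "\<And>s r. s < d \<Longrightarrow> r < d \<Longrightarrow> C s r = (\<Sum>i\<in>Q s. c s i * B i r)"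
  shows "vec_det d C = (\<Sum>g\<in>PiE {..<d} Q. (\<Prod>s<d. c s (g s)) * vec_det d (\<lambda>s. B (g s)))"
proof -
  have "vec_det d C = (\<Sum>p | p permutes {..<d}. of_int (sign p) * (\<Prod>s<d. \<Sum>i\<in>Q s. c s i * B i (p s)))"
    unfolding vec_det_expand
  proof (intro sum.cong refl arg_cong2[where f = "(*)"] prod.cong)
    fix p s assume p: "p \<in> {p. p permutes {..<d}}" and s: "s \<in> {..<d}"
    have "p s \<in> {..<d}" using permutes_in_image[of p "{..<d}" s] p s by blast
    then show "C s (p s) = (\<Sum>i\<in>Q s. c s i * B i (p s))" using assms(2) s by simp
  qed
  also have "\<dots> = (\<Sum>p | p permutes {..<d}. \<Sum>g\<in>PiE {..<d} Q. of_int (sign p) * (\<Prod>s<d. c s (g s) * B (g s) (p s)))"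
    using assms(1) by (subst prod_sum_PiE) (auto simp: sum_distrib_left)
  also have "\<dots> = (\<Sum>g\<in>PiE {..<d} Q. \<Sum>p | p permutes {..<d}. of_int (sign p) * (\<Prod>s<d. c s (g s) * B (g s) (p s)))"
    by (rule sum.swap)
  also have "\<dots> = (\<Sum>g\<in>PiE {..<d} Q. (\<Prod>s<d. c s (g s)) * vec_det d (\<lambda>s. B (g s)))"
    unfolding vec_det_expand sum_distrib_left by (simp add: prod.distrib ac_simps)
  finally show ?thesis .
qed

lemma vec_det_linear:
  assumes s: "s < d" and v: "\<And>r. r < d \<Longrightarrow> v r = (\<Sum>i\<in>Q. c i * u i r)"
  shows "vec_det d (C(s := v)) = (\<Sum>i\<in>Q. c i * vec_det d (C(s := u i)))"
proof -
  have upd: "(\<Prod>t<d. (C(s := x)) t (p t)) = x (p s) * (\<Prod>t\<in>{..<d} - {s}. C t (p t))" for x and p :: "nat \<Rightarrow> nat"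
  proof -
    have "(\<Prod>t<d. (C(s := x)) t (p t)) = (C(s := x)) s (p s) * (\<Prod>t\<in>{..<d} - {s}. (C(s := x)) t (p t))"
      using s by (intro prod.remove) auto
    also have "(\<Prod>t\<in>{..<d} - {s}. (C(s := x)) t (p t)) = (\<Prod>t\<in>{..<d} - {s}. C t (p t))"
      by (intro prod.cong) auto
    finally show ?thesis by simp
  qed
  have "vec_det d (C(s := v)) = (\<Sum>p | p permutes {..<d}. \<Sum>i\<in>Q. c i * (of_int (sign p) * (u i (p s) * (\<Prod>t\<in>{..<d} - {s}. C t (p t)))))"
    unfolding vec_det_expand upd
  proof (intro sum.cong refl)
    fix p assume p: "p \<in> {p. p permutes {..<d}}"
    have "p s \<in> {..<d}" using permutes_in_image[of p "{..<d}" s] p s by blast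
    then show "of_int (sign p) * (v (p s) * (\<Prod>t\<in>{..<d} - {s}. C t (p t))) =
        (\<Sum>i\<in>Q. c i * (of_int (sign p) * (u i (p s) * (\<Prod>t\<in>{..<d} - {s}. C t (p t)))))"
      by (simp add: v sum_distrib_left sum_distrib_right ac_simps)
  qed
  also have "\<dots> = (\<Sum>i\<in>Q. c i * vec_det d (C(s := u i)))"
    unfolding vec_det_expand upd by (subst sum.swap) (simp add: sum_distrib_left)
  finally show ?thesis .
qed

lemma vec_det_cramer:
  fixes C :: "nat \<Rightarrow> nat \<Rightarrow> 'k::field"
  assumes nz: "vec_det d C \<noteq> 0"
  shows "\<exists>x. (\<forall>r<d. v r = (\<Sum>s<d. x s * C s r)) \<and> (\<forall>s<d. vec_det d (C(s := v)) = x s * vec_det d C)"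
proof -
  let ?A = "\<lambda>C. mat d d (\<lambda>(r, s). C s r) :: 'k mat"
  have detA: "det (?A C) = vec_det d C" for C
  proof -
    have "det (?A C) = det (transpose_mat (?A C))" by (rule det_transpose[symmetric, of _ d]) simp
    also have "transpose_mat (?A C) = mat d d (\<lambda>(s, r). C s r)" by (rule eq_matI) auto
    finally show ?thesis by (simp add: vec_det_def)
  qed
  have carr: "?A C \<in> carrier_mat d d" by simp
  obtain A' where A': "A' \<in> carrier_mat d d" "?A C * A' = 1\<^sub>m d"
    using det_non_zero_imp_unit[OF carr, of "()"] nz unfolding detA Units_def ring_mat_def by auto
  define x where "x = A' *\<^sub>v vec d v"
  have x: "x \<in> carrier_vec d" using A' by (auto simp: x_def)
  have "?A C *\<^sub>v x = (?A C * A') *\<^sub>v vec d v"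
    unfolding x_def by (rule assoc_mult_mat_vec[symmetric, OF carr A'(1)]) simp
  then have Ax: "?A C *\<^sub>v x = vec d v" by (simp add: A'(2))
  have "v r = (\<Sum>s<d. x $ s * C s r)" if "r < d" for r
  proof -
    have "v r = (?A C *\<^sub>v x) $ r" using that by (simp add: Ax)
    also have "\<dots> = (\<Sum>s<d. x $ s * C s r)"
      using that x by (simp add: scalar_prod_def atLeast0LessThan mult.commute)
    finally show ?thesis .
  qed
  moreover have "vec_det d (C(s := v)) = x $ s * vec_det d C" if "s < d" for s
  proof -
    have "?A (C(s := v)) = replace_col (?A C) (?A C *\<^sub>v x) s"
      unfolding Ax replace_col_def by (rule eq_matI) auto
    then show ?thesis using cramer_lemma_mat[OF carr x that] by (simp flip: detA)
  qed
  ultimately show ?thesis by (intro exI[of _ "\<lambda>s. x $ s"]) auto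
qed


section \<open>Tropicalization of a linear space\<close>

text \<open>
  A \<open>d\<close>-dimensional subspace of \<open>K\<^sup>X\<close> is presented by the columns \<open>B x\<close>, \<open>x \<in> X\<close>, of a matrix whose
  rows span it. The valuation of a maximal minor does not depend on the order of its columns, so
  signs never enter the tropical Pluecker vector.
\<close>

definition row_space :: "'x set \<Rightarrow> nat \<Rightarrow> ('x \<Rightarrow> nat \<Rightarrow> 'k::field) \<Rightarrow> ('x \<Rightarrow> 'k) set" where
  "row_space X d B = {x \<in> coord_space X. \<exists>c. \<forall>i\<in>X. x i = (\<Sum>r<d. c r * B i r)}"

definition minor_val ::
  "'x set \<Rightarrow> nat \<Rightarrow> ('x \<Rightarrow> nat \<Rightarrow> ('s::idem_semifield, 'k::field) hahn) \<Rightarrow> 'x set \<Rightarrow> 's" where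
  "minor_val X d B I = (if I \<subseteq> X \<and> (\<exists>f. bij_betw f {..<d} I)
     then hval (vec_det d (\<lambda>s. B ((SOME f. bij_betw f {..<d} I) s))) else 0)"

lemma vec_det_reorder:
  fixes B :: "'x \<Rightarrow> nat \<Rightarrow> ('s::idem_semifield, 'k::field) hahn"
  assumes f: "bij_betw f {..<d} I" and e: "bij_betw e {..<d} I"
  shows "hval (vec_det d (\<lambda>s. B (f s))) = hval (vec_det d (\<lambda>s. B (e s)))"
proof -
  define p where "p s = (if s < d then inv_into {..<d} e (f s) else s)" for s
  have "bij_betw (inv_into {..<d} e \<circ> f) {..<d} {..<d}"
    using f bij_betw_inv_into[OF e] by (rule bij_betw_trans)
  then have "bij_betw p {..<d} {..<d}"
    by (rule bij_betw_cong[THEN iffD1, rotated]) (simp add: p_def)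
  then have p: "p permutes {..<d}" by (rule bij_imp_permutes) (simp add: p_def)
  have "e (p s) = f s" if "s < d" for s
  proof -
    have "f s \<in> I" using f that by (auto simp: bij_betw_def)
    then show ?thesis using bij_betw_inv_into_right[OF e, of "f s"] that by (simp add: p_def)
  qed
  then have "vec_det d (\<lambda>s. B (f s)) = vec_det d (\<lambda>s. B (e (p s)))" by (intro vec_det_cong) simp
  also have "\<dots> = of_int (sign p) * vec_det d (\<lambda>s. B (e s))" by (rule vec_det_permute[OF p])
  finally show ?thesis by (auto simp: sign_def)
qed

lemma minor_val_eq:
  assumes "bij_betw f {..<d} I" "I \<subseteq> X"
  shows "minor_val X d B I = hval (vec_det d (\<lambda>s. B (f s)))"
proof -
  have "bij_betw (SOME f. bij_betw f {..<d} I) {..<d} I" using assms(1) by (rule someI[where P = "\<lambda>f. bij_betw f {..<d} I"])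
  then show ?thesis using assms vec_det_reorder by (auto simp: minor_val_def)
qed

lemma minor_val_nonzero:
  assumes "minor_val X d B I \<noteq> 0"
  obtains f where "bij_betw f {..<d} I" "I \<subseteq> X" "card I = d" "finite I" "vec_det d (\<lambda>s. B (f s)) \<noteq> 0"
proof -
  obtain f where f: "bij_betw f {..<d} I" "I \<subseteq> X"
    using assms by (auto simp: minor_val_def split: if_splits)
  then have "vec_det d (\<lambda>s. B (f s)) \<noteq> 0" using assms by (simp add: minor_val_eq[OF f])
  moreover have "card I = d" "finite I" using f(1) bij_betw_same_card[OF f(1)] bij_betw_finite[OF f(1)] by auto
  ultimately show ?thesis using f by (intro that)
qed

lemma minor_val_card: "card I \<noteq> d \<Longrightarrow> minor_val X d B I = 0"
  using minor_val_nonzero by metis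

lemma vec_det_not_inj:
  assumes "\<not> inj_on f {..<d}"
  shows "vec_det d (\<lambda>s. B (f s)) = 0"
proof -
  obtain s t where "s < d" "t < d" "s \<noteq> t" "f s = f t" using assms by (auto simp: inj_on_def)
  then show ?thesis by (intro vec_det_eq_vectors[of s d t]) auto
qed

lemma bij_betw_replace:
  assumes f: "bij_betw f {..<d} I" and s: "s < d" and k: "k \<notin> I"
  shows "bij_betw (f(s := k)) {..<d} (insert k (I - {f s}))"
proof -
  have inj: "inj_on f {..<d}" "f ` {..<d} = I" using f by (auto simp: bij_betw_def)
  have "(f(s := k)) ` {..<d} = insert k (f ` ({..<d} - {s}))" using s by (auto simp: image_iff)
  also have "f ` ({..<d} - {s}) = I - {f s}" using inj s by (subst inj_on_image_set_diff[OF inj(1)]) auto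
  finally have "(f(s := k)) ` {..<d} = insert k (I - {f s})" .
  moreover have "inj_on (f(s := k)) {..<d}"
    using inj k by (auto simp: inj_on_def)
  ultimately show ?thesis by (simp add: bij_betw_def)
qed

text \<open>
  Replacing one column by a variable one gives the minor as a function of the new column; its value
  at the columns of \<open>B\<close> is a vector of the row space.
\<close>

definition cocircuit_vec :: "'x set \<Rightarrow> nat \<Rightarrow> ('x \<Rightarrow> nat \<Rightarrow> 'k::field) \<Rightarrow> (nat \<Rightarrow> 'x) \<Rightarrow> nat \<Rightarrow> 'x \<Rightarrow> 'k" where
  "cocircuit_vec X d B f s = (\<lambda>k. if k \<in> X then vec_det d (\<lambda>t. B ((f(s := k)) t)) else 0)"

lemma cocircuit_vec_in_row_space:
  assumes "s < d"
  shows "cocircuit_vec X d B f s \<in> row_space X d B"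
proof -
  let ?unit = "\<lambda>i r. if r = i then 1 else 0 :: 'b"
  have "vec_det d (\<lambda>t. B ((f(s := k)) t)) = (\<Sum>r<d. vec_det d ((\<lambda>t. B (f t))(s := ?unit r)) * B k r)" for k
  proof -
    have "vec_det d ((\<lambda>t. B (f t))(s := B k)) = (\<Sum>i<d. B k i * vec_det d ((\<lambda>t. B (f t))(s := ?unit i)))"
      using assms by (intro vec_det_linear) (simp_all add: if_distrib sum.delta cong: if_cong)
    moreover have "(\<lambda>t. B ((f(s := k)) t)) = (\<lambda>t. B (f t))(s := B k)" by auto
    ultimately show ?thesis by (simp add: mult.commute)
  qed
  then show ?thesis unfolding row_space_def cocircuit_vec_def coord_space_def by auto
qed

text \<open>
  For \<open>k\<close> in \<open>I - {f s}\<close> both sides vanish: a column occurs twice, and the set has only \<open>d - 1\<close> elements.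
\<close>

lemma hval_cocircuit_vec:
  assumes f: "bij_betw f {..<d} I" and I: "I \<subseteq> X" and s: "s < d"
  shows "hval (cocircuit_vec X d B f s k) = minor_val X d B (insert k (I - {f s}))"
proof (cases "k \<in> X")
  case True
  show ?thesis
  proof (cases "k \<in> I - {f s}")
    case True
    then obtain t where t: "t < d" "f t = k" "t \<noteq> s" using f by (auto simp: bij_betw_def)
    then have "\<not> inj_on (f(s := k)) {..<d}" using s by (auto simp: inj_on_def)
    then have "vec_det d (\<lambda>t. B ((f(s := k)) t)) = 0" by (rule vec_det_not_inj)
    moreover have "finite I" "card I = d" "f s \<in> I"
      using bij_betw_finite[OF f] bij_betw_same_card[OF f] f s by (auto simp: bij_betw_def)
    then have "card (insert k (I - {f s})) \<noteq> d"
      using True s card_Suc_Diff1[of I "f s"] by (simp add: insert_absorb)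
    ultimately show ?thesis using \<open>k \<in> X\<close> by (simp add: cocircuit_vec_def minor_val_card)
  next
    case False
    have "bij_betw (f(s := k)) {..<d} (insert k (I - {f s}))"
    proof (cases "k = f s")
      case True
      then have "f(s := k) = f" "insert k (I - {f s}) = I" using f s by (auto simp: bij_betw_def)
      then show ?thesis using f by simp
    next
      case False
      then show ?thesis using \<open>k \<notin> I - {f s}\<close> by (intro bij_betw_replace f s) auto
    qed
    moreover have "insert k (I - {f s}) \<subseteq> X" using I True by auto
    ultimately show ?thesis using True by (simp add: minor_val_eq cocircuit_vec_def)
  qed
next
  case False
  then show ?thesis by (simp add: cocircuit_vec_def minor_val_def)
qed

lemma row_space_cramer:
  assumes x: "x \<in> row_space X d B" and f: "\<And>s. s < d \<Longrightarrow> f s \<in> X" and nz: "vec_det d (\<lambda>s. B (f s)) \<noteq> 0"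
    and k: "k \<in> X"
  shows "x k * vec_det d (\<lambda>s. B (f s)) = (\<Sum>s<d. x (f s) * cocircuit_vec X d B f s k)"
proof -
  let ?D = "vec_det d (\<lambda>s. B (f s))"
  obtain c where c: "\<And>i. i \<in> X \<Longrightarrow> x i = (\<Sum>r<d. c r * B i r)" using x by (auto simp: row_space_def)
  obtain y where y: "\<And>r. r < d \<Longrightarrow> B k r = (\<Sum>s<d. y s * B (f s) r)"
    "\<And>s. s < d \<Longrightarrow> vec_det d ((\<lambda>t. B (f t))(s := B k)) = y s * ?D"
    using vec_det_cramer[OF nz, of "B k"] by auto
  have "x k = (\<Sum>r<d. \<Sum>s<d. c r * (y s * B (f s) r))"
    using c[OF k] y(1) by (simp add: sum_distrib_left)
  also have "\<dots> = (\<Sum>s<d. y s * (\<Sum>r<d. c r * B (f s) r))"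
    by (subst sum.swap) (simp add: sum_distrib_left ac_simps)
  also have "\<dots> = (\<Sum>s<d. y s * x (f s))" using c f by simp
  finally have "x k * ?D = (\<Sum>s<d. x (f s) * (y s * ?D))"
    by (simp add: sum_distrib_left sum_distrib_right ac_simps)
  also have "\<dots> = (\<Sum>s<d. x (f s) * cocircuit_vec X d B f s k)"
  proof (intro sum.cong refl)
    fix s assume "s \<in> {..<d}"
    moreover have "(\<lambda>t. B ((f(s := k)) t)) = (\<lambda>t. B (f t))(s := B k)" by auto
    ultimately show "x (f s) * (y s * ?D) = x (f s) * cocircuit_vec X d B f s k"
      using y(2)[of s] k by (simp add: cocircuit_vec_def)
  qed
  finally show ?thesis .
qed

text \<open>
  Cramer's rule for \<open>x\<close> in the row space is a vanishing sum with terms \<open>x i\<close> times the minor of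
  \<open>J - {i}\<close>.
\<close>

lemma trop_row_space_subset:
  fixes B :: "'x \<Rightarrow> nat \<Rightarrow> ('s::idem_semifield, 'k::field) hahn"
  assumes x: "x \<in> row_space X d B"
  shows "(\<lambda>i. hval (x i)) \<in> plucker_space X d (minor_val X d B)"
proof (rule plucker_spaceI)
  show "(\<lambda>i. hval (x i)) \<in> coord_space X" using x by (auto simp: row_space_def coord_space_def)
  fix J j assume J: "J \<subseteq> X" "card J = d + 1" "j \<in> J"
  let ?w = "minor_val X d B"
  have fin: "finite J" using J(2) by (metis Suc_eq_plus1 card.infinite nat.distinct(1))
  show "?w (J - {j}) * hval (x j) \<le> (\<Sum>i\<in>J - {j}. ?w (J - {i}) * hval (x i))"
  proof (cases "?w (J - {j}) = 0")
    case False
    then obtain f where f: "bij_betw f {..<d} (J - {j})" and nz: "vec_det d (\<lambda>s. B (f s)) \<noteq> 0"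
      by (rule minor_val_nonzero)
    let ?I = "J - {j}" and ?D = "vec_det d (\<lambda>s. B (f s))"
    have I: "?I \<subseteq> X" using J by auto
    have fX: "f s \<in> X" if "s < d" for s using f that J by (auto simp: bij_betw_def)
    have "hval (x j) * hval ?D = hval (\<Sum>s<d. x (f s) * cocircuit_vec X d B f s j)"
      using row_space_cramer[OF x fX nz, of j] J by (auto simp flip: hval_mult)
    also have "\<dots> \<le> (\<Sum>s<d. hval (x (f s)) * hval (cocircuit_vec X d B f s j))"
      by (intro hval_sum_le) (auto simp: hval_mult intro!: idem_le_sum[of "{..<d}" _ "\<lambda>s. hval (x (f s)) * hval (cocircuit_vec X d B f s j)"])
    also have "\<dots> = (\<Sum>s<d. hval (x (f s)) * ?w (insert j (?I - {f s})))"
      by (intro sum.cong refl) (simp add: hval_cocircuit_vec[OF f I])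
    also have "\<dots> = (\<Sum>s<d. hval (x (f s)) * ?w (J - {f s}))"
    proof (intro sum.cong refl)
      fix s assume "s \<in> {..<d}"
      then have "f s \<in> ?I" using f by (auto simp: bij_betw_def)
      then have "insert j (?I - {f s}) = J - {f s}" using J by auto
      then show "hval (x (f s)) * ?w (insert j (?I - {f s})) = hval (x (f s)) * ?w (J - {f s})" by simp
    qed
    also have "\<dots> = (\<Sum>i\<in>?I. hval (x i) * ?w (J - {i}))" by (rule sum.reindex_bij_betw[OF f])
    finally show ?thesis using minor_val_eq[OF f I, of B] by (simp add: mult.commute)
  qed simp
qed

text \<open>
  Each tropical Pluecker relation is a condition satisfied by the valuation of a vector in the row
  space, namely the one obtained from a basis containing \<open>K\<close> by varying its remaining element.
\<close>

lemma trop_plucker_minor_val: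
  fixes B :: "'x \<Rightarrow> nat \<Rightarrow> ('s::idem_semifield, 'k::field) hahn"
  assumes "\<exists>I. minor_val X d B I \<noteq> 0"
  shows "trop_plucker X d (minor_val X d B)"
  unfolding trop_plucker_def
proof (intro conjI allI impI ballI)
  let ?w = "minor_val X d B"
  show "\<exists>I. ?w I \<noteq> 0" by (rule assms)
  show "I \<subseteq> X" "card I = d" if "?w I \<noteq> 0" for I using minor_val_nonzero[OF that] by auto
  fix J K j assume JK: "J \<subseteq> X \<and> card J = d + 1 \<and> K \<subseteq> X \<and> card K + 1 = d" and j: "j \<in> J - K"
  have fin: "finite J" using JK by (metis Suc_eq_plus1 card.infinite nat.distinct(1))
  let ?t = "\<lambda>i. ?w (J - {i}) * ?w (insert i K)"
  have "(\<lambda>k. ?w (insert k K)) \<in> plucker_space X d ?w"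
  proof (cases "\<exists>i. ?w (insert i K) \<noteq> 0")
    case True
    then obtain i where i: "?w (insert i K) \<noteq> 0" by auto
    have "i \<notin> K"
    proof
      assume "i \<in> K"
      then show False using i JK minor_val_card[of K d X B] by (simp add: insert_absorb)
    qed
    from i obtain f where f: "bij_betw f {..<d} (insert i K)" and sub: "insert i K \<subseteq> X" by (rule minor_val_nonzero)
    then have "i \<in> f ` {..<d}" by (simp add: bij_betw_def)
    then obtain s where s: "s < d" "f s = i" by auto
    have "insert i K - {f s} = K" using s \<open>i \<notin> K\<close> by auto
    then have "(\<lambda>k. hval (cocircuit_vec X d B f s k)) = (\<lambda>k. ?w (insert k K))"
      using hval_cocircuit_vec[OF f sub s(1), of B] by auto
    then show ?thesis using trop_row_space_subset[OF cocircuit_vec_in_row_space[OF s(1), of X B f]] by simp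
  next
    case False
    then show ?thesis by (intro plucker_spaceI) (auto simp: coord_space_def)
  qed
  from plucker_space_le[OF this, of J j] have "?t j \<le> sum ?t (J - {j})" using JK j by auto
  also have "\<dots> = sum ?t (J - K - {j})"
    using fin JK minor_val_card[of K d X B] by (intro sum.mono_neutral_right) (auto simp: insert_absorb)
  finally show "sum ?t (J - K) = sum ?t (J - K - {j})"
    using sum_eq_sum_remove_iff[of "J - K" j ?t] fin j by auto
qed


lemma row_space_combination:
  assumes "\<And>s. s \<in> T \<Longrightarrow> u s \<in> row_space X d B"
  shows "(\<lambda>k. \<Sum>s\<in>T. a s * u s k) \<in> row_space X d B"
proof -
  have "\<forall>s\<in>T. \<exists>c. \<forall>i\<in>X. u s i = (\<Sum>r<d. c r * B i r)" using assms by (simp add: row_space_def)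
  then obtain c where c: "\<And>s i. s \<in> T \<Longrightarrow> i \<in> X \<Longrightarrow> u s i = (\<Sum>r<d. c s r * B i r)"
    by (auto dest!: bchoice)
  have "(\<Sum>s\<in>T. a s * u s i) = (\<Sum>r<d. (\<Sum>s\<in>T. a s * c s r) * B i r)" if "i \<in> X" for i
  proof -
    have "(\<Sum>s\<in>T. a s * u s i) = (\<Sum>s\<in>T. \<Sum>r<d. a s * c s r * B i r)"
      using that by (simp add: c sum_distrib_left mult.assoc)
    also have "\<dots> = (\<Sum>r<d. \<Sum>s\<in>T. a s * c s r * B i r)" by (rule sum.swap)
    finally show ?thesis by (simp add: sum_distrib_right)
  qed
  moreover have "(\<lambda>k. \<Sum>s\<in>T. a s * u s k) \<in> coord_space X"
    using assms by (auto simp: row_space_def coord_space_def)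
  ultimately show ?thesis
    unfolding row_space_def by (intro CollectI conjI exI[of _ "\<lambda>r. \<Sum>s\<in>T. a s * c s r"]) auto
qed

text \<open>
  To lift \<open>v\<close>, choose a basis \<open>I\<close> that contains as many zeros of \<open>v\<close> as possible and among these
  maximizes the minor divided by the product of the nonzero entries of \<open>v\<close> on \<open>I\<close>; that is, after
  rescaling all nonzero entries of \<open>v\<close> to \<open>1\<close>, a maximal minor. Take the fundamental cocircuits of \<open>I\<close> at
  those elements where \<open>v\<close> is nonzero, scaled to agree with \<open>v\<close> there. By the choice of \<open>I\<close> they have no
  entry larger than \<open>v\<close>, and for every \<open>k\<close> outside \<open>I\<close> with \<open>v k \<noteq> 0\<close> the condition on \<open>v\<close> at \<open>I \<union> {k}\<close>
  gives one whose entry at \<open>k\<close> matches \<open>v\<close>. A generic combination has valuation \<open>v\<close>: for each such \<open>k\<close>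
  it avoids one cancellation of leading coefficients. There are at most \<open>|X| - d\<close> such \<open>k\<close>, and none
  if \<open>d = 0\<close>.
\<close>

lemma plucker_space_lifts:
  fixes B :: "'x \<Rightarrow> nat \<Rightarrow> ('s::idem_semifield, 'k::field) hahn"
  assumes fin: "finite X" and ne: "\<exists>I. minor_val X d B I \<noteq> 0"
    and large: "d = 0 \<or> infinite (UNIV :: 'k set) \<or> card X - d + 1 < card (UNIV :: 'k set)"
    and v: "v \<in> plucker_space X d (minor_val X d B)"
  shows "\<exists>x\<in>row_space X d B. \<forall>k. hval (x k) = v k"
proof -
  let ?w = "minor_val X d B"
  define Z where "Z = {i\<in>X. v i = 0}"
  define Y where "Y = {i\<in>X. v i \<noteq> 0}"
  have wX: "I \<subseteq> X" if "?w I \<noteq> 0" for I using that by (rule minor_val_nonzero)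
  have finI: "finite I" if "?w I \<noteq> 0" for I using that by (rule minor_val_nonzero)
  obtain I1 where I1: "?w I1 \<noteq> 0" using ne by auto
  have "\<forall>I. ?w I \<noteq> 0 \<longrightarrow> card (I \<inter> Z) < card X + 1"
    using fin by (auto intro!: card_mono simp: less_Suc_eq_le Z_def)
  with I1 obtain I0 where I0: "?w I0 \<noteq> 0" and max0: "\<And>I. ?w I \<noteq> 0 \<Longrightarrow> card (I \<inter> Z) \<le> card (I0 \<inter> Z)"
    using ex_has_greatest_nat[of "\<lambda>I. ?w I \<noteq> 0" I1 "\<lambda>I. card (I \<inter> Z)" "card X + 1"] by blast
  define Q where "Q = {I. ?w I \<noteq> 0 \<and> card (I \<inter> Z) = card (I0 \<inter> Z)}"
  define h where "h I = ?w I * (\<Prod>i\<in>I \<inter> Y. inverse (v i))" for I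
  have "Q \<subseteq> Pow X" using wX by (auto simp: Q_def)
  then have finQ: "finite Q" using fin by (rule finite_subset[OF _ finite_Pow_iff[THEN iffD2]])
  have "Max (h ` Q) \<in> h ` Q" using finQ I0 by (intro Max_in) (auto simp: Q_def)
  then obtain I where I: "I \<in> Q" and hI: "h I = Max (h ` Q)" by auto
  have hmax: "h I' \<le> h I" if "I' \<in> Q" for I' unfolding hI using finQ that by (intro Max_ge) auto
  have wI: "?w I \<noteq> 0" and cI: "card (I \<inter> Z) = card (I0 \<inter> Z)" using I by (auto simp: Q_def)
  from wI obtain f where f: "bij_betw f {..<d} I" and IX: "I \<subseteq> X" and cardI: "card I = d" and fI: "finite I"
    and D: "vec_det d (\<lambda>s. B (f s)) \<noteq> 0" by (rule minor_val_nonzero)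
  let ?D = "vec_det d (\<lambda>s. B (f s))" and ?b = "cocircuit_vec X d B f"
  have valD: "hval ?D = ?w I" using minor_val_eq[OF f IX, of B] by simp
  have fs: "f s \<in> I" if "s < d" for s using f that by (auto simp: bij_betw_def)
  have valb: "hval (?b s k) = ?w (insert k (I - {f s}))" if "s < d" for s k
    by (rule hval_cocircuit_vec[OF f IX that])

  have zero: "?w (insert k (I - {f s})) = 0" if s: "s < d" "f s \<in> Y" and k: "k \<in> Z - I" for s k
  proof (rule ccontr)
    assume nz: "?w (insert k (I - {f s})) \<noteq> 0"
    have "insert k (I - {f s}) \<inter> Z = insert k (I \<inter> Z)" using s k by (auto simp: Y_def Z_def)
    then have "card (insert k (I - {f s}) \<inter> Z) = card (I \<inter> Z) + 1" using k fI by simp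
    then show False using max0[OF nz] cI by simp
  qed

  have le: "?w (insert k (I - {f s})) * v (f s) \<le> ?w I * v k"
    if s: "s < d" "f s \<in> Y" and k: "k \<in> Y - I" for s k
  proof (cases "?w (insert k (I - {f s})) = 0")
    case False
    let ?I = "insert k (I - {f s})"
    let ?P = "\<Prod>i\<in>I \<inter> Y - {f s}. inverse (v i)"
    have "?I \<inter> Z = I \<inter> Z" using s k by (auto simp: Y_def Z_def)
    then have "?I \<in> Q" using False cI by (simp add: Q_def)
    have "?I \<inter> Y = insert k (I \<inter> Y - {f s})" using k by auto
    then have hI': "h ?I = ?w ?I * (inverse (v k) * ?P)" using k fI by (simp add: h_def)
    have "(\<Prod>i\<in>I \<inter> Y. inverse (v i)) = inverse (v (f s)) * ?P"
      using fI fs s by (intro prod.remove) auto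
    then have hI'': "h I = ?w I * (inverse (v (f s)) * ?P)" by (simp add: h_def)
    have nz: "v k \<noteq> 0" "v (f s) \<noteq> 0" using s k by (auto simp: Y_def)
    have P: "?P \<noteq> 0" using fI by (subst idem_prod_eq_0_iff) (auto simp: Y_def)
    have "(v k * v (f s)) * h ?I \<le> (v k * v (f s)) * h I"
      using hmax[OF \<open>?I \<in> Q\<close>] by (rule idem_mult_mono)
    moreover have "(v k * v (f s)) * h ?I = (v k * inverse (v k)) * (?P * (?w ?I * v (f s)))"
      unfolding hI' by (simp only: ac_simps)
    moreover have "(v k * v (f s)) * h I = (v (f s) * inverse (v (f s))) * (?P * (?w I * v k))"
      unfolding hI'' by (simp only: ac_simps)
    ultimately have "?P * (?w ?I * v (f s)) \<le> ?P * (?w I * v k)"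
      using nz by (simp add: idem_right_inverse)
    then show ?thesis using idem_mult_le[OF P] by simp
  qed simp

  define T where "T = {s. s < d \<and> f s \<in> Y}"
  have finT: "finite T" by (simp add: T_def)
  (* The leading coefficient at k contributed by the cocircuit at f s, if it reaches level v k. *)
  define \<beta> where "\<beta> k s = (if ?w (insert k (I - {f s})) * v (f s) = ?w I * v k
    then hlc (inverse ?D) * hlc (?b s k) else 0)" for k s
  have attained: "\<exists>s\<in>T. \<beta> k s \<noteq> 0" if k: "k \<in> Y - I" for k
  proof -
    let ?J = "insert k I"
    have kX: "k \<in> X" and kI: "k \<notin> I" and vk: "v k \<noteq> 0" using k by (auto simp: Y_def)
    have J: "?J \<subseteq> X" "card ?J = d + 1" using kX kI fI IX cardI by auto
    have "?w (?J - {k}) * v k \<le> (\<Sum>i\<in>?J - {k}. ?w (?J - {i}) * v i)"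
      by (rule plucker_space_le[OF v J]) simp
    moreover have "?J - {k} = I" using kI by auto
    ultimately have sumle: "?w I * v k \<le> (\<Sum>i\<in>I. ?w (?J - {i}) * v i)" by simp
    have nz: "?w I * v k \<noteq> 0" using wI vk by (simp add: idem_mult_eq_0_iff)
    then have "(\<Sum>i\<in>I. ?w (?J - {i}) * v i) \<noteq> 0" using sumle by auto
    then obtain i where i: "i \<in> I" "?w (?J - {i}) * v i = (\<Sum>i\<in>I. ?w (?J - {i}) * v i)"
      using idem_sum_attained by blast
    have "i \<in> f ` {..<d}" using i(1) f by (simp add: bij_betw_def)
    then obtain s where s: "s < d" "f s = i" by auto
    have "?J - {i} = insert k (I - {f s})" using s i kI by auto
    then have ge: "?w I * v k \<le> ?w (insert k (I - {f s})) * v (f s)" using sumle i s by simp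
    then have "?w (insert k (I - {f s})) * v (f s) \<noteq> 0" using nz by auto
    then have nz': "v (f s) \<noteq> 0" "?w (insert k (I - {f s})) \<noteq> 0" by (auto simp: idem_mult_eq_0_iff)
    have sY: "f s \<in> Y" using nz' s i IX by (auto simp: Y_def)
    have "?b s k \<noteq> 0" using nz'(2) valb[OF s(1), of k] by auto
    moreover have "?w (insert k (I - {f s})) * v (f s) = ?w I * v k"
      using ge le[OF s(1) sY k] by simp
    ultimately have "\<beta> k s \<noteq> 0" using D by (simp add: \<beta>_def)
    then show ?thesis using s sY by (auto simp: T_def)
  qed
  have YI: "finite (Y - I)" "card (Y - I) \<le> card X - d"
  proof -
    have sub: "Y - I \<subseteq> X - I" by (auto simp: Y_def)
    show "finite (Y - I)" using finite_subset[OF sub] fin by simp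
    have "card (Y - I) \<le> card (X - I)" using fin sub by (intro card_mono) auto
    then show "card (Y - I) \<le> card X - d" using IX fI cardI by (simp add: card_Diff_subset)
  qed
  have large': "infinite (UNIV :: 'k set) \<or> card (Y - I) + 1 < card (UNIV :: 'k set)"
  proof (cases "d = 0")
    case True
    then have "Y - I = {}" using attained by (auto simp: T_def)
    then have "card (Y - I) = 0" by (simp only: card.empty)
    then show ?thesis using one_less_card_field[where 'k = 'k] by linarith
  next
    case False
    then show ?thesis using large YI(2) by linarith
  qed
  have "\<exists>\<alpha>. (\<forall>s\<in>T. \<alpha> s \<noteq> 0) \<and> (\<forall>k\<in>Y - I. (\<Sum>s\<in>T. \<beta> k s * (\<Prod>y\<in>{s}. \<alpha> y)) \<noteq> 0)"
    by (rule generic_point_monomials[where R = "\<lambda>_. T" and g = "\<lambda>_ s. {s}"])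
      (use finT YI(1) large' attained in \<open>auto simp: inj_on_def\<close>)
  then obtain \<alpha> where \<alpha>: "\<And>s. s \<in> T \<Longrightarrow> \<alpha> s \<noteq> 0" "\<And>k. k \<in> Y - I \<Longrightarrow> (\<Sum>s\<in>T. \<beta> k s * \<alpha> s) \<noteq> 0"
    by auto

  (* The cocircuit has entry ?D at f s, so this scaling makes the entry there hmonom (\<alpha> s) (inverse (v (f s))). *)
  define a where "a s = hmonom (\<alpha> s) (inverse (v (f s))) * inverse ?D" for s
  define x where "x = (\<lambda>k. \<Sum>s\<in>T. a s * ?b s k)"
  have vala: "hval (a s) = v (f s) * inverse (?w I)" "hlc (a s) = \<alpha> s * hlc (inverse ?D)" if "s \<in> T" for s
  proof -
    have "\<alpha> s \<noteq> 0" "inverse (v (f s)) \<noteq> 0" using that \<alpha>(1) by (auto simp: T_def Y_def)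
    then show "hval (a s) = v (f s) * inverse (?w I)" "hlc (a s) = \<alpha> s * hlc (inverse ?D)"
      unfolding a_def by (simp_all add: hval_mult hlc_mult hval_inverse valD hval_hmonom hlc_hmonom)
  qed
  have x_row: "x \<in> row_space X d B"
    unfolding x_def by (intro row_space_combination cocircuit_vec_in_row_space) (auto simp: T_def)
  have val_term: "hval (a s * ?b s k) = inverse (?w I) * (?w (insert k (I - {f s})) * v (f s))" if "s \<in> T" for s k
    using vala(1)[OF that] valb[of s k] that by (simp add: hval_mult T_def ac_simps)
  have cancel: "inverse (?w I) * (?w I * y) = y" for y
    using wI by (simp add: idem_left_inverse flip: mult.assoc)
  have off: "?b s (f t) = 0" if "s < d" "t < d" "s \<noteq> t" for s t
  proof -
    have "f t \<noteq> f s" using f that by (auto simp: bij_betw_def inj_on_def)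
    then have "insert (f t) (I - {f s}) = I - {f s}" using fs[OF that(2)] by auto
    moreover have "card (I - {f s}) \<noteq> d" using card_Suc_Diff1[OF fI fs[OF that(1)]] cardI by simp
    ultimately show ?thesis using valb[OF that(1), of "f t"] minor_val_card[of "I - {f s}" d X B] by simp
  qed
  have "hval (x k) = v k" for k
  proof (cases "k \<in> Y - I")
    case True
    have vk: "v k \<noteq> 0" using True by (auto simp: Y_def)
    have iff: "hval (a s * ?b s k) = v k \<longleftrightarrow> ?w (insert k (I - {f s})) * v (f s) = ?w I * v k" if "s \<in> T" for s
    proof -
      have "hval (a s * ?b s k) = v k \<longleftrightarrow> ?w I * hval (a s * ?b s k) = ?w I * v k"
        using idem_mult_left_cancel[OF wI] by simp
      then show ?thesis unfolding val_term[OF that] using wI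
        by (simp add: idem_right_inverse flip: mult.assoc)
    qed
    show ?thesis
      unfolding x_def
    proof (rule hval_sum_eq)
      fix s assume s: "s \<in> T"
      have "inverse (?w I) * (?w (insert k (I - {f s})) * v (f s)) \<le> inverse (?w I) * (?w I * v k)"
        using le[of s k] s True by (intro idem_mult_mono) (auto simp: T_def)
      then show "hval (a s * ?b s k) \<le> v k" unfolding val_term[OF s] cancel .
    next
      have "(\<Sum>s | s \<in> T \<and> hval (a s * ?b s k) = v k. hlc (a s * ?b s k)) =
          (\<Sum>s\<in>T. if hval (a s * ?b s k) = v k then hlc (a s * ?b s k) else 0)"
        using finT by (simp add: sum.inter_filter)
      also have "\<dots> = (\<Sum>s\<in>T. \<beta> k s * \<alpha> s)"
      proof (intro sum.cong refl)
        fix s assume s: "s \<in> T"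
        show "(if hval (a s * ?b s k) = v k then hlc (a s * ?b s k) else 0) = \<beta> k s * \<alpha> s"
          unfolding iff[OF s] \<beta>_def using vala(2)[OF s] by (simp add: hlc_mult)
      qed
      finally show "(\<Sum>s | s \<in> T \<and> hval (a s * ?b s k) = v k. hlc (a s * ?b s k)) \<noteq> 0"
        using \<alpha>(2)[OF True] by simp
    qed (rule finT)
  next
    case False
    consider "k \<notin> X" | "k \<in> Z - I" | "k \<in> I" using False by (auto simp: Y_def Z_def)
    then show ?thesis
    proof cases
      case 1
      then have "x k = 0" "v k = 0" using x_row v by (auto simp: row_space_def plucker_space_def coord_space_def)
      then show ?thesis by simp
    next
      case 2
      have "?b s k = 0" if "s \<in> T" for s using zero[of s k] valb[of s k] that 2 by (simp add: T_def)
      then have "x k = 0" by (simp add: x_def)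
      then show ?thesis using 2 by (simp add: Z_def)
    next
      case 3
      then have "k \<in> f ` {..<d}" using f by (simp add: bij_betw_def)
      then obtain t where t: "t < d" "f t = k" by auto
      have "x k = (\<Sum>s\<in>T. if s = t then a t * ?b t k else 0)"
        unfolding x_def using off[OF _ t(1)] t by (intro sum.cong refl) (auto simp: T_def)
      then have xk: "x k = (if t \<in> T then a t * ?b t k else 0)" using finT by simp
      show ?thesis
      proof (cases "t \<in> T")
        case True
        have "insert k (I - {f t}) = I" using t 3 by auto
        then show ?thesis using xk True val_term[OF True, of k] t cancel by simp
      next
        case False
        then have "v k = 0" using t 3 IX by (auto simp: T_def Y_def)
        then show ?thesis using xk False by simp
      qed
    qed
  qed
  then show ?thesis using x_row by blast
qed

lemma trop_row_space:
  fixes B :: "'x \<Rightarrow> nat \<Rightarrow> ('s::idem_semifield, 'k::field) hahn"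
  assumes "finite X" "\<exists>I. minor_val X d B I \<noteq> 0"
    and "d = 0 \<or> infinite (UNIV :: 'k set) \<or> card X - d + 1 < card (UNIV :: 'k set)"
  shows "trop (row_space X d B) = plucker_space X d (minor_val X d B)"
proof
  show "trop (row_space X d B) \<subseteq> plucker_space X d (minor_val X d B)"
    using trop_row_space_subset by (auto simp: trop_def)
  show "plucker_space X d (minor_val X d B) \<subseteq> trop (row_space X d B)"
  proof
    fix v assume "v \<in> plucker_space X d (minor_val X d B)"
    from plucker_space_lifts[OF assms this] obtain x where "x \<in> row_space X d B" "\<forall>k. hval (x k) = v k" by auto
    then show "v \<in> trop (row_space X d B)" unfolding trop_def by (intro image_eqI[of _ _ x]) auto
  qed
qed

lemma sum_fun_apply: "(\<Sum>a\<in>A. f a) k = (\<Sum>a\<in>A. f a k)"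
  by (induction A rule: infinite_finite_induct) auto

text \<open>
  A minimal set of coordinates on which no nonzero vector of \<open>\<Lambda>\<close> vanishes carries a basis of \<open>\<Lambda>\<close> that
  restricts to the standard basis.
\<close>

lemma linear_subspace_row_space:
  fixes \<Lambda> :: "('x \<Rightarrow> 'k::field) set"
  assumes fin: "finite X" and sub: "linear_subspace X \<Lambda>"
  shows "\<exists>B f. \<Lambda> = row_space X (coord.dim \<Lambda>) B \<and> inj_on f {..<coord.dim \<Lambda>} \<and>
    f ` {..<coord.dim \<Lambda>} \<subseteq> X \<and> vec_det (coord.dim \<Lambda>) (\<lambda>s. B (f s)) = 1"
proof -
  have \<Lambda>: "\<Lambda> \<subseteq> coord_space X" "coord.subspace \<Lambda>" using sub by (auto simp: linear_subspace_def)
  define P where "P I \<longleftrightarrow> I \<subseteq> X \<and> (\<forall>x\<in>\<Lambda>. (\<forall>i\<in>I. x i = 0) \<longrightarrow> (\<forall>i. x i = 0))" for I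
  have "P X" using \<Lambda>(1) unfolding P_def coord_space_def by auto
  then obtain I where I: "P I" and min: "\<And>I'. P I' \<Longrightarrow> card I \<le> card I'"
    using ex_has_least_nat[of P X card] by auto
  have IX: "I \<subseteq> X" and vanish: "\<And>x i. x \<in> \<Lambda> \<Longrightarrow> (\<And>j. j \<in> I \<Longrightarrow> x j = 0) \<Longrightarrow> x i = 0"
    using I unfolding P_def by blast+
  have fI: "finite I" using IX fin by (rule finite_subset)
  have "\<exists>x. x \<in> \<Lambda> \<and> (\<forall>j\<in>I. x j = (if j = i then 1 else 0))" if i: "i \<in> I" for i
  proof -
    have "\<not> P (I - {i})" using min[of "I - {i}"] card_Diff1_less[OF fI i] by linarith
    then obtain x k where x: "x \<in> \<Lambda>" "\<forall>j\<in>I - {i}. x j = 0" "x k \<noteq> 0" using IX unfolding P_def by blast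
    have xi: "x i \<noteq> 0"
    proof
      assume "x i = 0"
      then have "x j = 0" if "j \<in> I" for j using x(2) that by (cases "j = i") auto
      then have "x k = 0" by (rule vanish[OF x(1)])
      then show False using x by simp
    qed
    have "cscale (inverse (x i)) x \<in> \<Lambda>" using \<Lambda>(2) x(1) by (rule coord.subspace_scale)
    moreover have "\<forall>j\<in>I. cscale (inverse (x i)) x j = (if j = i then 1 else 0)"
      using x(2) xi by (auto simp: cscale_def)
    ultimately show ?thesis by blast
  qed
  then have "\<forall>i\<in>I. \<exists>x. x \<in> \<Lambda> \<and> (\<forall>j\<in>I. x j = (if j = i then 1 else 0))" by simp
  then obtain b where "\<forall>i\<in>I. b i \<in> \<Lambda> \<and> (\<forall>j\<in>I. b i j = (if j = i then 1 else 0))"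
    by (rule bchoice[THEN exE])
  then have b: "\<And>i. i \<in> I \<Longrightarrow> b i \<in> \<Lambda>" "\<And>i j. i \<in> I \<Longrightarrow> j \<in> I \<Longrightarrow> b i j = (if j = i then 1 else 0)"
    by simp_all
  have comb_in: "(\<Sum>i\<in>I. cscale (u i) (b i)) \<in> \<Lambda>" for u
    using \<Lambda>(2) b(1) by (intro coord.subspace_sum coord.subspace_scale) auto
  have comb: "(\<Sum>i\<in>I. cscale (u i) (b i)) k = (\<Sum>i\<in>I. u i * b i k)" for u k
    by (simp add: sum_fun_apply cscale_def)
  have comb_at: "(\<Sum>i\<in>I. u i * b i j) = u j" if "j \<in> I" for u j
  proof -
    have "(\<Sum>i\<in>I. u i * b i j) = (\<Sum>i\<in>I. if i = j then u j else 0)"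
      using b(2) that by (intro sum.cong refl) auto
    then show ?thesis using fI that by simp
  qed
  have expand: "x = (\<Sum>i\<in>I. cscale (x i) (b i))" if x: "x \<in> \<Lambda>" for x
  proof
    fix k
    let ?y = "x - (\<Sum>i\<in>I. cscale (x i) (b i))"
    have "?y \<in> \<Lambda>" using \<Lambda>(2) x comb_in by (rule coord.subspace_diff)
    then have "?y k = 0" by (rule vanish) (simp add: comb comb_at)
    then show "x k = (\<Sum>i\<in>I. cscale (x i) (b i)) k" by simp
  qed
  have inj: "inj_on b I"
    by (rule inj_onI) (metis b(2) zero_neq_one)
  have indep: "coord.independent (b ` I)"
  proof -
    have "\<forall>v\<in>b ` I. u v = 0" if u: "(\<Sum>v\<in>b ` I. cscale (u v) v) = 0" for u
    proof
      fix v assume "v \<in> b ` I"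
      then obtain i where i: "i \<in> I" "v = b i" by auto
      have "(\<Sum>i\<in>I. cscale (u (b i)) (b i)) = 0" using u inj by (simp add: sum.reindex)
      then have "(\<Sum>i\<in>I. u (b i) * b i j) = 0" for j using comb[of "\<lambda>i. u (b i)" j] by simp
      then have "u (b i) = 0" using comb_at[OF i(1), of "\<lambda>i. u (b i)"] by simp
      then show "u v = 0" using i by simp
    qed
    then show ?thesis using fI by (auto simp: coord.dependent_finite)
  qed
  have span: "coord.span (b ` I) = coord.span \<Lambda>"
  proof
    show "coord.span (b ` I) \<subseteq> coord.span \<Lambda>" using b(1) by (intro coord.span_mono) auto
    have "\<Lambda> \<subseteq> coord.span (b ` I)"
    proof
      fix x assume "x \<in> \<Lambda>"
      then have "x = (\<Sum>i\<in>I. cscale (x i) (b i))" by (rule expand)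
      also have "\<dots> \<in> coord.span (b ` I)"
        by (intro coord.span_sum coord.span_scale coord.span_base) auto
      finally show "x \<in> coord.span (b ` I)" .
    qed
    then show "coord.span \<Lambda> \<subseteq> coord.span (b ` I)" by (metis coord.span_mono coord.span_span)
  qed
  have dim: "coord.dim \<Lambda> = card I"
    using coord.dim_eq_card[OF span indep] inj by (simp add: card_image)
  let ?d = "coord.dim \<Lambda>"
  obtain f where f: "bij_betw f {..<?d} I" using ex_bij_betw_nat_finite[OF fI] by (auto simp: dim atLeast0LessThan)
  define B where "B k r = b (f r) k" for k r
  have reindex: "(\<Sum>r<?d. c (f r) * B k r) = (\<Sum>i\<in>I. c i * b i k)" for c k
    unfolding B_def by (rule sum.reindex_bij_betw[OF f])
  have "\<Lambda> = row_space X ?d B"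
  proof (intro subset_antisym subsetI)
    fix x assume x: "x \<in> \<Lambda>"
    have xk: "x k = (\<Sum>r<?d. x (f r) * B k r)" for k
      unfolding reindex[of x] using fun_cong[OF expand[OF x], of k] comb[of x k] by simp
    have "\<exists>c. \<forall>k\<in>X. x k = (\<Sum>r<?d. c r * B k r)" by (intro exI[of _ "\<lambda>r. x (f r)"] ballI xk)
    then show "x \<in> row_space X ?d B" using x \<Lambda>(1) by (auto simp: row_space_def)
  next
    fix x assume "x \<in> row_space X ?d B"
    then obtain c where x: "x \<in> coord_space X" and c: "\<And>k. k \<in> X \<Longrightarrow> x k = (\<Sum>r<?d. c r * B k r)"
      unfolding row_space_def by auto
    define u where "u i = c (inv_into {..<?d} f i)" for i
    have "x = (\<Sum>i\<in>I. cscale (u i) (b i))"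
    proof
      fix k
      show "x k = (\<Sum>i\<in>I. cscale (u i) (b i)) k"
      proof (cases "k \<in> X")
        case True
        have "(\<Sum>r<?d. c r * B k r) = (\<Sum>r<?d. u (f r) * B k r)"
          using bij_betw_inv_into_left[OF f] by (intro sum.cong refl) (simp add: u_def)
        then show ?thesis using c[OF True] by (simp add: reindex comb)
      next
        case False
        then have "x k = 0" using x by (simp add: coord_space_def)
        moreover have "(\<Sum>i\<in>I. cscale (u i) (b i)) k = 0"
          using comb_in[of u] \<Lambda>(1) False by (auto simp: coord_space_def)
        ultimately show ?thesis by simp
      qed
    qed
    then show "x \<in> \<Lambda>" using comb_in by simp
  qed
  moreover have "vec_det ?d (\<lambda>s. B (f s)) = 1"
  proof -
    have fi: "f s = f r \<longleftrightarrow> s = r" if "s < ?d" "r < ?d" for s r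
      using f that by (auto simp: bij_betw_def inj_on_def)
    have "f s \<in> I" if "s < ?d" for s using f that by (auto simp: bij_betw_def)
    then have "vec_det ?d (\<lambda>s. B (f s)) = vec_det ?d (\<lambda>s r. if s = r then 1 else 0)"
      using b(2) fi by (intro vec_det_cong) (simp add: B_def)
    also have "mat ?d ?d (\<lambda>(s, r). if s = r then 1 else 0 :: 'k) = 1\<^sub>m ?d" by (rule eq_matI) auto
    then have "vec_det ?d (\<lambda>s r. if s = r then 1 else 0 :: 'k) = 1" by (simp add: vec_det_def)
    finally show ?thesis .
  qed
  moreover have "f ` {..<?d} = I" "inj_on f {..<?d}" using f by (simp_all add: bij_betw_def)
  ultimately show ?thesis using IX by (intro exI[of _ B] exI[of _ f]) auto
qed


section \<open>Minors of a graph\<close>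

text \<open>
  The graph of \<open>\<Delta>\<close> on the row space of \<open>B\<close> is a row space: its column at \<open>f\<^sub>j\<close> is the combination
  of the columns of \<open>B\<close> given by the \<open>j\<close>-th row of \<open>\<Delta>\<close>.
\<close>

definition graph_cols :: "'e set \<Rightarrow> ('f \<times> 'e \<Rightarrow> 'k::field) \<Rightarrow> ('e \<Rightarrow> nat \<Rightarrow> 'k) \<Rightarrow> 'e + 'f \<Rightarrow> nat \<Rightarrow> 'k" where
  "graph_cols E \<Delta> B = case_sum B (\<lambda>j r. \<Sum>i\<in>E. \<Delta> (j, i) * B i r)"

text \<open>
  Expand the columns at the elements of \<open>J\<close> by multilinearity; a choice of one summand from each of
  them is a map \<open>\<sigma>\<close>.
\<close>

lemma vec_det_graph_cols:
  assumes fin: "finite E" "finite I" "finite J" and f: "bij_betw f {..<d} (I <+> J)"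
  shows "vec_det d (\<lambda>s. graph_cols E \<Delta> B (f s)) =
    (\<Sum>\<sigma>\<in>J \<rightarrow>\<^sub>E E. (\<Prod>j\<in>J. \<Delta> (j, \<sigma> j)) * vec_det d (\<lambda>s. B (case_sum id \<sigma> (f s))))"
proof -
  define Q where "Q s = (case f s of Inl i \<Rightarrow> {i} | Inr j \<Rightarrow> E)" for s
  define c where "c s i = (case f s of Inl _ \<Rightarrow> 1 | Inr j \<Rightarrow> \<Delta> (j, i))" for s i
  let ?inv = "inv_into {..<d} f"
  have fin_Inr: "?inv (Inr j) < d" "f (?inv (Inr j)) = Inr j" if "j \<in> J" for j
  proof -
    have j: "Inr j \<in> I <+> J" using that by auto
    show "f (?inv (Inr j)) = Inr j" by (rule bij_betw_inv_into_right[OF f j])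
    have "?inv (Inr j) \<in> {..<d}" using bij_betw_inv_into[OF f] j by (auto simp: bij_betw_def)
    then show "?inv (Inr j) < d" by simp
  qed
  have fs: "f s \<in> I <+> J" if "s < d" for s using f that by (auto simp: bij_betw_def)
  have "vec_det d (\<lambda>s. graph_cols E \<Delta> B (f s)) =
      (\<Sum>g\<in>PiE {..<d} Q. (\<Prod>s<d. c s (g s)) * vec_det d (\<lambda>s. B (g s)))"
    by (rule vec_det_sum) (auto simp: Q_def c_def graph_cols_def fin split: sum.split)
  also have "\<dots> = (\<Sum>\<sigma>\<in>J \<rightarrow>\<^sub>E E. (\<Prod>j\<in>J. \<Delta> (j, \<sigma> j)) * vec_det d (\<lambda>s. B (case_sum id \<sigma> (f s))))"
  proof (rule sum.reindex_bij_witness[where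
        j = "\<lambda>g. \<lambda>j\<in>J. g (?inv (Inr j))" and i = "\<lambda>\<sigma>. \<lambda>s\<in>{..<d}. case_sum id \<sigma> (f s)"])
    fix g assume g: "g \<in> PiE {..<d} Q"
    let ?\<sigma> = "\<lambda>j\<in>J. g (?inv (Inr j))"
    have g_eq: "case_sum id ?\<sigma> (f s) = g s" if s: "s < d" for s
    proof (cases "f s")
      case (Inl i)
      then have "g s \<in> {i}" using g s by (auto simp: Q_def dest!: PiE_mem[of g _ _ s])
      then show ?thesis using Inl by simp
    next
      case (Inr j)
      then have j: "j \<in> J" using fs[OF s] by auto
      have "?inv (f s) = s" using s by (intro bij_betw_inv_into_left[OF f]) simp
      then have "?inv (Inr j) = s" using Inr by simp
      then show ?thesis using Inr j by simp
    qed
    show "(\<lambda>s\<in>{..<d}. case_sum id ?\<sigma> (f s)) = g"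
    proof
      fix s
      show "(\<lambda>s\<in>{..<d}. case_sum id ?\<sigma> (f s)) s = g s"
        using g_eq[of s] PiE_arb[OF g, of s] by (cases "s < d") auto
    qed
    show "?\<sigma> \<in> J \<rightarrow>\<^sub>E E"
    proof
      fix j assume j: "j \<in> J"
      then have "g (?inv (Inr j)) \<in> Q (?inv (Inr j))" using g fin_Inr(1)[OF j] by (auto dest!: PiE_mem)
      then show "?\<sigma> j \<in> E" using j fin_Inr(2)[OF j] by (simp add: Q_def)
    qed simp
    have "(\<Prod>s<d. c s (g s)) = (\<Prod>s<d. case_sum (\<lambda>_. 1) (\<lambda>j. \<Delta> (j, ?\<sigma> j)) (f s))"
    proof (intro prod.cong refl)
      fix s assume "s \<in> {..<d}"
      then show "c s (g s) = case_sum (\<lambda>_. 1) (\<lambda>j. \<Delta> (j, ?\<sigma> j)) (f s)"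
        using g_eq[of s] by (cases "f s") (auto simp: c_def)
    qed
    also have "\<dots> = (\<Prod>x\<in>I <+> J. case_sum (\<lambda>_. 1) (\<lambda>j. \<Delta> (j, ?\<sigma> j)) x)"
      by (rule prod.reindex_bij_betw[OF f])
    also have "\<dots> = (\<Prod>j\<in>J. \<Delta> (j, ?\<sigma> j))" using fin by (subst prod.Plus) (auto simp: comp_def)
    finally have "(\<Prod>s<d. c s (g s)) = (\<Prod>j\<in>J. \<Delta> (j, ?\<sigma> j))" .
    moreover have "vec_det d (\<lambda>s. B (g s)) = vec_det d (\<lambda>s. B (case_sum id ?\<sigma> (f s)))"
      using g_eq by (intro vec_det_cong) simp
    ultimately show "(\<Prod>j\<in>J. \<Delta> (j, ?\<sigma> j)) * vec_det d (\<lambda>s. B (case_sum id ?\<sigma> (f s))) =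
        (\<Prod>s<d. c s (g s)) * vec_det d (\<lambda>s. B (g s))" by simp
  next
    fix \<sigma> assume \<sigma>: "\<sigma> \<in> J \<rightarrow>\<^sub>E E"
    let ?g = "\<lambda>s\<in>{..<d}. case_sum id \<sigma> (f s)"
    show "(\<lambda>j\<in>J. ?g (?inv (Inr j))) = \<sigma>"
    proof
      fix j
      show "(\<lambda>j\<in>J. ?g (?inv (Inr j))) j = \<sigma> j"
        using fin_Inr[of j] PiE_arb[OF \<sigma>, of j] by (cases "j \<in> J") auto
    qed
    show "?g \<in> PiE {..<d} Q"
    proof
      fix s assume s: "s \<in> {..<d}"
      show "?g s \<in> Q s"
        using s fs[of s] PiE_mem[OF \<sigma>] by (cases "f s") (auto simp: Q_def)
    qed simp
  qed
  finally show ?thesis .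
qed

text \<open>
  Which minors of \<open>B\<close> occur in this expansion, and with which valuation, is described by the weight
  that occurs in the tropical graph.
\<close>

lemma hval_vec_det_graph_term:
  assumes f: "bij_betw f {..<d} (I <+> J)" and I: "I \<subseteq> E" and \<sigma>: "\<sigma> \<in> J \<rightarrow>\<^sub>E E"
  shows "hval (vec_det d (\<lambda>s. B (case_sum id \<sigma> (f s)))) = graph_weight (minor_val E d B) I J \<sigma>"
proof -
  let ?\<tau> = "case_sum id \<sigma>"
  have finj: "inj_on f {..<d}" and fimg: "f ` {..<d} = I <+> J" using f by (auto simp: bij_betw_def)
  have img: "?\<tau> ` (I <+> J) = I \<union> \<sigma> ` J" by (simp add: Plus_def image_Un image_image)
  have inj: "inj_on ?\<tau> (I <+> J) \<longleftrightarrow> inj_on \<sigma> J \<and> \<sigma> ` J \<inter> I = {}"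
  proof -
    have "Inl ` I - Inr ` J = Inl ` I" "Inr ` J - Inl ` I = Inr ` J" by auto
    moreover have "?\<tau> ` Inl ` I = I" "?\<tau> ` Inr ` J = \<sigma> ` J" by (simp_all add: image_image)
    moreover have "inj_on ?\<tau> (Inl ` I)" by (simp add: inj_on_def)
    moreover have "inj_on ?\<tau> (Inr ` J) \<longleftrightarrow> inj_on \<sigma> J" by (simp add: inj_on_def)
    ultimately show ?thesis by (simp add: Plus_def inj_on_Un Int_commute)
  qed
  show ?thesis
  proof (cases "inj_on \<sigma> J \<and> \<sigma> ` J \<inter> I = {}")
    case True
    then have "bij_betw ?\<tau> (I <+> J) (I \<union> \<sigma> ` J)" using inj img by (simp add: bij_betw_def)
    with f have "bij_betw (?\<tau> \<circ> f) {..<d} (I \<union> \<sigma> ` J)" by (rule bij_betw_trans)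
    moreover have "I \<union> \<sigma> ` J \<subseteq> E" using I \<sigma> by auto
    ultimately have "minor_val E d B (I \<union> \<sigma> ` J) = hval (vec_det d (\<lambda>s. B ((?\<tau> \<circ> f) s)))"
      by (rule minor_val_eq)
    then show ?thesis using True by (simp add: graph_weight_def)
  next
    case False
    then have "\<not> inj_on (?\<tau> \<circ> f) {..<d}"
      using comp_inj_on_iff[OF finj, of ?\<tau>] unfolding fimg inj by blast
    then have "vec_det d (\<lambda>s. B ((?\<tau> \<circ> f) s)) = 0" by (rule vec_det_not_inj)
    then show ?thesis using False by (auto simp: graph_weight_def)
  qed
qed


section \<open>Generic leading coefficients\<close>

text \<open>
  The leading coefficient of a term of highest valuation in the minor of the graph at \<open>Z\<close> is
  \<open>graph_coeff E F d A B Z \<sigma>\<close> times a monomial in the leading coefficients of \<open>\<Delta>\<close>; for all other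
  terms \<open>graph_coeff E F d A B Z \<sigma>\<close> is \<open>0\<close>. It depends on \<open>\<Delta>\<close> only through the valuations \<open>A\<close>.
\<close>

definition graph_coeff :: "'e set \<Rightarrow> 'f set \<Rightarrow> nat \<Rightarrow> ('f \<times> 'e \<Rightarrow> 's::idem_semifield) \<Rightarrow>
    ('e \<Rightarrow> nat \<Rightarrow> ('s, 'k::field) hahn) \<Rightarrow> ('e + 'f) set \<Rightarrow> ('f \<Rightarrow> 'e) \<Rightarrow> 'k" where
  "graph_coeff E F d A B Z \<sigma> =
    (if (\<Prod>j\<in>Inr -` Z. A (j, \<sigma> j)) * graph_weight (minor_val E d B) (Inl -` Z) (Inr -` Z) \<sigma> =
        trop_graph E F A (minor_val E d B) Z
     then hlc (vec_det d (\<lambda>s. B (case_sum id \<sigma> ((SOME f. bij_betw f {..<d} Z) s)))) else 0)"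

definition graph_poly :: "'e set \<Rightarrow> 'f set \<Rightarrow> nat \<Rightarrow> ('f \<times> 'e \<Rightarrow> 's::idem_semifield) \<Rightarrow>
    ('e \<Rightarrow> nat \<Rightarrow> ('s, 'k::field) hahn) \<Rightarrow> ('e + 'f) set \<Rightarrow> ('f \<times> 'e \<Rightarrow> 'k) \<Rightarrow> 'k" where
  "graph_poly E F d A B Z c =
    (\<Sum>\<sigma>\<in>(Inr -` Z) \<rightarrow>\<^sub>E E. graph_coeff E F d A B Z \<sigma> * (\<Prod>j\<in>Inr -` Z. c (j, \<sigma> j)))"

lemma ex_bij_enum:
  assumes "finite Z" "card Z = d"
  shows "bij_betw (SOME f. bij_betw f {..<d} Z) {..<d} Z"
  using ex_bij_betw_nat_finite[OF assms(1)] assms(2)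
  by (intro someI_ex[where P = "\<lambda>f. bij_betw f {..<d} Z"]) (simp add: atLeast0LessThan)

text \<open>
  \<open>graph_poly\<close> at the leading coefficients of \<open>\<Delta>\<close> is the sum of the leading coefficients of the largest
  terms, so the valuation is the tropical one if it does not vanish. For \<open>Z \<subseteq> E\<close> the expansion has a
  single term and nothing can cancel.
\<close>

lemma minor_val_graph_cols:
  fixes B :: "'e \<Rightarrow> nat \<Rightarrow> ('s::idem_semifield, 'k::field) hahn" and A :: "'f \<times> 'e \<Rightarrow> 's"
  assumes fin: "finite E" "finite F" and Z: "Z \<subseteq> E <+> F" "card Z = d"
    and \<Delta>: "\<Delta> \<in> val_fibre F E A"
    and generic: "Inr -` Z \<noteq> {} \<Longrightarrow> trop_graph E F A (minor_val E d B) Z \<noteq> 0 \<Longrightarrow>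
      graph_poly E F d A B Z (lead_coeffs \<Delta>) \<noteq> 0"
  shows "minor_val (E <+> F) d (graph_cols E \<Delta> B) Z = trop_graph E F A (minor_val E d B) Z"
proof -
  let ?I = "Inl -` Z" and ?J = "Inr -` Z" and ?w = "minor_val E d B"
  let ?f = "SOME f. bij_betw f {..<d} Z" and ?m = "trop_graph E F A (minor_val E d B) Z"
  have ZIJ: "Z = ?I <+> ?J" using Z(1) by auto
  have sub: "?I \<subseteq> E" "?J \<subseteq> F" using Z(1) by auto
  have finIJ: "finite ?I" "finite ?J" using finite_subset[OF sub(1) fin(1)] finite_subset[OF sub(2) fin(2)] by auto
  have finZ: "finite Z" using Z(1) fin by (auto intro: finite_subset)
  have f: "bij_betw ?f {..<d} Z" using finZ Z(2) by (rule ex_bij_enum)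
  then have f': "bij_betw ?f {..<d} (?I <+> ?J)" using ZIJ by simp
  let ?D = "\<lambda>\<sigma>. vec_det d (\<lambda>s. B (case_sum id \<sigma> (?f s)))"
  let ?t = "\<lambda>\<sigma>. (\<Prod>j\<in>?J. \<Delta> (j, \<sigma> j)) * ?D \<sigma>"
  let ?a = "\<lambda>\<sigma>. (\<Prod>j\<in>?J. A (j, \<sigma> j)) * graph_weight ?w ?I ?J \<sigma>"
  have finPi: "finite (?J \<rightarrow>\<^sub>E E)" using finIJ fin by (intro finite_PiE) auto
  have m: "?m = sum ?a (?J \<rightarrow>\<^sub>E E)"
    using trop_graph_eq_sum[OF fin sub, of A ?w] ZIJ by simp
  have val: "hval (?t \<sigma>) = ?a \<sigma>" if \<sigma>: "\<sigma> \<in> ?J \<rightarrow>\<^sub>E E" for \<sigma>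
  proof -
    have "hval (\<Delta> (j, \<sigma> j)) = A (j, \<sigma> j)" if "j \<in> ?J" for j
      using \<Delta> sub that PiE_mem[OF \<sigma>] by (auto simp: val_fibre_def)
    then have "hval (\<Prod>j\<in>?J. \<Delta> (j, \<sigma> j)) = (\<Prod>j\<in>?J. A (j, \<sigma> j))"
      unfolding hval_prod by (intro prod.cong refl)
    then show ?thesis
      using hval_vec_det_graph_term[OF f' sub(1) \<sigma>, of B] by (simp add: hval_mult)
  qed
  have "hval (sum ?t (?J \<rightarrow>\<^sub>E E)) = ?m"
  proof (rule hval_sum_eq[OF finPi])
    fix \<sigma> assume \<sigma>: "\<sigma> \<in> ?J \<rightarrow>\<^sub>E E"
    show "hval (?t \<sigma>) \<le> ?m" unfolding val[OF \<sigma>] m by (rule idem_le_sum[OF finPi \<sigma>])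
  next
    assume nz: "?m \<noteq> 0"
    show "(\<Sum>\<sigma> | \<sigma> \<in> ?J \<rightarrow>\<^sub>E E \<and> hval (?t \<sigma>) = ?m. hlc (?t \<sigma>)) \<noteq> 0"
    proof (cases "?J = {}")
      case True
      let ?u = "\<lambda>_. undefined :: 'e"
      have Pi: "?J \<rightarrow>\<^sub>E E = {?u}" using True by (simp add: PiE_empty_domain)
      then have "hval (?t ?u) = ?m" unfolding m using val[of ?u] by simp
      then have single: "{\<sigma>. \<sigma> \<in> ?J \<rightarrow>\<^sub>E E \<and> hval (?t \<sigma>) = ?m} = {?u}" unfolding Pi by auto
      have "?t ?u \<noteq> 0"
      proof
        assume "?t ?u = 0"
        then have "hval (?t ?u) = 0" by (simp only: hval_zero)
        then show False using nz \<open>hval (?t ?u) = ?m\<close> by simp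
      qed
      then have "hlc (?t ?u) \<noteq> 0" by (simp only: hlc_eq_0_iff not_False_eq_True)
      moreover have "(\<Sum>\<sigma>\<in>{?u}. hlc (?t \<sigma>)) = hlc (?t ?u)"
        by (simp only: sum.insert finite.emptyI empty_iff not_False_eq_True sum.empty add_0_right)
      ultimately show ?thesis unfolding single by argo
    next
      case False
      have "(\<Sum>\<sigma> | \<sigma> \<in> ?J \<rightarrow>\<^sub>E E \<and> hval (?t \<sigma>) = ?m. hlc (?t \<sigma>)) =
          (\<Sum>\<sigma>\<in>?J \<rightarrow>\<^sub>E E. if hval (?t \<sigma>) = ?m then hlc (?t \<sigma>) else 0)"
        using finPi by (simp add: sum.inter_filter)
      also have "\<dots> = graph_poly E F d A B Z (lead_coeffs \<Delta>)"
        unfolding graph_poly_def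
      proof (intro sum.cong refl)
        fix \<sigma> assume \<sigma>: "\<sigma> \<in> ?J \<rightarrow>\<^sub>E E"
        show "(if hval (?t \<sigma>) = ?m then hlc (?t \<sigma>) else 0) =
            graph_coeff E F d A B Z \<sigma> * (\<Prod>j\<in>?J. lead_coeffs \<Delta> (j, \<sigma> j))"
          unfolding val[OF \<sigma>] graph_coeff_def by (simp add: hlc_mult hlc_prod lead_coeffs_def)
      qed
      finally show ?thesis using generic[OF False nz] by simp
    qed
  qed
  then show ?thesis
    using minor_val_eq[OF f Z(1), of "graph_cols E \<Delta> B"] vec_det_graph_cols[OF fin(1) finIJ f', of \<Delta> B] by simp
qed

text \<open>
  There are fewer than \<open>n choose d\<close> conditions, where \<open>n = |E| + |F|\<close>, because the set \<open>I0\<close> inside \<open>E\<close>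
  imposes none. This leaves room for requiring that all coordinates of the point be nonzero.
\<close>

lemma exists_generic_leading_coeffs:
  fixes B :: "'e \<Rightarrow> nat \<Rightarrow> ('s::idem_semifield, 'k::field) hahn" and A :: "'f \<times> 'e \<Rightarrow> 's"
  assumes fin: "finite E" "finite F" and I0: "I0 \<subseteq> E" "card I0 = d"
    and large: "infinite (UNIV :: 'k set) \<or> (card E + card F) choose d < card (UNIV :: 'k set)"
  shows "\<exists>c. (\<forall>x\<in>F \<times> E. c x \<noteq> 0) \<and>
    (\<forall>Z. Z \<subseteq> E <+> F \<and> card Z = d \<and> Inr -` Z \<noteq> {} \<and> trop_graph E F A (minor_val E d B) Z \<noteq> 0 \<longrightarrow>
      graph_poly E F d A B Z c \<noteq> 0)"
proof -
  let ?w = "minor_val E d B"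
  define T where "T = {Z. Z \<subseteq> E <+> F \<and> card Z = d \<and> Inr -` Z \<noteq> {} \<and> trop_graph E F A ?w Z \<noteq> 0}"
  define g where "g Z \<sigma> = (\<lambda>j. (j, \<sigma> j)) ` (Inr -` Z)" for Z :: "('e + 'f) set" and \<sigma> :: "'f \<Rightarrow> 'e"
  let ?N = "{Z. Z \<subseteq> E <+> F \<and> card Z = d}"
  have "card ?N = (card E + card F) choose d"
    using fin by (subst n_subsets) (simp_all add: card_Plus)
  moreover have finN: "finite ?N" using fin by simp
  moreover have I0N: "Inl ` I0 \<in> ?N" using I0 by (auto simp: card_image)
  moreover have "T \<subseteq> ?N - {Inl ` I0}" by (auto simp: T_def)
  ultimately have "finite T" "card T < (card E + card F) choose d"
    using card_mono[of "?N - {Inl ` I0}" T] finite_subset[of T "?N - {Inl ` I0}"] card_Diff1_less[OF finN I0N] by auto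
  then have T: "finite T" "infinite (UNIV :: 'k set) \<or> card T + 1 < card (UNIV :: 'k set)"
    using large by auto
  have sub: "Inl -` Z \<subseteq> E" "Inr -` Z \<subseteq> F" "finite (Inr -` Z)" if "Z \<in> T" for Z
  proof -
    show *: "Inl -` Z \<subseteq> E" "Inr -` Z \<subseteq> F" using that by (auto simp: T_def)
    show "finite (Inr -` Z)" using *(2) fin(2) by (rule finite_subset)
  qed
  have "\<exists>c. (\<forall>x\<in>F \<times> E. c x \<noteq> 0) \<and>
    (\<forall>Z\<in>T. (\<Sum>\<sigma>\<in>(Inr -` Z) \<rightarrow>\<^sub>E E. graph_coeff E F d A B Z \<sigma> * (\<Prod>x\<in>g Z \<sigma>. c x)) \<noteq> 0)"
  proof (rule generic_point_monomials)
    show "finite (F \<times> E)" "finite T" using fin T by auto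
    show "infinite (UNIV :: 'k set) \<or> card T + 1 < card (UNIV :: 'k set)" by (rule T(2))
    fix Z assume Z: "Z \<in> T"
    let ?I = "Inl -` Z" and ?J = "Inr -` Z"
    show "finite (?J \<rightarrow>\<^sub>E E)" using sub[OF Z] fin by (intro finite_PiE) auto
    show "inj_on (g Z) (?J \<rightarrow>\<^sub>E E)"
    proof (rule inj_onI)
      fix \<sigma> \<sigma>' assume \<sigma>: "\<sigma> \<in> ?J \<rightarrow>\<^sub>E E" "\<sigma>' \<in> ?J \<rightarrow>\<^sub>E E" and eq: "g Z \<sigma> = g Z \<sigma>'"
      have "\<sigma> j = \<sigma>' j" if "j \<in> ?J" for j
      proof -
        have "(j, \<sigma> j) \<in> g Z \<sigma>'" unfolding eq[symmetric] using that by (auto simp: g_def)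
        then show ?thesis by (auto simp: g_def)
      qed
      then show "\<sigma> = \<sigma>'" by (rule PiE_ext[OF \<sigma>])
    qed
    show "g Z \<sigma> \<subseteq> F \<times> E" if "\<sigma> \<in> ?J \<rightarrow>\<^sub>E E" for \<sigma>
      using sub(2)[OF Z] PiE_mem[OF that] by (auto simp: g_def)
    have ZIJ: "Z = ?I <+> ?J" using Z by (auto simp: T_def)
    have finZ: "finite Z" "card Z = d" using Z fin by (auto simp: T_def intro: finite_subset[of Z "E <+> F"])
    have f: "bij_betw (SOME f. bij_betw f {..<d} Z) {..<d} (?I <+> ?J)" using ex_bij_enum[OF finZ] ZIJ by simp
    have m: "trop_graph E F A ?w Z = (\<Sum>\<sigma>\<in>?J \<rightarrow>\<^sub>E E. (\<Prod>j\<in>?J. A (j, \<sigma> j)) * graph_weight ?w ?I ?J \<sigma>)"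
      using trop_graph_eq_sum[OF fin sub(1,2)[OF Z], of A ?w] ZIJ by simp
    have nz: "trop_graph E F A ?w Z \<noteq> 0" using Z by (simp add: T_def)
    then obtain \<sigma> where \<sigma>: "\<sigma> \<in> ?J \<rightarrow>\<^sub>E E"
      "(\<Prod>j\<in>?J. A (j, \<sigma> j)) * graph_weight ?w ?I ?J \<sigma> = trop_graph E F A ?w Z"
      unfolding m using idem_sum_attained by blast
    have "graph_weight ?w ?I ?J \<sigma> \<noteq> 0" using \<sigma>(2) nz by (metis mult_zero_right)
    then have "vec_det d (\<lambda>s. B (case_sum id \<sigma> ((SOME f. bij_betw f {..<d} Z) s))) \<noteq> 0"
      using hval_vec_det_graph_term[OF f sub(1)[OF Z] \<sigma>(1), of B] by auto
    then have "graph_coeff E F d A B Z \<sigma> \<noteq> 0" using \<sigma>(2) by (simp add: graph_coeff_def)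
    then show "\<exists>\<sigma>\<in>?J \<rightarrow>\<^sub>E E. graph_coeff E F d A B Z \<sigma> \<noteq> 0" using \<sigma>(1) by blast
  qed
  then obtain c where c: "\<forall>x\<in>F \<times> E. c x \<noteq> 0"
    "\<forall>Z\<in>T. (\<Sum>\<sigma>\<in>(Inr -` Z) \<rightarrow>\<^sub>E E. graph_coeff E F d A B Z \<sigma> * (\<Prod>x\<in>g Z \<sigma>. c x)) \<noteq> 0"
    by (elim exE conjE)
  have "(\<Prod>x\<in>g Z \<sigma>. c x) = (\<Prod>j\<in>Inr -` Z. c (j, \<sigma> j))" for Z \<sigma>
    unfolding g_def by (subst prod.reindex) (auto simp: inj_on_def)
  then have "\<forall>Z\<in>T. graph_poly E F d A B Z c \<noteq> 0" using c(2) by (simp add: graph_poly_def)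
  then show ?thesis using c(1) by (intro exI[of _ c]) (auto simp: T_def)
qed

text \<open>
  A term that uses a zero entry of \<open>A\<close> is not among the largest ones, so its monomial does not occur.
\<close>

lemma graph_poly_cong:
  assumes fin: "finite E" "finite F" and Z: "Z \<subseteq> E <+> F"
    and nz: "trop_graph E F A (minor_val E d B) Z \<noteq> 0"
    and c: "\<And>x. x \<in> F \<times> E \<Longrightarrow> A x \<noteq> 0 \<Longrightarrow> c x = c' x"
  shows "graph_poly E F d A B Z c = graph_poly E F d A B Z c'"
  unfolding graph_poly_def
proof (intro sum.cong refl)
  let ?J = "Inr -` Z"
  fix \<sigma> assume \<sigma>: "\<sigma> \<in> ?J \<rightarrow>\<^sub>E E"
  have J: "?J \<subseteq> F" using Z by auto
  have finJ: "finite ?J" using J fin(2) by (rule finite_subset)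
  show "graph_coeff E F d A B Z \<sigma> * (\<Prod>j\<in>?J. c (j, \<sigma> j)) = graph_coeff E F d A B Z \<sigma> * (\<Prod>j\<in>?J. c' (j, \<sigma> j))"
  proof (cases "graph_coeff E F d A B Z \<sigma> = 0")
    case False
    then have "(\<Prod>j\<in>?J. A (j, \<sigma> j)) \<noteq> 0" using nz by (auto simp: graph_coeff_def split: if_splits)
    then have "A (j, \<sigma> j) \<noteq> 0" if "j \<in> ?J" for j using that finJ by (simp add: idem_prod_eq_0_iff)
    then have "(\<Prod>j\<in>?J. c (j, \<sigma> j)) = (\<Prod>j\<in>?J. c' (j, \<sigma> j))"
      using J PiE_mem[OF \<sigma>] by (intro prod.cong refl c) auto
    then show ?thesis by simp
  qed simp
qed


section \<open>Polynomial functions\<close>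

definition poly_function :: "(('v \<Rightarrow> 'k::comm_semiring_1) \<Rightarrow> 'k) \<Rightarrow> bool" where
  "poly_function f \<longleftrightarrow> (\<exists>p. \<forall>c. poly_eval p c = f c)"

definition monom_eval :: "('v \<Rightarrow>\<^sub>0 nat) \<Rightarrow> ('v \<Rightarrow> 'k::comm_semiring_1) \<Rightarrow> 'k" where
  "monom_eval m c = (\<Prod>i\<in>Poly_Mapping.keys m. c i ^ Poly_Mapping.lookup m i)"

lemma poly_eval_superset:
  assumes "finite K" "Poly_Mapping.keys p \<subseteq> K"
  shows "poly_eval p c = (\<Sum>m\<in>K. Poly_Mapping.lookup p m * monom_eval m c)"
  unfolding poly_eval_def monom_eval_def
  using assms by (intro sum.mono_neutral_left) (auto simp: in_keys_iff)

lemma monom_eval_superset: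
  assumes "finite K" "Poly_Mapping.keys m \<subseteq> K"
  shows "monom_eval m c = (\<Prod>i\<in>K. c i ^ Poly_Mapping.lookup m i)"
  unfolding monom_eval_def
  using assms by (intro prod.mono_neutral_left) (auto simp: in_keys_iff)

lemma monom_eval_add: "monom_eval (m + m') c = monom_eval m c * monom_eval m' c"
proof -
  let ?K = "Poly_Mapping.keys m \<union> Poly_Mapping.keys m'"
  have K: "finite ?K" "Poly_Mapping.keys (m + m') \<subseteq> ?K" "Poly_Mapping.keys m \<subseteq> ?K" "Poly_Mapping.keys m' \<subseteq> ?K"
    using Poly_Mapping.keys_add[of m m'] by auto
  show ?thesis
    unfolding monom_eval_superset[OF K(1,2)] monom_eval_superset[OF K(1,3)] monom_eval_superset[OF K(1,4)]
    by (simp add: lookup_add power_add prod.distrib)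
qed

lemma poly_function_monom: "poly_function (\<lambda>c. a * monom_eval m c)"
  unfolding poly_function_def
proof (intro exI allI)
  fix c :: "'a \<Rightarrow> 'b"
  have "poly_eval (Poly_Mapping.single m a) c = (\<Sum>m'\<in>{m}. Poly_Mapping.lookup (Poly_Mapping.single m a) m' * monom_eval m' c)"
    by (rule poly_eval_superset) auto
  then show "poly_eval (Poly_Mapping.single m a) c = a * monom_eval m c" by simp
qed

lemma poly_function_const: "poly_function (\<lambda>_. a)"
  using poly_function_monom[of a 0] by (simp add: monom_eval_def)

lemma poly_function_var: "poly_function (\<lambda>c. c x)"
  using poly_function_monom[of 1 "Poly_Mapping.single x 1"] by (simp add: monom_eval_def)

lemma poly_function_add:
  assumes "poly_function f" "poly_function g"
  shows "poly_function (\<lambda>c. f c + g c)"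
proof -
  obtain p q where p: "\<And>c. poly_eval p c = f c" and q: "\<And>c. poly_eval q c = g c"
    using assms unfolding poly_function_def by auto
  let ?K = "Poly_Mapping.keys p \<union> Poly_Mapping.keys q"
  have K: "finite ?K" "Poly_Mapping.keys (p + q) \<subseteq> ?K" "Poly_Mapping.keys p \<subseteq> ?K" "Poly_Mapping.keys q \<subseteq> ?K"
    using Poly_Mapping.keys_add[of p q] by auto
  have "poly_eval (p + q) c = f c + g c" for c
    unfolding p[symmetric] q[symmetric] poly_eval_superset[OF K(1,2)] poly_eval_superset[OF K(1,3)]
      poly_eval_superset[OF K(1,4)]
    by (simp add: lookup_add distrib_right sum.distrib)
  then show ?thesis unfolding poly_function_def by blast
qed

lemma poly_function_sum:
  assumes "\<And>a. a \<in> A \<Longrightarrow> poly_function (f a)"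
  shows "poly_function (\<lambda>c. \<Sum>a\<in>A. f a c)"
  using assms
  by (induction A rule: infinite_finite_induct) (auto intro: poly_function_add poly_function_const)

lemma poly_function_mult:
  assumes "poly_function f" "poly_function g"
  shows "poly_function (\<lambda>c. f c * g c)"
proof -
  obtain p q where p: "\<And>c. poly_eval p c = f c" and q: "\<And>c. poly_eval q c = g c"
    using assms unfolding poly_function_def by auto
  let ?P = "Poly_Mapping.keys p" and ?Q = "Poly_Mapping.keys q"
  have "f c * g c = (\<Sum>m\<in>?P. \<Sum>m'\<in>?Q.
      (Poly_Mapping.lookup p m * Poly_Mapping.lookup q m') * monom_eval (m + m') c)" for c
    unfolding p[symmetric] q[symmetric] poly_eval_superset[OF finite_keys subset_refl] sum_product monom_eval_add
    by (simp add: ac_simps)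
  then show ?thesis by (simp add: poly_function_sum poly_function_monom)
qed

lemma poly_function_prod:
  assumes "\<And>a. a \<in> A \<Longrightarrow> poly_function (f a)"
  shows "poly_function (\<lambda>c. \<Prod>a\<in>A. f a c)"
  using assms
  by (induction A rule: infinite_finite_induct) (auto intro: poly_function_mult poly_function_const)

lemma zariski_open_nonvanishing:
  assumes "poly_function f"
  shows "zariski_open X {c \<in> coord_space X. f c \<noteq> 0}"
proof -
  obtain p where "\<And>c. poly_eval p c = f c" using assms unfolding poly_function_def by auto
  then show ?thesis unfolding zariski_open_def by (intro exI[of _ "{p}"]) auto
qed

lemma poly_function_graph_poly: "poly_function (graph_poly E F d A B Z)"
  unfolding graph_poly_def[abs_def]
  by (intro poly_function_sum poly_function_mult poly_function_prod poly_function_const poly_function_var)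


section \<open>Tropical images of realizable spaces\<close>

text \<open>
  This makes the bound on the size of \<open>\<kappa>\<close> in the theorem suffice for \<open>trop_row_space\<close>.
\<close>

lemma choose_ge_codim: "1 \<le> d \<Longrightarrow> d \<le> n \<Longrightarrow> n - d + 1 \<le> n choose d"
proof (induction n arbitrary: d)
  case (Suc m)
  then obtain e where d: "d = Suc e" by (cases d) auto
  show ?case
  proof (cases "e = 0 \<or> e = m")
    case False
    then have "m - (Suc e) + 1 \<le> m choose (Suc e)" using Suc d by simp
    moreover have "0 < m choose e" using Suc.prems d by simp
    moreover have "Suc m choose d = (m choose e) + (m choose Suc e)" by (simp add: d)
    moreover have "Suc m - d = Suc (m - Suc e)" using False Suc.prems d by arith
    ultimately show ?thesis by linarith
  qed (use d in auto)
qed simp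

lemma graph_row_space_projection:
  assumes fin: "finite E" and \<Delta>: "\<Delta> \<in> coord_space (F \<times> E)"
  shows "(\<lambda>x j. x (Inr j)) ` row_space (E <+> F) d (graph_cols E \<Delta> B) = matrix_image E \<Delta> (row_space E d B)"
proof -
  have entry: "(\<Sum>r<d. c r * graph_cols E \<Delta> B (Inr j) r) = (\<Sum>i\<in>E. \<Delta> (j, i) * (\<Sum>r<d. c r * B i r))" for c j
  proof -
    have "(\<Sum>r<d. c r * graph_cols E \<Delta> B (Inr j) r) = (\<Sum>r<d. \<Sum>i\<in>E. \<Delta> (j, i) * (c r * B i r))"
      by (simp add: graph_cols_def sum_distrib_left ac_simps)
    also have "\<dots> = (\<Sum>i\<in>E. \<Delta> (j, i) * (\<Sum>r<d. c r * B i r))"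
      by (subst sum.swap) (simp add: sum_distrib_left)
    finally show ?thesis .
  qed
  have \<Delta>0: "\<Delta> (j, i) = 0" if "j \<notin> F" for i j using \<Delta> that by (simp add: coord_space_def)
  show ?thesis
  proof (intro subset_antisym subsetI)
    fix y assume "y \<in> (\<lambda>x j. x (Inr j)) ` row_space (E <+> F) d (graph_cols E \<Delta> B)"
    then obtain x c where y: "y = (\<lambda>j. x (Inr j))" and x: "x \<in> coord_space (E <+> F)"
      and c: "\<forall>k\<in>E <+> F. x k = (\<Sum>r<d. c r * graph_cols E \<Delta> B k r)"
      unfolding row_space_def by auto
    let ?v = "\<lambda>i. x (Inl i)"
    have xE: "?v i = (\<Sum>r<d. c r * B i r)" if "i \<in> E" for i
      using bspec[OF c, of "Inl i"] that by (simp add: graph_cols_def InlI)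
    have "?v \<in> coord_space E" using x by (auto simp: coord_space_def)
    then have "?v \<in> row_space E d B"
      unfolding row_space_def by (intro CollectI conjI exI[of _ c] ballI xE)
    moreover have "y = (\<lambda>j. \<Sum>i\<in>E. \<Delta> (j, i) * ?v i)"
    proof
      fix j
      show "y j = (\<Sum>i\<in>E. \<Delta> (j, i) * ?v i)"
      proof (cases "j \<in> F")
        case True
        then have "y j = (\<Sum>i\<in>E. \<Delta> (j, i) * (\<Sum>r<d. c r * B i r))"
          using bspec[OF c, of "Inr j"] by (simp add: y entry InrI)
        then show ?thesis by (simp add: xE)
      next
        case False
        then show ?thesis using x by (auto simp: y \<Delta>0 coord_space_def)
      qed
    qed
    ultimately show "y \<in> matrix_image E \<Delta> (row_space E d B)"
      unfolding matrix_image_def by (intro image_eqI[where x = ?v])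
  next
    fix y assume "y \<in> matrix_image E \<Delta> (row_space E d B)"
    then obtain v c where y: "y = (\<lambda>j. \<Sum>i\<in>E. \<Delta> (j, i) * v i)" and v: "v \<in> coord_space E"
      and c: "\<And>i. i \<in> E \<Longrightarrow> v i = (\<Sum>r<d. c r * B i r)"
      unfolding matrix_image_def row_space_def by auto
    let ?x = "case_sum v y"
    have "?x k = (\<Sum>r<d. c r * graph_cols E \<Delta> B k r)" if k: "k \<in> E <+> F" for k
    proof (cases k)
      case (Inl i)
      then have "i \<in> E" using k by auto
      then show ?thesis using Inl c by (simp add: graph_cols_def)
    next
      case (Inr j)
      have "y j = (\<Sum>i\<in>E. \<Delta> (j, i) * (\<Sum>r<d. c r * B i r))" unfolding y using c by simp
      then show ?thesis using Inr by (simp add: entry)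
    qed
    moreover have "?x \<in> coord_space (E <+> F)"
      unfolding coord_space_def
    proof (intro CollectI allI impI)
      fix k assume "k \<notin> E <+> F"
      then show "?x k = 0"
      proof (cases k)
        case (Inr j)
        then have "j \<notin> F" using \<open>k \<notin> E <+> F\<close> by auto
        then show ?thesis using Inr by (simp add: y \<Delta>0)
      qed (use v in \<open>auto simp: coord_space_def\<close>)
    qed
    ultimately have "?x \<in> row_space (E <+> F) d (graph_cols E \<Delta> B)"
      unfolding row_space_def by (intro CollectI conjI exI[of _ c] ballI)
    then show "y \<in> (\<lambda>x j. x (Inr j)) ` row_space (E <+> F) d (graph_cols E \<Delta> B)"
      by (intro image_eqI[of _ _ ?x]) auto
  qed
qed

text \<open>
  Pluecker vectors of the same space are proportional, so the tropical graphs formed with them agree.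
\<close>

lemma tropim_eq:
  assumes fin: "finite E" "finite F" and w: "trop_plucker E d w"
  shows "tropim E F A (plucker_space E d w) =
    (\<lambda>v j. v (Inr j)) ` plucker_space (E <+> F) d (trop_graph E F A w)"
  unfolding tropim_def
proof (rule the_equality)
  show "\<exists>d' w'. trop_plucker E d' w' \<and> plucker_space E d w = plucker_space E d' w' \<and>
      (\<lambda>v j. v (Inr j)) ` plucker_space (E <+> F) d (trop_graph E F A w) =
      (\<lambda>v j. v (Inr j)) ` plucker_space (E <+> F) d' (trop_graph E F A w')"
    using w by (intro exI[of _ d] exI[of _ w]) simp
next
  fix M :: "('b \<Rightarrow> 'c) set"
  assume "\<exists>d' w'. trop_plucker E d' w' \<and> plucker_space E d w = plucker_space E d' w' \<and>
      M = (\<lambda>v j. v (Inr j)) ` plucker_space (E <+> F) d' (trop_graph E F A w')"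
  then obtain d' w' where w': "trop_plucker E d' w'" and eq: "plucker_space E d w = plucker_space E d' w'"
    and M: "M = (\<lambda>v j. v (Inr j)) ` plucker_space (E <+> F) d' (trop_graph E F A w')"
    by (elim exE conjE)
  have d': "d' = d" by (rule plucker_space_determines_vector(1)[OF fin(1) w w' eq])
  obtain c where c: "c \<noteq> 0" "\<And>I. w' I = c * w I"
    using plucker_space_determines_vector(2)[OF fin(1) w w' eq] by auto
  then have "w' = (\<lambda>I. c * w I)" by auto
  then have "plucker_space (E <+> F) d (trop_graph E F A w') = plucker_space (E <+> F) d (trop_graph E F A w)"
    using fin c(1) by (intro plucker_space_scale[of c]) (simp_all add: trop_graph_scale)
  then show "M = (\<lambda>v j. v (Inr j)) ` plucker_space (E <+> F) d (trop_graph E F A w)"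
    by (simp add: M d')
qed

lemma linear_subspace_matrix_image:
  assumes \<Lambda>: "linear_subspace E \<Lambda>" and \<Delta>: "\<Delta> \<in> coord_space (F \<times> E)"
  shows "linear_subspace F (matrix_image E \<Delta> \<Lambda>)"
proof -
  let ?T = "\<lambda>v j. \<Sum>i\<in>E. \<Delta> (j, i) * v i"
  have sub: "coord.subspace \<Lambda>" using \<Lambda> by (simp add: linear_subspace_def)
  have "matrix_image E \<Delta> \<Lambda> \<subseteq> coord_space F"
    using \<Delta> by (auto simp: matrix_image_def coord_space_def)
  moreover have "coord.subspace (matrix_image E \<Delta> \<Lambda>)"
    unfolding matrix_image_def
  proof (rule coord.subspaceI)
    have "?T 0 = 0" by auto
    then show "0 \<in> ?T ` \<Lambda>" using coord.subspace_0[OF sub] by force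
  next
    fix x y assume "x \<in> ?T ` \<Lambda>" "y \<in> ?T ` \<Lambda>"
    then obtain u v where uv: "u \<in> \<Lambda>" "v \<in> \<Lambda>" and xy: "x = ?T u" "y = ?T v" by blast
    have sum_eq: "x + y = ?T (u + v)" unfolding xy by (auto simp: sum.distrib distrib_left)
    show "x + y \<in> ?T ` \<Lambda>" unfolding sum_eq using coord.subspace_add[OF sub uv] by (rule imageI)
  next
    fix a x assume "x \<in> ?T ` \<Lambda>"
    then obtain u where u: "u \<in> \<Lambda>" and x: "x = ?T u" by blast
    have scale_eq: "cscale a x = ?T (cscale a u)"
      unfolding x by (auto simp: cscale_def sum_distrib_left ac_simps)
    show "cscale a x \<in> ?T ` \<Lambda>" unfolding scale_eq using coord.subspace_scale[OF sub u] by (rule imageI)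
  qed
  ultimately show ?thesis by (simp add: linear_subspace_def)
qed

lemma dim_matrix_image_row_space_le: "coord.dim (matrix_image E \<Delta> (row_space E d B)) \<le> d"
proof -
  define u where "u r j = (\<Sum>i\<in>E. \<Delta> (j, i) * B i r)" for r j
  have "matrix_image E \<Delta> (row_space E d B) \<subseteq> coord.span (u ` {..<d})"
  proof
    fix y assume "y \<in> matrix_image E \<Delta> (row_space E d B)"
    then obtain v c where y: "y = (\<lambda>j. \<Sum>i\<in>E. \<Delta> (j, i) * v i)"
      and c: "\<And>i. i \<in> E \<Longrightarrow> v i = (\<Sum>r<d. c r * B i r)"
      unfolding matrix_image_def row_space_def by auto
    have "y = (\<Sum>r<d. cscale (c r) (u r))"
    proof
      fix j
      have "y j = (\<Sum>i\<in>E. \<Sum>r<d. c r * (\<Delta> (j, i) * B i r))"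
        by (simp add: y c sum_distrib_left ac_simps)
      also have "\<dots> = (\<Sum>r<d. c r * u r j)"
        by (subst sum.swap) (simp add: u_def sum_distrib_left)
      finally show "y j = (\<Sum>r<d. cscale (c r) (u r)) j" by (simp add: sum_fun_apply cscale_def)
    qed
    also have "\<dots> \<in> coord.span (u ` {..<d})"
      by (intro coord.span_sum coord.span_scale coord.span_base) auto
    finally show "y \<in> coord.span (u ` {..<d})" .
  qed
  then have "coord.dim (matrix_image E \<Delta> (row_space E d B)) \<le> card (u ` {..<d})"
    by (rule coord.dim_le_card) simp
  also have "\<dots> \<le> d" using card_image_le[of "{..<d}" u] by simp
  finally show ?thesis .
qed

lemma subspace_presentation:
  fixes \<Lambda> :: "('x \<Rightarrow> ('s::idem_semifield, 'k::field) hahn) set"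
  assumes "finite X" "linear_subspace X \<Lambda>"
  obtains B I where "\<Lambda> = row_space X (coord.dim \<Lambda>) B" "minor_val X (coord.dim \<Lambda>) B I \<noteq> 0"
    "I \<subseteq> X" "card I = coord.dim \<Lambda>"
proof -
  let ?d = "coord.dim \<Lambda>"
  obtain B f where B: "\<Lambda> = row_space X ?d B" "inj_on f {..<?d}"
    "f ` {..<?d} \<subseteq> X" "vec_det ?d (\<lambda>s. B (f s)) = 1"
    using linear_subspace_row_space[OF assms] by blast
  have "minor_val X ?d B (f ` {..<?d}) = 1"
    using minor_val_eq[OF inj_on_imp_bij_betw[OF B(2)] B(3), of B] B(4) by simp
  moreover have "card (f ` {..<?d}) = ?d" using card_image[OF B(2)] by simp
  ultimately show ?thesis using B by (intro that[of B "f ` {..<?d}"]) auto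
qed

theorem theorem4p12:
  fixes E :: "'e set" and F :: "'f set" and d :: nat
    and \<Lambda> :: "('e \<Rightarrow> ('s::idem_semifield, 'k::field) hahn) set"
    and A :: "'f \<times> 'e \<Rightarrow> 's"
  assumes "finite E" and "finite F"
    and "linear_subspace E \<Lambda>" and "coord.dim \<Lambda> = d"
    and "A \<in> coord_space (F \<times> E)"
    and "infinite (UNIV :: 'k set) \<or> card (UNIV :: 'k set) > (card E + card F) choose d"
  shows "realizable TYPE('k) F (tropim E F A (trop \<Lambda>)) \<and>
    (\<exists>U :: ('f \<times> 'e \<Rightarrow> 'k) set. zariski_open (F \<times> E) U \<and> U \<noteq> {} \<and>
       (\<exists>\<Delta> :: 'f \<times> 'e \<Rightarrow> ('s, 'k) hahn. \<Delta> \<in> val_fibre F E A \<and> lead_coeffs \<Delta> \<in> U) \<and>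
       (\<forall>\<Delta> :: 'f \<times> 'e \<Rightarrow> ('s, 'k) hahn. \<Delta> \<in> val_fibre F E A \<and> lead_coeffs \<Delta> \<in> U \<longrightarrow>
          tropim E F A (trop \<Lambda>) = trop (matrix_image E \<Delta> \<Lambda>)))"
proof -
  note fin = assms(1,2)
  obtain B I0 where \<Lambda>: "\<Lambda> = row_space E d B" and I0: "minor_val E d B I0 \<noteq> 0" "I0 \<subseteq> E" "card I0 = d"
    using subspace_presentation[OF assms(1,3)] unfolding assms(4) by blast
  let ?w = "minor_val E d B" and ?V = "E <+> F"
  let ?g = "trop_graph E F A ?w" and ?B = "\<lambda>\<Delta>. graph_cols E \<Delta> B"
  have finV: "finite ?V" and cardV: "card ?V = card E + card F" using fin by (auto simp: card_Plus)
  have d_le: "d \<le> card E" using card_mono[OF fin(1) I0(2)] I0(3) by simp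
  (* The field is large enough to tropicalize \<Lambda>, its graph and the image: their codimensions are at
     most that of the graph. *)
  have large: "d' = 0 \<or> infinite (UNIV :: 'k set) \<or> n - d' + 1 < card (UNIV :: 'k set)"
    if "n - d' \<le> card E + card F - d" "d' \<le> d" for n d'
  proof (cases "d' = 0")
    case False
    then have "card E + card F - d + 1 \<le> (card E + card F) choose d"
      using that d_le by (intro choose_ge_codim) auto
    then show ?thesis using assms(6) that(1) by linarith
  qed simp
  have w: "trop_plucker E d ?w" using I0(1) by (intro trop_plucker_minor_val) blast
  have "trop \<Lambda> = plucker_space E d ?w"
    unfolding \<Lambda> by (rule trop_row_space) (use fin I0 large[of "card E" d] in auto)
  then have tropim: "tropim E F A (trop \<Lambda>) = (\<lambda>v j. v (Inr j)) ` plucker_space ?V d ?g"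
    using tropim_eq[OF fin w] by simp

  define T where "T = {Z. Z \<subseteq> ?V \<and> card Z = d \<and> Inr -` Z \<noteq> {} \<and> ?g Z \<noteq> 0}"
  have finT: "finite T" unfolding T_def using finV by simp
  define U where "U = {c \<in> coord_space (F \<times> E). (\<Prod>Z\<in>T. graph_poly E F d A B Z c) \<noteq> 0}"
  have open_U: "zariski_open (F \<times> E) U"
    unfolding U_def by (intro zariski_open_nonvanishing poly_function_prod poly_function_graph_poly)

  have main: "tropim E F A (trop \<Lambda>) = trop (matrix_image E \<Delta> \<Lambda>)"
    if \<Delta>: "\<Delta> \<in> val_fibre F E A" "lead_coeffs \<Delta> \<in> U" for \<Delta> :: "'f \<times> 'e \<Rightarrow> ('s, 'k) hahn"
  proof -
    have nonvanish: "graph_poly E F d A B Z (lead_coeffs \<Delta>) \<noteq> 0" if "Z \<in> T" for Z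
      using \<Delta>(2) finT that by (simp add: U_def)
    have minors: "minor_val ?V d (?B \<Delta>) Z = ?g Z" if "Z \<subseteq> ?V" "card Z = d" for Z
      using that by (intro minor_val_graph_cols fin \<Delta>(1) nonvanish) (auto simp: T_def)
    (* The graph projects isomorphically to \<Lambda>, so a nonzero minor of \<Lambda> is one of the graph. *)
    have Inl_I0: "Inl ` I0 = I0 <+> ({} :: 'f set)" by auto
    have "?g (Inl ` I0) = ?w I0"
      unfolding Inl_I0 using trop_graph_eq_sum[OF fin I0(2) empty_subsetI, of A ?w] by (simp add: graph_weight_def)
    moreover have "minor_val ?V d (?B \<Delta>) (Inl ` I0) = ?g (Inl ` I0)"
      using I0 by (intro minors) (auto simp: card_image)
    ultimately have "\<exists>Z. minor_val ?V d (?B \<Delta>) Z \<noteq> 0" using I0(1) by metis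
    then have "trop (row_space ?V d (?B \<Delta>)) = plucker_space ?V d (minor_val ?V d (?B \<Delta>))"
      using large[of "card ?V" d] cardV by (intro trop_row_space finV) auto
    also have "\<dots> = plucker_space ?V d ?g"
      by (rule plucker_space_scale[of 1]) (auto simp: minors)
    finally have "tropim E F A (trop \<Lambda>) = (\<lambda>v j. v (Inr j)) ` trop (row_space ?V d (?B \<Delta>))"
      by (simp add: tropim)
    also have "\<dots> = trop ((\<lambda>x j. x (Inr j)) ` row_space ?V d (?B \<Delta>))"
      by (simp add: trop_def image_image)
    also have "\<dots> = trop (matrix_image E \<Delta> \<Lambda>)"
      using graph_row_space_projection[OF fin(1), of \<Delta> F d B] \<Delta>(1) by (simp add: val_fibre_def \<Lambda>)
    finally show ?thesis .
  qed

  obtain c0 where c0: "\<And>x. x \<in> F \<times> E \<Longrightarrow> c0 x \<noteq> 0" "\<And>Z. Z \<in> T \<Longrightarrow> graph_poly E F d A B Z c0 \<noteq> 0"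
    using exists_generic_leading_coeffs[OF fin I0(2,3) assms(6), of A B] unfolding T_def by auto
  (* A series of valuation 0 has leading coefficient 0; the polynomials do not involve these entries. *)
  define c where "c x = (if A x = 0 then 0 else c0 x)" for x
  define \<Delta> :: "'f \<times> 'e \<Rightarrow> ('s, 'k) hahn" where "\<Delta> x = hmonom (c x) (inverse (A x))" for x
  have A0: "A x = 0" if "x \<notin> F \<times> E" for x using assms(5) that unfolding coord_space_def by blast
  have zero: "\<Delta> x = 0" if "A x = 0" for x
    using that by (intro hahn_eqI) (simp add: \<Delta>_def hcoeff_monom idem_inverse_zero)
  have val: "hval (\<Delta> x) = A x" and lc: "hlc (\<Delta> x) = c x" for x
  proof -
    have "hval (\<Delta> x) = A x \<and> hlc (\<Delta> x) = c x"
    proof (cases "A x = 0")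
      case True
      then show ?thesis using zero[OF True] by (simp add: c_def)
    next
      case False
      then have "x \<in> F \<times> E" using A0 by blast
      then have "c x \<noteq> 0" using False c0(1) by (simp add: c_def)
      then show ?thesis using False by (simp add: \<Delta>_def hval_hmonom hlc_hmonom)
    qed
    then show "hval (\<Delta> x) = A x" "hlc (\<Delta> x) = c x" by auto
  qed
  have fibre: "\<Delta> \<in> val_fibre F E A" using zero A0 val by (simp add: val_fibre_def coord_space_def)
  have lead: "lead_coeffs \<Delta> = c" using lc by (auto simp: lead_coeffs_def)
  have "graph_poly E F d A B Z c = graph_poly E F d A B Z c0" if "Z \<in> T" for Z
    by (rule graph_poly_cong[OF fin]) (use that in \<open>auto simp: T_def c_def\<close>)
  then have "c \<in> U" using A0 c0(2) finT by (simp add: U_def coord_space_def c_def)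
  then have \<Delta>U: "lead_coeffs \<Delta> \<in> U" by (simp add: lead)

  (* That the tropical image is a tropical linear space is seen from any generic \<Delta>, by presenting
     the image of \<Lambda> itself as a row space. *)
  let ?M = "matrix_image E \<Delta> \<Lambda>"
  have coordD: "\<Delta> \<in> coord_space (F \<times> E)" using fibre by (simp add: val_fibre_def)
  have M: "linear_subspace F ?M" by (rule linear_subspace_matrix_image[OF assms(3) coordD])
  obtain B' I' where B': "?M = row_space F (coord.dim ?M) B'" "minor_val F (coord.dim ?M) B' I' \<noteq> 0"
    "I' \<subseteq> F" "card I' = coord.dim ?M" by (rule subspace_presentation[OF fin(2) M])
  have dM: "coord.dim ?M \<le> d" unfolding \<Lambda> by (rule dim_matrix_image_row_space_le)
  have "trop (row_space F (coord.dim ?M) B') = plucker_space F (coord.dim ?M) (minor_val F (coord.dim ?M) B')"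
    using B'(2) large[of "card F" "coord.dim ?M"] dM d_le by (intro trop_row_space fin) auto
  moreover have "trop_plucker F (coord.dim ?M) (minor_val F (coord.dim ?M) B')"
    using B'(2) by (intro trop_plucker_minor_val) blast
  ultimately have "trop_linear_space F (trop ?M)"
    unfolding trop_linear_space_def
    by (intro exI[of _ "coord.dim ?M"] exI[of _ "minor_val F (coord.dim ?M) B'"]) (simp flip: B'(1))
  then have "realizable TYPE('k) F (tropim E F A (trop \<Lambda>))"
    unfolding realizable_def main[OF fibre \<Delta>U] using M by blast
  then show ?thesis using open_U main fibre \<Delta>U by blast
qed

end
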